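(* Let $\mathcal X,\mathcal Y=\{y_1,y_2,\dots\}$ be countable sets, $\lambda>0$, and let $c\colon\mathcal X\times\mathcal Y\to\mathbb R$ admit dominating functions $c_{\mathcal X}^\pm,c_{\mathcal Y}^\pm$ with $\|c_{\mathcal X}^+-c_{\mathcal X}^-\|_{\ell^\infty(\mathcal X)}<\infty$ and weights $\mathcal C_{\mathcal X},\mathcal C_{\mathcal Y},\phi_{\mathcal X},\phi_{\mathcal Y}$; put $\Phi^4_{\mathcal Y}=\mathcal C_{\mathcal Y}\phi_{\mathcal Y}^4$. Let $r\in\mathcal P(\mathcal X)$, $s\in\mathcal P(\mathcal Y)$ both have full support, with $\mathcal C_{\mathcal X}\in\ell^1_r(\mathcal X)$ and $\Phi^4_{\mathcal Y}\in\ell^1_s(\mathcal Y)$. Then the EROT plan, viewed as a map $$\pi^\lambda\colon\big(\mathcal P(\mathcal X)\cap\ell^1_{\mathcal C_{\mathcal X}}(\mathcal X)\big)\times\big(\mathcal P(\mathcal Y)\cap\ell^1_{\Phi^4_{\mathcal Y}}(\mathcal Y)\big)\to\ell^1_{\mathcal C_{\mathcal X}\oplus\mathcal C_{\mathcal Y}}(\mathcal X\times\mathcal Y),$$ is Hadamard differentiable at $(r,s)$ tangentially to $\big(\mathcal P(\mathcal X)\cap\ell^1_{\mathcal C_{\mathcal X}}(\mathcal X)\big)\times\big(\mathcal P(\mathcal Y)\cap\ell^1_{\Phi^4_{\mathcal Y}}(\mathcal Y)\big)$, with Hadamard derivative $\mathcal D^H_{|(r,s)}\pi^\lambda$ given on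 the contingent cone at $(r,s)$ by $$(h^{\mathcal X},h^{\mathcal Y})\mapsto\Big(-\big[\mathcal D_{\pi,\alpha,\beta_*}\mathcal F\big]^{-1}_\pi\circ\mathcal D_{r,s_*}\mathcal F\Big)(h^{\mathcal X},h^{\mathcal Y}_* )$$ $$=\frac{\pi^\lambda}{r\otimes s}\odot\big[r\otimes h^{\mathcal Y}+h^{\mathcal X}\otimes s\big]-\pi^\lambda\odot A_*^T\begin{pmatrix} (\mathrm{Id}-\mathcal A^{\mathcal X}\mathcal A^{\mathcal Y})^{-1} & -(\mathrm{Id}-\mathcal A^{\mathcal X}\mathcal A^{\mathcal Y})^{-1}\mathcal A^{\mathcal X} \\ -\mathcal A^{\mathcal Y}(\mathrm{Id}-\mathcal A^{\mathcal X}\mathcal A^{\mathcal Y})^{-1} & (\mathrm{Id}-\mathcal A^{\mathcal Y}\mathcal A^{\mathcal X})^{-1} \end{pmatrix}\begin{pmatrix} 0 & \mathcal B^{\mathcal X} \\ \mathcal B^{\mathcal Y} & 0 \end{pmatrix}\begin{pmatrix} h^{\mathcal X} \\ h^{\mathcal Y} \end{pmatrix},$$ where $\pi^\lambda=\pi^\lambda(r,s)$ and the partial derivatives of $\mathcal F$ are taken at $(\pi^\lambda,\alpha^\lambda,\beta^\lambda_*,r,s_* )$. The derivative is a well-defined bounded operator, and the contingent cone at $(r,s)$ with respect to $\ell^1_{\mathcal C_{\mathcal X}}(\mathcal X)\times\ell^1_{\Phi^4_{\mathcal Y}}(\mathcal Y)$ is $$\Big\{h^{\mathcal X}\in\ell^1_{\mathcal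 C_{\mathcal X}}(\mathcal X):\sum_{x}h^{\mathcal X}_x=0\Big\}\times\Big\{h^{\mathcal Y}\in\ell^1_{\Phi^4_{\mathcal Y}}(\mathcal Y):\sum_yh^{\mathcal Y}_y=0\Big\}.$$
   Context: $\mathcal P(\mathcal X)$: probability measures $r=(r_x)$ on $\mathcal X$; $\ell^1_r(\mathcal X)$: functions with finite expectation under $r$. For a positive function $f$ on a countable set $Z$: $\ell^1_f(Z)$ has norm $\sum_zf(z)|a_z|$, $\ell^\infty_f(Z)$ has norm $\sup_z|b_z|/f(z)$. $(\mathcal C_{\mathcal X}\oplus\mathcal C_{\mathcal Y})(x,y)=\mathcal C_{\mathcal X}(x)+\mathcal C_{\mathcal Y}(y)$; $(r\otimes s)_{xy}=r_xs_y$; $\odot$ and fractions are componentwise. EROT: $\Pi(r,s)$ is the set of couplings; $M(\pi)=\sum_{x,y}\pi_{xy}\log(\pi_{xy}/(r_xs_y))$; the EROT plan $\pi^\lambda(r,s)$ is the unique minimizer of $\langle c,\pi\rangle+\lambda M(\pi)$ over $\Pi(r,s)$. EROT potentials $(\alpha^\lambda,\beta^\lambda)\in\ell^1_r(\mathcal X)\times\ell^1_s(\mathcal Y)$ are the maximizers of $\langle\alpha,r\rangle+\langle\beta,s\rangle-\lambda\sum_{x,y}[\exp((\alpha_x+\beta_y-c(x,y))/\lambda)r_xs_y-r_xs_y]$, here normalized by $\beta^\lambda_{y_1}=0$; they satisfy $\pi^\lambda_{xy}=\exp((\alpha^\lambda_x+\beta^\lambda_y-c(x,y))/\lambda)r_xs_y$.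 Dominating functions for $c$: real functions $c_{\mathcal X}^-\le c_{\mathcal X}^+$ on $\mathcal X$, $c_{\mathcal Y}^-\le c_{\mathcal Y}^+$ on $\mathcal Y$ with $c_{\mathcal X}^-(x)+c_{\mathcal Y}^-(y)\le c(x,y)\le c_{\mathcal X}^+(x)+c_{\mathcal Y}^+(y)$. Weights: $\mathcal C_{\mathcal X}=1+|c_{\mathcal X}^+|+|c_{\mathcal X}^-|$, $\mathcal C_{\mathcal Y}=1+|c_{\mathcal Y}^+|+|c_{\mathcal Y}^-|$, $\phi_{\mathcal X}=\exp((c_{\mathcal X}^+-c_{\mathcal X}^-)/\lambda)$, $\phi_{\mathcal Y}=\exp((c_{\mathcal Y}^+-c_{\mathcal Y}^-)/\lambda)$. For a family indexed by $\mathcal Y$, the subscript $*$ means omitting the entry at the fixed element $y_1$. $A_*\colon\ell^1(\mathcal X\times\mathcal Y)\to\ell^1(\mathcal X)\times\ell^1(\mathcal Y\setminus\{y_1\})$, $A_*(\pi)=\big((\sum_y\pi_{xy})_x,(\sum_x\pi_{xy})_{y\ne y_1}\big)$. $A_*^T\colon\mathbb R^{\mathcal X}\times\mathbb R^{\mathcal Y\setminus\{y_1\}}\to\mathbb R^{\mathcal X\times\mathcal Y}$, $A_*^T(a,b_* )_{xy}=a_x+b_{*,y}$ for $y\ne y_1$ and $=a_x$ for $y=y_1$. $\mathcal F\big((\pi,\alpha,\beta_* ),(r,s_* )\big)=\big(\pi-\exp(\tfrac1\lambda[A_*^T(\alpha,\beta_* )-c])\odot(r\otimes s),\ A_*(\pi)-(r,s_*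 )\big)$ with $s_{y_1}=1-\sum_{y\ne y_1}s_{*,y}$. Its formal partial derivatives at $(\pi^\lambda,\alpha^\lambda,\beta_*^\lambda,r,s_* )$ are $\mathcal D_{r,s_*}\mathcal F(h^{\mathcal X},h^{\mathcal Y}_* )=\big(-\tfrac{\pi^\lambda}{r\otimes s}\odot(r\otimes h^{\mathcal Y}+h^{\mathcal X}\otimes s),\,-h^{\mathcal X},\,-h^{\mathcal Y}_*\big)$ with $h^{\mathcal Y}_{y_1}=-\sum_{y\ne y_1}h^{\mathcal Y}_{*,y}$, and $\mathcal D_{\pi,\alpha,\beta_*}\mathcal F(H,a,b_* )=\big(H-\tfrac1\lambda\pi^\lambda\odot A_*^T(a,b_* ),\,A_*(H)\big)$. $[\mathcal D_{\pi,\alpha,\beta_*}\mathcal F]^{-1}_\pi$ is the $\pi$-component of the inverse (the component $H$ of the unique solution $(H,a,b_* )\in\ell^1_{\mathcal C_{\mathcal X}\oplus\mathcal C_{\mathcal Y}}(\mathcal X\times\mathcal Y)\times\ell^\infty(\mathcal X)\times\ell^\infty_{\phi_{\mathcal Y}}(\mathcal Y\setminus\{y_1\})$). Operators (with $\pi=\pi^\lambda(r,s)$): $\mathcal A^{\mathcal X}\colon\ell^\infty_{\phi_{\mathcal Y}}(\mathcal Y\setminus\{y_1\})\to\ell^\infty(\mathcal X)$, $(\mathcal A^{\mathcal X}b)_x=\sum_{y\ne y_1}\frac{\pi_{xy}}{r_x}b_y$; $\mathcal A^{\mathcal Y}\colon\ell^\infty(\mathcal X)\to\ell^\infty_{\phi_{\mathcal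 Y}}(\mathcal Y\setminus\{y_1\})$, $(\mathcal A^{\mathcal Y}a)_y=\sum_x\frac{\pi_{xy}}{s_y}a_x$; $\mathcal B^{\mathcal X}\colon\ell^1_{\Phi^4_{\mathcal Y}}(\mathcal Y)\to\ell^\infty(\mathcal X)$, $(\mathcal B^{\mathcal X}h)_x=\sum_{y\in\mathcal Y}\frac{\pi_{xy}}{r_xs_y}h_y$; $\mathcal B^{\mathcal Y}\colon\ell^1_{\mathcal C_{\mathcal X}}(\mathcal X)\to\ell^\infty_{\phi_{\mathcal Y}}(\mathcal Y\setminus\{y_1\})$, $(\mathcal B^{\mathcal Y}h)_y=\sum_x\frac{\pi_{xy}}{r_xs_y}h_x$. Hadamard differentiability: a map $\Psi\colon U_0\to V$, $U_0\subseteq U$, $U,V$ normed, is Hadamard differentiable at $u\in U_0$ tangentially to $U_0$ if there is a continuous linear map $\mathcal D^H_{|u}\Psi$ such that $\|t_n^{-1}(\Psi(u+t_nh_n)-\Psi(u))-\mathcal D^H_{|u}\Psi(h)\|_V\to0$ for all $t_n\searrow0$ and all $h_n=t_n^{-1}(k_n-u)$, $k_n\in U_0$, converging to $h$; the derivative is defined on the contingent cone $T_u(U_0)$ of all such limits $h$. *)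

theory Defs
  imports "HOL-Analysis.Analysis" "HOL-Library.Function_Algebras"
begin

text \<open>Families of reals form a real vector space under the pointwise operations; with
  \<^theory>\<open>HOL-Library.Function_Algebras\<close>, \<open>*\<close> is the componentwise product.\<close>

instantiation "fun" :: (type, real_vector) real_vector
begin

definition scaleR_fun :: "real \<Rightarrow> ('a \<Rightarrow> 'b) \<Rightarrow> 'a \<Rightarrow> 'b"
  where "scaleR_fun a f = (\<lambda>x. a *\<^sub>R f x)"

instance
  by standard (auto simp: scaleR_fun_def fun_eq_iff scaleR_add_right scaleR_add_left)

end


section \<open>Weighted sequence spaces\<close>

text \<open>A family indexed by a subset \<open>Z\<close> of the index type is represented by its extension by zero,
  so that, for example, \<open>- {y1}\<close> plays the role of \<open>Y\<close> without the point \<open>y1\<close>.\<close>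

definition l1_space :: "('a \<Rightarrow> real) \<Rightarrow> 'a set \<Rightarrow> ('a \<Rightarrow> real) set"
  where "l1_space f Z = {a. (\<forall>z. z \<notin> Z \<longrightarrow> a z = 0) \<and> (\<lambda>z. f z * \<bar>a z\<bar>) summable_on Z}"

definition l1_norm :: "('a \<Rightarrow> real) \<Rightarrow> 'a set \<Rightarrow> ('a \<Rightarrow> real) \<Rightarrow> real"
  where "l1_norm f Z a = (\<Sum>\<^sub>\<infinity>z\<in>Z. f z * \<bar>a z\<bar>)"

definition linf_space :: "('a \<Rightarrow> real) \<Rightarrow> 'a set \<Rightarrow> ('a \<Rightarrow> real) set"
  where "linf_space f Z = {b. (\<forall>z. z \<notin> Z \<longrightarrow> b z = 0) \<and> bdd_above ((\<lambda>z. \<bar>b z\<bar> / f z) ` Z)}"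

definition prob_vectors :: "('a \<Rightarrow> real) set"
  where "prob_vectors = {r. (\<forall>x. 0 \<le> r x) \<and> (r has_sum 1) UNIV}"

definition tensor :: "('x \<Rightarrow> real) \<Rightarrow> ('y \<Rightarrow> real) \<Rightarrow> 'x \<times> 'y \<Rightarrow> real"  (infixr "\<otimes>\<^sub>t" 72)
  where "r \<otimes>\<^sub>t s = (\<lambda>(x, y). r x * s y)"

definition dsum :: "('x \<Rightarrow> real) \<Rightarrow> ('y \<Rightarrow> real) \<Rightarrow> 'x \<times> 'y \<Rightarrow> real"  (infixr "\<oplus>\<^sub>t" 67)
  where "f \<oplus>\<^sub>t g = (\<lambda>(x, y). f x + g y)"


section \<open>Entropically regularized optimal transport\<close>

definition couplings :: "('x \<Rightarrow> real) \<Rightarrow> ('y \<Rightarrow> real) \<Rightarrow> ('x \<times> 'y \<Rightarrow> real) set"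
  where "couplings r s = {\<pi>. (\<forall>z. 0 \<le> \<pi> z) \<and>
    (\<forall>x. ((\<lambda>y. \<pi> (x, y)) has_sum r x) UNIV) \<and> (\<forall>y. ((\<lambda>x. \<pi> (x, y)) has_sum s y) UNIV)}"

text \<open>The mutual information of a coupling takes values in \<open>[0, \<infinity>]\<close>. Since
  \<open>t * ln t \<ge> t - 1\<close>, the negative parts of its terms are always summable, so for a coupling
  non-summability means that the value is \<open>\<infinity>\<close>. The convention \<open>0 * ln 0 = 0\<close> is built in.\<close>

definition mutual_info :: "('x \<Rightarrow> real) \<Rightarrow> ('y \<Rightarrow> real) \<Rightarrow> ('x \<times> 'y \<Rightarrow> real) \<Rightarrow> ereal"
  where "mutual_info r s \<pi> =
    (let f = (\<lambda>z. \<pi> z * ln (\<pi> z / (r \<otimes>\<^sub>t s) z))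
     in if f summable_on UNIV then ereal (\<Sum>\<^sub>\<infinity>z. f z) else \<infinity>)"

text \<open>The linear cost below is meaningful when \<open>c\<close> is integrable under every coupling of
  \<open>r\<close> and \<open>s\<close>, as is the case for marginals that integrate the weights of dominating functions.\<close>

definition erot_objective ::
    "real \<Rightarrow> ('x \<times> 'y \<Rightarrow> real) \<Rightarrow> ('x \<Rightarrow> real) \<Rightarrow> ('y \<Rightarrow> real) \<Rightarrow> ('x \<times> 'y \<Rightarrow> real) \<Rightarrow> ereal"
  where "erot_objective lam c r s \<pi> =
    ereal (\<Sum>\<^sub>\<infinity>z. c z * \<pi> z) + ereal lam * mutual_info r s \<pi>"

definition is_erot_plan ::
    "real \<Rightarrow> ('x \<times> 'y \<Rightarrow> real) \<Rightarrow> ('x \<Rightarrow> real) \<Rightarrow> ('y \<Rightarrow> real) \<Rightarrow> ('x \<times> 'y \<Rightarrow> real) \<Rightarrow> bool"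
  where "is_erot_plan lam c r s =
    is_arg_min (erot_objective lam c r s) (\<lambda>\<pi>. \<pi> \<in> couplings r s)"

definition erot_plan ::
    "real \<Rightarrow> ('x \<times> 'y \<Rightarrow> real) \<Rightarrow> ('x \<Rightarrow> real) \<Rightarrow> ('y \<Rightarrow> real) \<Rightarrow> 'x \<times> 'y \<Rightarrow> real"
  where "erot_plan lam c r s = (THE \<pi>. is_erot_plan lam c r s \<pi>)"

definition dominating ::
    "('x \<times> 'y \<Rightarrow> real) \<Rightarrow> ('x \<Rightarrow> real) \<Rightarrow> ('x \<Rightarrow> real) \<Rightarrow> ('y \<Rightarrow> real) \<Rightarrow> ('y \<Rightarrow> real) \<Rightarrow> bool"
  where "dominating c cXm cXp cYm cYp \<longleftrightarrow>
    (\<forall>x. cXm x \<le> cXp x) \<and> (\<forall>y. cYm y \<le> cYp y) \<and>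
    (\<forall>x y. cXm x + cYm y \<le> c (x, y) \<and> c (x, y) \<le> cXp x + cYp y)"

definition cost_weight :: "('a \<Rightarrow> real) \<Rightarrow> ('a \<Rightarrow> real) \<Rightarrow> 'a \<Rightarrow> real"
  where "cost_weight cm cp = (\<lambda>z. 1 + \<bar>cp z\<bar> + \<bar>cm z\<bar>)"

definition exp_weight :: "real \<Rightarrow> ('a \<Rightarrow> real) \<Rightarrow> ('a \<Rightarrow> real) \<Rightarrow> 'a \<Rightarrow> real"
  where "exp_weight lam cm cp = (\<lambda>z. exp ((cp z - cm z) / lam))"


section \<open>The optimality map and its formal partial derivatives\<close>

definition omit :: "'y \<Rightarrow> ('y \<Rightarrow> real) \<Rightarrow> 'y \<Rightarrow> real"
  where "omit y1 b = b(y1 := 0)"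

definition fill_mass :: "real \<Rightarrow> 'y \<Rightarrow> ('y \<Rightarrow> real) \<Rightarrow> 'y \<Rightarrow> real"
  \<comment> \<open>restores the omitted entry from the total mass \<open>m\<close>\<close>
  where "fill_mass m y1 b = b(y1 := m - (\<Sum>\<^sub>\<infinity>y\<in>- {y1}. b y))"

definition A_star :: "'y \<Rightarrow> ('x \<times> 'y \<Rightarrow> real) \<Rightarrow> ('x \<Rightarrow> real) \<times> ('y \<Rightarrow> real)"
  where "A_star y1 \<pi> = ((\<lambda>x. \<Sum>\<^sub>\<infinity>y. \<pi> (x, y)), omit y1 (\<lambda>y. \<Sum>\<^sub>\<infinity>x. \<pi> (x, y)))"

definition A_star_T :: "'y \<Rightarrow> ('x \<Rightarrow> real) \<times> ('y \<Rightarrow> real) \<Rightarrow> 'x \<times> 'y \<Rightarrow> real"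
  where "A_star_T y1 = (\<lambda>(a, b). \<lambda>(x, y). if y = y1 then a x else a x + b y)"

definition opt_map ::
    "real \<Rightarrow> ('x \<times> 'y \<Rightarrow> real) \<Rightarrow> 'y \<Rightarrow>
     (('x \<times> 'y \<Rightarrow> real) \<times> ('x \<Rightarrow> real) \<times> ('y \<Rightarrow> real)) \<times> (('x \<Rightarrow> real) \<times> ('y \<Rightarrow> real)) \<Rightarrow>
     ('x \<times> 'y \<Rightarrow> real) \<times> ('x \<Rightarrow> real) \<times> ('y \<Rightarrow> real)"
  where "opt_map lam c y1 = (\<lambda>((\<pi>, \<alpha>, \<beta>), (r, s)).
    (\<pi> - (\<lambda>z. exp ((A_star_T y1 (\<alpha>, \<beta>) z - c z) / lam)) * (r \<otimes>\<^sub>t fill_mass 1 y1 s),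
     A_star y1 \<pi> - (r, s)))"

text \<open>The formal partial derivatives of \<^const>\<open>opt_map\<close> at a point at which
  \<open>\<pi> = exp ((A_star_T y1 (\<alpha>, \<beta>) - c) / lam) * (r \<otimes>\<^sub>t s)\<close>, in particular at the EROT plan and
  potentials; there they depend on the potentials through \<open>\<pi>\<close> only. The lemmas
  \<open>opt_map_deriv_data\<close> and \<open>opt_map_deriv_vars\<close> below confirm the formulas componentwise.\<close>

definition D_data ::
    "'y \<Rightarrow> ('x \<times> 'y \<Rightarrow> real) \<Rightarrow> ('x \<Rightarrow> real) \<Rightarrow> ('y \<Rightarrow> real) \<Rightarrow> ('x \<Rightarrow> real) \<times> ('y \<Rightarrow> real) \<Rightarrow>
     ('x \<times> 'y \<Rightarrow> real) \<times> ('x \<Rightarrow> real) \<times> ('y \<Rightarrow> real)"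
  where "D_data y1 \<pi> r s = (\<lambda>(hX, hY).
    (- (\<lambda>z. \<pi> z / (r \<otimes>\<^sub>t s) z) * (r \<otimes>\<^sub>t fill_mass 0 y1 hY + hX \<otimes>\<^sub>t s), - hX, - hY))"

definition D_vars ::
    "real \<Rightarrow> 'y \<Rightarrow> ('x \<times> 'y \<Rightarrow> real) \<Rightarrow> ('x \<times> 'y \<Rightarrow> real) \<times> ('x \<Rightarrow> real) \<times> ('y \<Rightarrow> real) \<Rightarrow>
     ('x \<times> 'y \<Rightarrow> real) \<times> ('x \<Rightarrow> real) \<times> ('y \<Rightarrow> real)"
  where "D_vars lam y1 \<pi> = (\<lambda>(H, a, b).
    (H - (1 / lam) *\<^sub>R (\<pi> * A_star_T y1 (a, b)), A_star y1 H))"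

text \<open>The \<open>\<pi>\<close>-component of the inverse of \<^const>\<open>D_vars\<close> restricted to a solution space \<open>W\<close>.\<close>

definition D_vars_inv_pi ::
    "(('x \<times> 'y \<Rightarrow> real) \<times> ('x \<Rightarrow> real) \<times> ('y \<Rightarrow> real)) set \<Rightarrow> real \<Rightarrow> 'y \<Rightarrow> ('x \<times> 'y \<Rightarrow> real) \<Rightarrow>
     ('x \<times> 'y \<Rightarrow> real) \<times> ('x \<Rightarrow> real) \<times> ('y \<Rightarrow> real) \<Rightarrow> 'x \<times> 'y \<Rightarrow> real"
  where "D_vars_inv_pi W lam y1 \<pi> g = fst (THE w. w \<in> W \<and> D_vars lam y1 \<pi> w = g)"

lemma fill_mass_add:
  fixes s :: "'y \<Rightarrow> real"
  assumes s: "(s has_sum 1) UNIV" and h: "h summable_on - {y1}" "h y1 = 0"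
  shows "fill_mass 1 y1 (omit y1 s + t *\<^sub>R h) = s + t *\<^sub>R fill_mass 0 y1 h"
proof -
  have summ: "s summable_on - {y1}"
    using s summable_on_subset_banach[of s UNIV] by (auto simp: summable_on_def)
  have "1 = infsum s (insert y1 (- {y1}))"
    using infsumI[OF s] by (simp add: insert_UNIV Compl_insert)
  also have "\<dots> = s y1 + infsum s (- {y1})"
    by (rule infsum_insert) (use summ in auto)
  finally have one: "1 - infsum s (- {y1}) = s y1" by simp
  have "(\<Sum>\<^sub>\<infinity>y\<in>- {y1}. (omit y1 s + t *\<^sub>R h) y) = (\<Sum>\<^sub>\<infinity>y\<in>- {y1}. s y + t * h y)"
    by (rule infsum_cong) (auto simp: omit_def scaleR_fun_def)
  also have "\<dots> = infsum s (- {y1}) + t * infsum h (- {y1})"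
    by (simp add: infsum_add summ h summable_on_cmult_right infsum_cmult_right)
  finally show ?thesis
    using one by (auto simp: fun_eq_iff fill_mass_def omit_def scaleR_fun_def)
qed

lemma fill_mass_omit:
  fixes s :: "'y \<Rightarrow> real"
  assumes s: "(s has_sum 1) UNIV"
  shows "fill_mass 1 y1 (omit y1 s) = s"
  using fill_mass_add[OF s, of 0 y1 0] summable_on_0[of "- {y1}" 0] by simp

lemma opt_map_deriv_vars:
  fixes \<pi> H :: "'x \<times> 'y \<Rightarrow> real" and \<alpha> a :: "'x \<Rightarrow> real" and \<beta> b :: "'y \<Rightarrow> real"
  assumes pi: "\<And>z. \<pi> z = exp ((A_star_T y1 (\<alpha>, \<beta>) z - c z) / lam) * (r \<otimes>\<^sub>t s) z"
    and s: "(s has_sum 1) UNIV"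
    and sums: "\<And>x. (\<lambda>y. \<pi> (x, y)) summable_on UNIV" "\<And>y. (\<lambda>x. \<pi> (x, y)) summable_on UNIV"
      "\<And>x. (\<lambda>y. H (x, y)) summable_on UNIV" "\<And>y. (\<lambda>x. H (x, y)) summable_on UNIV"
  defines "G \<equiv> \<lambda>t. opt_map lam c y1
      ((\<pi> + t *\<^sub>R H, \<alpha> + t *\<^sub>R a, \<beta> + t *\<^sub>R b), (r, omit y1 s))"
  shows "((\<lambda>t. fst (G t) z) has_real_derivative fst (D_vars lam y1 \<pi> (H, a, b)) z) (at 0)"
    and "((\<lambda>t. fst (snd (G t)) x) has_real_derivative
          fst (snd (D_vars lam y1 \<pi> (H, a, b))) x) (at 0)"
    and "((\<lambda>t. snd (snd (G t)) y) has_real_derivative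
          snd (snd (D_vars lam y1 \<pi> (H, a, b))) y) (at 0)"
proof -
  show "((\<lambda>t. fst (G t) z) has_real_derivative fst (D_vars lam y1 \<pi> (H, a, b)) z) (at 0)"
  proof (cases z)
    case (Pair x y)
    let ?k = "A_star_T y1 (\<alpha>, \<beta>) z - c z" and ?m = "A_star_T y1 (a, b) z"
    have split: "A_star_T y1 (\<alpha> + t *\<^sub>R a, \<beta> + t *\<^sub>R b) z - c z = ?k + t * ?m" for t
      by (simp add: Pair A_star_T_def scaleR_fun_def algebra_simps)
    have "((\<lambda>t. \<pi> z + t * H z - exp ((?k + t * ?m) / lam) * (r \<otimes>\<^sub>t s) z) has_real_derivative
        H z - exp (?k / lam) * (?m / lam) * (r \<otimes>\<^sub>t s) z) (at 0)"
      by (rule derivative_eq_intros DERIV_cdivide refl | simp)+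
    then show ?thesis
      unfolding G_def opt_map_def D_vars_def
      by (simp add: fill_mass_omit[OF s] split, simp add: scaleR_fun_def pi[of z] algebra_simps)
  qed
  show "((\<lambda>t. fst (snd (G t)) x) has_real_derivative
          fst (snd (D_vars lam y1 \<pi> (H, a, b))) x) (at 0)"
    unfolding G_def opt_map_def D_vars_def A_star_def
    apply (simp add: scaleR_fun_def infsum_add sums summable_on_cmult_right infsum_cmult_right)
    apply (rule derivative_eq_intros refl | simp)+
    done
  show "((\<lambda>t. snd (snd (G t)) y) has_real_derivative
          snd (snd (D_vars lam y1 \<pi> (H, a, b))) y) (at 0)"
    unfolding G_def opt_map_def D_vars_def A_star_def
    apply (simp add: scaleR_fun_def omit_def infsum_add sums summable_on_cmult_right infsum_cmult_right)
    apply (rule impI conjI derivative_eq_intros refl | simp)+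
    done
qed

lemma opt_map_deriv_data:
  fixes \<pi> :: "'x \<times> 'y \<Rightarrow> real" and \<alpha> hX :: "'x \<Rightarrow> real" and \<beta> hY :: "'y \<Rightarrow> real"
  assumes pi: "\<And>z. \<pi> z = exp ((A_star_T y1 (\<alpha>, \<beta>) z - c z) / lam) * (r \<otimes>\<^sub>t s) z"
    and s: "(s has_sum 1) UNIV" and pos: "\<And>x. 0 < r x" "\<And>y. 0 < s y"
    and hY: "hY summable_on - {y1}" "hY y1 = 0"
  defines "G \<equiv> \<lambda>t. opt_map lam c y1 ((\<pi>, \<alpha>, \<beta>), (r + t *\<^sub>R hX, omit y1 s + t *\<^sub>R hY))"
  shows "((\<lambda>t. fst (G t) z) has_real_derivative fst (D_data y1 \<pi> r s (hX, hY)) z) (at 0)"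
    and "((\<lambda>t. fst (snd (G t)) x) has_real_derivative
          fst (snd (D_data y1 \<pi> r s (hX, hY))) x) (at 0)"
    and "((\<lambda>t. snd (snd (G t)) y) has_real_derivative
          snd (snd (D_data y1 \<pi> r s (hX, hY))) y) (at 0)"
proof -
  have fill: "fill_mass 1 y1 (omit y1 s + t *\<^sub>R hY) = s + t *\<^sub>R fill_mass 0 y1 hY" for t
    by (rule fill_mass_add[OF s hY])
  show "((\<lambda>t. fst (G t) z) has_real_derivative fst (D_data y1 \<pi> r s (hX, hY)) z) (at 0)"
  proof (cases z)
    case (Pair x y)
    have nz: "r x \<noteq> 0" "s y \<noteq> 0" using pos(1)[of x] pos(2)[of y] by auto
    let ?e = "exp ((A_star_T y1 (\<alpha>, \<beta>) z - c z) / lam)" and ?g = "fill_mass 0 y1 hY y"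
    have "((\<lambda>t. \<pi> z - ?e * ((r x + t * hX x) * (s y + t * ?g))) has_real_derivative
        - (?e * (r x * ?g + hX x * s y))) (at 0)"
      by (rule derivative_eq_intros refl | simp add: algebra_simps)+
    then show ?thesis
      unfolding G_def opt_map_def D_data_def using nz
      by (simp add: fill pi[of z], simp add: scaleR_fun_def pi[of z] Pair tensor_def)
  qed
  show "((\<lambda>t. fst (snd (G t)) x) has_real_derivative
          fst (snd (D_data y1 \<pi> r s (hX, hY))) x) (at 0)"
    unfolding G_def opt_map_def D_data_def A_star_def
    apply (simp add: scaleR_fun_def)
    apply (rule derivative_eq_intros refl | simp)+
    done
  show "((\<lambda>t. snd (snd (G t)) y) has_real_derivative
          snd (snd (D_data y1 \<pi> r s (hX, hY))) y) (at 0)"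
    unfolding G_def opt_map_def D_data_def A_star_def
    apply (simp add: scaleR_fun_def)
    apply (rule derivative_eq_intros refl | simp)+
    done
qed


section \<open>The operators in the explicit form of the derivative\<close>

definition op_AX :: "'y \<Rightarrow> ('x \<times> 'y \<Rightarrow> real) \<Rightarrow> ('x \<Rightarrow> real) \<Rightarrow> ('y \<Rightarrow> real) \<Rightarrow> 'x \<Rightarrow> real"
  where "op_AX y1 \<pi> r b = (\<lambda>x. \<Sum>\<^sub>\<infinity>y\<in>- {y1}. \<pi> (x, y) / r x * b y)"

definition op_AY :: "'y \<Rightarrow> ('x \<times> 'y \<Rightarrow> real) \<Rightarrow> ('y \<Rightarrow> real) \<Rightarrow> ('x \<Rightarrow> real) \<Rightarrow> 'y \<Rightarrow> real"
  where "op_AY y1 \<pi> s a = omit y1 (\<lambda>y. \<Sum>\<^sub>\<infinity>x. \<pi> (x, y) / s y * a x)"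

definition op_BX ::
    "('x \<times> 'y \<Rightarrow> real) \<Rightarrow> ('x \<Rightarrow> real) \<Rightarrow> ('y \<Rightarrow> real) \<Rightarrow> ('y \<Rightarrow> real) \<Rightarrow> 'x \<Rightarrow> real"
  where "op_BX \<pi> r s h = (\<lambda>x. \<Sum>\<^sub>\<infinity>y. \<pi> (x, y) / (r x * s y) * h y)"

definition op_BY ::
    "'y \<Rightarrow> ('x \<times> 'y \<Rightarrow> real) \<Rightarrow> ('x \<Rightarrow> real) \<Rightarrow> ('y \<Rightarrow> real) \<Rightarrow> ('x \<Rightarrow> real) \<Rightarrow> 'y \<Rightarrow> real"
  where "op_BY y1 \<pi> r s h = omit y1 (\<lambda>y. \<Sum>\<^sub>\<infinity>x. \<pi> (x, y) / (r x * s y) * h x)"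

definition block_op ::
    "('u \<Rightarrow> 'a::plus) \<Rightarrow> ('v \<Rightarrow> 'a) \<Rightarrow> ('u \<Rightarrow> 'b::plus) \<Rightarrow> ('v \<Rightarrow> 'b) \<Rightarrow> 'u \<times> 'v \<Rightarrow> 'a \<times> 'b"
  where "block_op M11 M12 M21 M22 = (\<lambda>(u, v). (M11 u + M12 v, M21 u + M22 v))"


section \<open>Hadamard differentiability\<close>

text \<open>Normed spaces are given as a carrier (a subspace of the ambient real vector space) together
  with a norm function that is meaningful on that carrier.\<close>

definition contingent_cone ::
    "'u::real_vector set \<Rightarrow> ('u \<Rightarrow> real) \<Rightarrow> 'u set \<Rightarrow> 'u \<Rightarrow> 'u set"
  where "contingent_cone U nU U0 u = {h \<in> U. \<exists>t k.
    (\<forall>n::nat. 0 < t n \<and> k n \<in> U0) \<and> t \<longlonglongrightarrow> 0 \<and>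
    (\<lambda>n. nU ((1 / t n) *\<^sub>R (k n - u) - h)) \<longlonglongrightarrow> 0}"

definition bounded_linear_between ::
    "'u::real_vector set \<Rightarrow> ('u \<Rightarrow> real) \<Rightarrow> 'v::real_vector set \<Rightarrow> ('v \<Rightarrow> real) \<Rightarrow> ('u \<Rightarrow> 'v) \<Rightarrow> bool"
  where "bounded_linear_between S nU V nV D \<longleftrightarrow>
    (\<forall>h\<in>S. D h \<in> V) \<and>
    (\<forall>h\<in>S. \<forall>k\<in>S. D (h + k) = D h + D k) \<and>
    (\<forall>h\<in>S. \<forall>a. D (a *\<^sub>R h) = a *\<^sub>R D h) \<and>
    (\<exists>K. \<forall>h\<in>S. nV (D h) \<le> K * nU h)"

text \<open>Tangential to the domain \<open>U0\<close> of the map. The derivative is determined on the contingent cone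
  only; it is required to be linear and continuous on the linear hull of the cone.\<close>

definition has_hadamard_derivative ::
    "('u::real_vector \<Rightarrow> 'v::real_vector) \<Rightarrow> ('u \<Rightarrow> 'v) \<Rightarrow>
     'u set \<Rightarrow> ('u \<Rightarrow> real) \<Rightarrow> 'u set \<Rightarrow> 'v set \<Rightarrow> ('v \<Rightarrow> real) \<Rightarrow> 'u \<Rightarrow> bool"
  where "has_hadamard_derivative \<Psi> D U nU U0 V nV u \<longleftrightarrow>
    U0 \<subseteq> U \<and> u \<in> U0 \<and> \<Psi> \<in> U0 \<rightarrow> V \<and>
    bounded_linear_between (span (contingent_cone U nU U0 u)) nU V nV D \<and>
    (\<forall>t h h0. (\<forall>n::nat. 0 < t n \<and> u + t n *\<^sub>R h n \<in> U0) \<and> t \<longlonglongrightarrow> 0 \<and>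
       h0 \<in> U \<and> (\<lambda>n. nU (h n - h0)) \<longlonglongrightarrow> 0 \<longrightarrow>
       (\<lambda>n. nV ((1 / t n) *\<^sub>R (\<Psi> (u + t n *\<^sub>R h n) - \<Psi> u) - D h0)) \<longlonglongrightarrow> 0)"

end

theory Submission
  imports Defs
begin

text \<open>Every EROT plan has the Gibbs form \<open>k a b r s\<close> with \<open>k = exp (- (c - cXm - cYm) / lam)\<close>, where
  the scalings \<open>a\<close>, \<open>b\<close> solve the Schroedinger system \<open>1 / a = \<Sum> k b s\<close>, \<open>1 / b = \<Sum> k a r\<close>.
  A solution with \<open>b y0 = 1\<close> is the decreasing limit of Sinkhorn iterates started at a
  supersolution; conservation of mass keeps the iterates away from zero. Optimality and uniqueness
  of the Gibbs plan follow from the nonnegativity of relative entropy.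

  For the derivative, divide the perturbed scalings by the unperturbed ones. The ratios \<open>u\<close>, \<open>v\<close>
  solve a Schroedinger system for a Markov kernel, and \<open>v y1 = 1\<close>. Since \<open>y1\<close> carries mass bounded
  below in every row, the extreme values of \<open>1 / u\<close> are pulled to \<open>1\<close>, which gives
  \<open>u - 1 = O(t)\<close> uniformly and \<open>v - 1 = O(t)\<close> up to a power of \<open>phiY\<close>. Inserting these bounds into the
  exact equations shows that the difference quotients solve the linearized system up to an error
  that vanishes with \<open>t\<close> and with the distance of the directions, and the same lower bound on the mass
  at \<open>y1\<close> makes \<open>AX AY\<close> a contraction, so the linearized system is boundedly invertible. Each step
  costs one power of \<open>phiY\<close>, four in total.\<close>

section \<open>Weighted sums\<close>

text \<open>When an index set is infinite, the admissible marginals have no interior point even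
  relative to the mean-zero directions, and perturbed marginals may vanish where \<open>r\<close>
  and \<open>s\<close> do not; an implicit function theorem on open sets does not apply.
  \<open>schroedinger_pair\<close> therefore imposes its equations at every index, charged or not,
  so that the ratios of perturbed to base scalings exist everywhere. Their bounds see the second
  marginal only through its \<open>phi\<close>-moment and its mass at the reference point, and only
  that mass has to stay away from zero, which holds for small steps. The four powers of
  \<open>phiY\<close> are spent as follows. The density \<open>p\<close> costs one. The ratio
  \<open>v\<close> may itself grow like \<open>phiY\<close>, and comparing it with the update from
  \<open>r\<close> alone pairs \<open>p\<close> with a direction, so \<open>v - 1\<close> costs two.
  Replacing the exact equation for \<open>v\<close> by its linearization leaves the product of
  \<open>v - 1\<close> with a term of order \<open>phiY\<close>, hence three. Multiplication by
  \<open>p\<close> in the remainder gives four. The \<open>x\<close> side costs nothing because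
  \<open>cXp - cXm\<close> is bounded.\<close>

lemma summable_on_abs_le:
  fixes f g :: "'a \<Rightarrow> real"
  assumes "g summable_on A" "\<And>i. i \<in> A \<Longrightarrow> \<bar>f i\<bar> \<le> g i"
  shows "f summable_on A"
proof -
  have "(\<lambda>i. \<bar>f i\<bar>) summable_on A"
    by (rule summable_on_comparison_test[OF assms(1)]) (simp_all add: assms(2))
  then show ?thesis
    using iffD2[OF summable_on_iff_abs_summable_on_real, of f A] by simp
qed

lemma summable_on_abs:
  fixes f :: "'a \<Rightarrow> real"
  shows "f summable_on A \<Longrightarrow> (\<lambda>x. \<bar>f x\<bar>) summable_on A"
  using iffD1[OF summable_on_iff_abs_summable_on_real, of f A] by simp

lemma has_sum_diff:
  fixes f g :: "'a \<Rightarrow> real"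
  assumes "(f has_sum a) A" "(g has_sum b) A"
  shows "((\<lambda>i. f i - g i) has_sum (a - b)) A"
  using has_sum_add[OF assms(1) has_sum_cmult_right[OF assms(2), of "-1"]] by simp

lemma abs_infsum_le:
  fixes f g :: "'a \<Rightarrow> real"
  assumes "g summable_on A" "\<And>i. i \<in> A \<Longrightarrow> \<bar>f i\<bar> \<le> g i"
  shows "\<bar>infsum f A\<bar> \<le> infsum g A"
proof -
  have "f summable_on A" "(\<lambda>i. - g i) summable_on A"
    using assms by (auto intro: summable_on_abs_le simp: summable_on_uminus)
  moreover have "f i \<le> g i" "- g i \<le> f i" if "i \<in> A" for i
    using assms(2)[OF that] by auto
  ultimately have "infsum f A \<le> infsum g A" "infsum (\<lambda>i. - g i) A \<le> infsum f A"
    using assms(1) by (auto intro!: infsum_mono)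
  then show ?thesis by (simp add: infsum_uminus)
qed

lemma infsum_diff_real:
  fixes f g :: "'a \<Rightarrow> real"
  assumes "f summable_on A" "g summable_on A"
  shows "infsum (\<lambda>i. f i - g i) A = infsum f A - infsum g A"
  using has_sum_diff[OF has_sum_infsum[OF assms(1)] has_sum_infsum[OF assms(2)]]
  by (rule infsumI)

lemma summable_on_UNIV_subset:
  fixes f :: "'a \<Rightarrow> real"
  shows "f summable_on UNIV \<Longrightarrow> f summable_on A"
  by (rule summable_on_subset_banach[of f UNIV]) auto

lemma has_sum_tensor:
  fixes f :: "'x \<Rightarrow> real" and g :: "'y \<Rightarrow> real"
  assumes f: "f summable_on UNIV" and g: "g summable_on UNIV"
  shows "((\<lambda>(x, y). f x * g y) has_sum (infsum f UNIV * infsum g UNIV)) UNIV"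
proof -
  have "(\<lambda>x. \<bar>f x\<bar>) summable_on UNIV" and g': "(\<lambda>y. \<bar>g y\<bar>) summable_on UNIV"
    by (rule summable_on_abs f g)+
  then have "(\<lambda>(x, y). \<bar>f x\<bar> * \<bar>g y\<bar>) summable_on UNIV \<times> UNIV"
    by (intro summable_on_SigmaI[where g = "\<lambda>x. \<bar>f x\<bar> * (\<Sum>\<^sub>\<infinity>y. \<bar>g y\<bar>)"])
      (auto intro!: has_sum_cmult_right has_sum_infsum summable_on_cmult_left)
  then have "(\<lambda>(x, y). f x * g y) summable_on UNIV \<times> UNIV"
    by (rule summable_on_abs_le) (auto simp: abs_mult)
  then have "((\<lambda>(x, y). f x * g y) has_sum (infsum f UNIV * infsum g UNIV)) (UNIV \<times> UNIV)"
    by (intro has_sum_SigmaI[where g = "\<lambda>x. f x * infsum g UNIV"])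
      (auto simp: f g intro!: has_sum_cmult_right has_sum_cmult_left has_sum_infsum)
  then show ?thesis by simp
qed

lemma summable_tensor:
  fixes f :: "'x \<Rightarrow> real" and g :: "'y \<Rightarrow> real"
  assumes "f summable_on UNIV" "g summable_on UNIV"
  shows "(\<lambda>(x, y). f x * g y) summable_on UNIV"
  using has_sum_tensor[OF assms] by (auto simp: summable_on_def)

lemma has_sum_nonneg_le:
  fixes f :: "'a \<Rightarrow> real"
  assumes "(f has_sum S) UNIV" "\<And>i. 0 \<le> f i"
  shows "f i \<le> S"
  using has_sum_mono_neutral[of f "{i}" "f i" f UNIV S] has_sum_finite[of "{i}" f] assms by auto

text \<open>Dominated convergence, taken over from the Lebesgue integral for counting measure: a
  real family is summable exactly when it is absolutely summable, so \<open>infsum\<close> is that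
  integral.\<close>

lemma infsum_tendsto_dominated:
  fixes f :: "nat \<Rightarrow> 'a \<Rightarrow> real"
  assumes g: "g summable_on UNIV" and le: "\<And>n i. \<bar>f n i\<bar> \<le> g i"
    and lim: "\<And>i. (\<lambda>n. f n i) \<longlonglongrightarrow> l i"
  shows "(\<lambda>n. infsum (f n) UNIV) \<longlonglongrightarrow> infsum l UNIV"
proof -
  have l_le: "\<bar>l i\<bar> \<le> g i" for i
    using tendsto_rabs[OF lim[of i]] le[of _ i] by (intro LIMSEQ_le_const2) auto
  have integrable: "integrable (count_space UNIV) h" and
    integral: "infsum h UNIV = integral\<^sup>L (count_space UNIV) h" if "h summable_on UNIV" for h :: "'a \<Rightarrow> real"
  proof -
    have "Infinite_Set_Sum.abs_summable_on h UNIV"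
      using summable_on_abs[OF that] by (simp flip: abs_summable_equivalent)
    then show "integrable (count_space UNIV) h" "infsum h UNIV = integral\<^sup>L (count_space UNIV) h"
      by (simp_all add: Infinite_Set_Sum.abs_summable_on_def infsetsum_infsum[symmetric] infsetsum_def)
  qed
  have "f n summable_on UNIV" "l summable_on UNIV" for n
    using summable_on_abs_le[OF g] le l_le by auto
  then show ?thesis
    using integral_dominated_convergence[of l "count_space UNIV" f g] le lim
    by (simp add: integral integrable[OF g])
qed

section \<open>Couplings and optimality of Gibbs plans\<close>

lemma coupling_has_sum_fst:
  fixes f :: "'x \<Rightarrow> real"
  assumes q: "q \<in> couplings r s" and f: "(\<lambda>x. \<bar>f x\<bar> * r x) summable_on UNIV"
  shows "((\<lambda>z. f (fst z) * q z) has_sum (\<Sum>\<^sub>\<infinity>x. f x * r x)) UNIV"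
proof -
  have q0: "0 \<le> q z" and qr: "((\<lambda>y. q (x, y)) has_sum r x) UNIV" for x z
    using q unfolding couplings_def by blast+
  have r0: "0 \<le> r x" for x
    using qr q0 by (rule has_sum_nonneg)
  have "(\<lambda>z. \<bar>f (fst z)\<bar> * q z) summable_on UNIV \<times> UNIV"
    by (rule summable_on_SigmaI[where g = "\<lambda>x. \<bar>f x\<bar> * r x"])
      (auto intro!: has_sum_cmult_right qr f mult_nonneg_nonneg q0)
  then have "(\<lambda>z. f (fst z) * q z) summable_on UNIV \<times> UNIV"
    by (rule summable_on_abs_le) (auto simp: abs_mult q0)
  moreover have "(\<lambda>x. f x * r x) summable_on UNIV"
    by (rule summable_on_abs_le[OF f]) (auto simp: abs_mult r0)
  ultimately have "((\<lambda>z. f (fst z) * q z) has_sum (\<Sum>\<^sub>\<infinity>x. f x * r x)) (UNIV \<times> UNIV)"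
    by (intro has_sum_SigmaI[where g = "\<lambda>x. f x * r x"])
      (auto intro!: has_sum_cmult_right qr has_sum_infsum)
  then show ?thesis by simp
qed

lemma coupling_has_sum_snd:
  fixes f :: "'y \<Rightarrow> real"
  assumes q: "q \<in> couplings r s" and f: "(\<lambda>y. \<bar>f y\<bar> * s y) summable_on UNIV"
  shows "((\<lambda>z. f (snd z) * q z) has_sum (\<Sum>\<^sub>\<infinity>y. f y * s y)) UNIV"
proof -
  have "(\<lambda>(y, x). q (x, y)) \<in> couplings s r"
    using q by (auto simp: couplings_def)
  from coupling_has_sum_fst[OF this f]
  have "((\<lambda>(y, x). f y * q (x, y)) has_sum (\<Sum>\<^sub>\<infinity>y. f y * s y)) (UNIV \<times> UNIV)"
    by (simp add: case_prod_unfold)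
  then show ?thesis
    by (subst (asm) has_sum_swap) (simp add: case_prod_unfold)
qed

text \<open>The extra \<open>- q + p\<close>, whose total vanishes for two couplings of the same
  marginals, makes every single term of the relative entropy nonnegative. A vanishing total then
  forces \<open>q = p\<close> entry by entry. Both claims are \<open>ln x \<le> x - 1\<close> and
  its equality case, applied to \<open>p / q\<close>.\<close>

lemma relative_entropy_term:
  fixes q p :: real
  assumes "0 \<le> q" "0 \<le> p" "q > 0 \<Longrightarrow> p > 0"
  shows "q * ln (q / p) - q + p \<ge> 0" and "q * ln (q / p) - q + p = 0 \<Longrightarrow> q = p"
proof -
  have *: "q * ln (q / p) - q + p = q * (p / q - 1 - ln (p / q))" if "q > 0"
    using that assms(3)[OF that] by (simp add: ln_div algebra_simps)
  show "q * ln (q / p) - q + p \<ge> 0"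
  proof (cases "q > 0")
    case True
    then show ?thesis
      using * ln_le_minus_one[of "p / q"] assms(3) by (auto simp: zero_le_mult_iff)
  qed (use assms in auto)
  show "q = p" if "q * ln (q / p) - q + p = 0"
  proof (cases "q > 0")
    case True
    then show ?thesis
      using * that ln_eq_minus_one[of "p / q"] assms(3) by auto
  qed (use assms that in auto)
qed

text \<open>For every coupling \<open>q\<close> of finite entropy the objective exceeds its value at
  \<open>\<pi>\<close> by \<open>lam\<close> times the relative entropy of \<open>q\<close> with
  respect to \<open>\<pi>\<close>: the additive function \<open>A x + B y\<close> has the same total
  under all couplings, so it drops out of the comparison.\<close>

lemma gibbs_plan_unique:
  fixes c :: "'x \<times> 'y \<Rightarrow> real"
  assumes lam: "lam > 0"
    and pi: "\<pi> \<in> couplings r s"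
    and gibbs: "\<And>x y. r x > 0 \<Longrightarrow> s y > 0 \<Longrightarrow>
      \<pi> (x, y) > 0 \<and> c (x, y) + lam * ln (\<pi> (x, y) / (r x * s y)) = A x + B y"
    and A: "(\<lambda>x. \<bar>A x\<bar> * r x) summable_on UNIV" and B: "(\<lambda>y. \<bar>B y\<bar> * s y) summable_on UNIV"
    and c: "\<And>x y. \<bar>c (x, y)\<bar> \<le> CX x + CY y"
    and CX: "(\<lambda>x. \<bar>CX x\<bar> * r x) summable_on UNIV" and CY: "(\<lambda>y. \<bar>CY y\<bar> * s y) summable_on UNIV"
    and r: "r summable_on UNIV"
  shows "is_erot_plan lam c r s q \<longleftrightarrow> q = \<pi>"
proof -
  let ?AB = "\<lambda>z. A (fst z) + B (snd z)"
  \<comment> \<open>The common total of \<open>A x + B y\<close> under all couplings;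
    \<open>obj_pi\<close> and \<open>key\<close> identify it as the minimal value.\<close>
  define J where "J = (\<Sum>\<^sub>\<infinity>x. A x * r x) + (\<Sum>\<^sub>\<infinity>y. B y * s y)"
  define ent where "ent q = (\<lambda>z. q z * ln (q z / (r \<otimes>\<^sub>t s) z))" for q :: "'x \<times> 'y \<Rightarrow> real"
  have nonneg: "0 \<le> q z" if "q \<in> couplings r s" for q z
    using that unfolding couplings_def by blast
  have supp: "r x > 0 \<and> s y > 0" if q: "q \<in> couplings r s" and pos: "q (x, y) > 0" for q x y
  proof -
    have "((\<lambda>y. q (x, y)) has_sum r x) UNIV" "((\<lambda>x. q (x, y)) has_sum s y) UNIV"
      using q by (auto simp: couplings_def)
    then have "q (x, y) \<le> r x" "q (x, y) \<le> s y"
      using has_sum_nonneg_le nonneg[OF q] by fastforce+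
    with pos show ?thesis by auto
  qed
  have ABsum: "((\<lambda>z. ?AB z * q z) has_sum J) UNIV" if "q \<in> couplings r s" for q
    unfolding J_def using has_sum_add[OF coupling_has_sum_fst[OF that A] coupling_has_sum_snd[OF that B]]
    by (simp add: distrib_right)
  have csum: "(\<lambda>z. c z * q z) summable_on UNIV" if q: "q \<in> couplings r s" for q
  proof (rule summable_on_abs_le)
    show "(\<lambda>z. CX (fst z) * q z + CY (snd z) * q z) summable_on UNIV"
      using has_sum_add[OF coupling_has_sum_fst[OF q CX] coupling_has_sum_snd[OF q CY]]
      by (auto simp: summable_on_def)
    show "\<bar>c z * q z\<bar> \<le> CX (fst z) * q z + CY (snd z) * q z" for z
      using c[of "fst z" "snd z"] nonneg[OF q, of z]
      by (simp add: abs_mult mult_right_mono flip: distrib_right)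
  qed
  have mass: "(q has_sum infsum r UNIV) UNIV" if q: "q \<in> couplings r s" for q
    using coupling_has_sum_fst[OF q, of "\<lambda>_. 1"] r by simp
  have ent_pi: "lam * ent \<pi> z = ?AB z * \<pi> z - c z * \<pi> z" for z
  proof (cases "\<pi> z > 0")
    case True
    then have "r (fst z) > 0" "s (snd z) > 0"
      using supp[OF pi, of "fst z" "snd z"] by auto
    then have "lam * ln (\<pi> z / (r (fst z) * s (snd z))) = ?AB z - c z"
      using gibbs[of "fst z" "snd z"] by simp
    then have "\<pi> z * (lam * ln (\<pi> z / (r (fst z) * s (snd z)))) = \<pi> z * (?AB z - c z)"
      by simp
    then show ?thesis
      by (simp add: ent_def tensor_def case_prod_unfold algebra_simps)
  next
    case False
    then have "\<pi> z = 0" using nonneg[OF pi, of z] by auto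
    then show ?thesis by (simp add: ent_def)
  qed
  have sum_pi: "(\<lambda>z. lam * ent \<pi> z) summable_on UNIV" "(\<Sum>\<^sub>\<infinity>z. lam * ent \<pi> z) = J - (\<Sum>\<^sub>\<infinity>z. c z * \<pi> z)"
    using has_sum_diff[OF ABsum[OF pi] has_sum_infsum[OF csum[OF pi]]]
    by (auto simp: ent_pi summable_on_def intro: infsumI)
  have obj: "erot_objective lam c r s q = (if ent q summable_on UNIV
      then ereal ((\<Sum>\<^sub>\<infinity>z. c z * q z) + lam * (\<Sum>\<^sub>\<infinity>z. ent q z)) else \<infinity>)" for q
    using lam by (simp add: erot_objective_def mutual_info_def ent_def Let_def)
  have obj_pi: "erot_objective lam c r s \<pi> = ereal J"
  proof -
    have "ent \<pi> summable_on UNIV"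
      using summable_on_cmult_right[OF sum_pi(1), of "1 / lam"] lam by simp
    then show ?thesis
      using sum_pi(2) by (simp add: obj infsum_cmult_right')
  qed
  have key: "erot_objective lam c r s q \<ge> ereal J \<and> (erot_objective lam c r s q = ereal J \<longrightarrow> q = \<pi>)"
    if q: "q \<in> couplings r s" for q
  proof (cases "ent q summable_on UNIV")
    case True
    define d where "d = (\<lambda>z. q z * ln (q z / \<pi> z) - q z + \<pi> z)"
    have pos: "\<pi> z > 0" if "q z > 0" for z
      using supp[OF q, of "fst z" "snd z"] gibbs[of "fst z" "snd z"] that by auto
    \<comment> \<open>Through the Gibbs relation the integrand of the relative entropy becomes a
      combination of summable families, so its total can be computed term by term.\<close>
    have d: "d z = (c z * q z + lam * ent q z - ?AB z * q z) / lam - q z + \<pi> z" for z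
    proof (cases "q z > 0")
      case pz: True
      then have rs: "r (fst z) > 0" "s (snd z) > 0"
        using supp[OF q, of "fst z" "snd z"] by auto
      then have rs2: "r (fst z) * s (snd z) > 0" by simp
      have g: "?AB z = c z + lam * ln (\<pi> z / (r (fst z) * s (snd z)))"
        using gibbs[OF rs] by simp
      show ?thesis
        unfolding g d_def ent_def tensor_def case_prod_unfold
          ln_divide_pos[OF pz pos[OF pz]] ln_divide_pos[OF pz rs2] ln_divide_pos[OF pos[OF pz] rs2]
        using lam by (simp add: field_simps)
    next
      case False
      then have "q z = 0" using nonneg[OF q, of z] by auto
      then show ?thesis by (simp add: d_def ent_def)
    qed
    have "((\<lambda>z. (c z * q z + lam * ent q z - ?AB z * q z) / lam - q z + \<pi> z) has_sum
        ((\<Sum>\<^sub>\<infinity>z. c z * q z) + lam * (\<Sum>\<^sub>\<infinity>z. ent q z) - J) / lam - infsum r UNIV + infsum r UNIV) UNIV"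
      by (intro has_sum_add has_sum_diff has_sum_divide_const has_sum_cmult_right mass q pi ABsum
          has_sum_infsum csum True)
    then have dsum: "(d has_sum ((\<Sum>\<^sub>\<infinity>z. c z * q z) + lam * (\<Sum>\<^sub>\<infinity>z. ent q z) - J) / lam) UNIV"
      by (simp add: d[abs_def])
    have d0: "0 \<le> d z" for z
      unfolding d_def by (rule relative_entropy_term) (use nonneg q pi pos in auto)
    have "0 \<le> ((\<Sum>\<^sub>\<infinity>z. c z * q z) + lam * (\<Sum>\<^sub>\<infinity>z. ent q z) - J) / lam"
      using dsum d0 by (rule has_sum_nonneg)
    then have ge: "J \<le> (\<Sum>\<^sub>\<infinity>z. c z * q z) + lam * (\<Sum>\<^sub>\<infinity>z. ent q z)"
      using lam by (simp add: zero_le_divide_iff)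
    have "q = \<pi>" if "(\<Sum>\<^sub>\<infinity>z. c z * q z) + lam * (\<Sum>\<^sub>\<infinity>z. ent q z) = J"
    proof
      fix z
      have "d z \<le> 0"
        using has_sum_nonneg_le[OF dsum d0, of z] that by simp
      then have "d z = 0" using d0[of z] by simp
      then show "q z = \<pi> z"
        unfolding d_def using relative_entropy_term(2)[of "q z" "\<pi> z"] nonneg q pi pos by auto
    qed
    with ge True show ?thesis by (simp add: obj)
  qed (simp add: obj)
  show ?thesis
  proof
    assume "is_erot_plan lam c r s q"
    then have q: "q \<in> couplings r s" and "\<not> erot_objective lam c r s \<pi> < erot_objective lam c r s q"
      using pi by (auto simp: is_erot_plan_def is_arg_min_def)
    then show "q = \<pi>" using key[OF q] by (auto simp: obj_pi not_less)
  next
    assume [simp]: "q = \<pi>"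
    show "is_erot_plan lam c r s q"
      unfolding is_erot_plan_def is_arg_min_def
    proof (intro conjI notI)
      assume "\<exists>y. y \<in> couplings r s \<and> erot_objective lam c r s y < erot_objective lam c r s q"
      then obtain y where "y \<in> couplings r s" "erot_objective lam c r s y < ereal J"
        by (auto simp: obj_pi)
      with key[of y] show False by (simp add: leD)
    qed (simp add: pi)
  qed
qed

section \<open>Existence of Schroedinger potentials\<close>

lemma prob_vectorsD:
  assumes "r \<in> prob_vectors"
  shows "0 \<le> r x" "r summable_on UNIV" "infsum r UNIV = 1"
  using assms by (auto simp: prob_vectors_def summable_on_def intro: infsumI)

text \<open>\<open>b y0 = 1\<close> fixes the additive constant in the potentials.\<close>

definition schroedinger_pair ::
    "('x \<Rightarrow> 'y \<Rightarrow> real) \<Rightarrow> ('x \<Rightarrow> real) \<Rightarrow> ('y \<Rightarrow> real) \<Rightarrow> 'y \<Rightarrow> ('x \<Rightarrow> real) \<Rightarrow> ('y \<Rightarrow> real) \<Rightarrow> bool"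
  where "schroedinger_pair k r s y0 a b \<longleftrightarrow>
    (\<forall>x. 0 < a x) \<and> (\<forall>y. 0 < b y) \<and> b y0 = 1 \<and>
    (\<forall>x. ((\<lambda>y. k x y * b y * s y) has_sum 1 / a x) UNIV) \<and>
    (\<forall>y. ((\<lambda>x. k x y * a x * r x) has_sum 1 / b y) UNIV)"

text \<open>The locale also serves the perturbed marginals, so \<open>r\<close> may vanish at any
  point and \<open>s\<close> at any point but \<open>y0\<close>. The lower bound on the kernel
  degrades with \<open>phi y\<close> but is uniform in \<open>x\<close>; this asymmetry persists in
  all later estimates.\<close>

locale kernel_marginals =
  fixes k :: "'x \<Rightarrow> 'y \<Rightarrow> real" and phi :: "'y \<Rightarrow> real" and K :: real
    and r :: "'x \<Rightarrow> real" and s :: "'y \<Rightarrow> real" and y0 :: 'y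
  assumes K_ge: "1 \<le> K" and phi_ge: "\<And>y. 1 \<le> phi y"
    and k_le: "\<And>x y. k x y \<le> 1" and k_ge: "\<And>x y. 1 \<le> K * phi y * k x y"
    and r: "r \<in> prob_vectors" and s: "s \<in> prob_vectors"
    and phi_s: "(\<lambda>y. phi y * s y) summable_on UNIV" and s_y0: "0 < s y0"
begin

lemmas r_prob = prob_vectorsD[OF r] and s_prob = prob_vectorsD[OF s]

lemma Kphi_pos: "0 < K * phi y"
  using K_ge phi_ge[of y] by simp

lemma Kphi_ge: "1 \<le> K * phi y"
  using K_ge phi_ge[of y] mult_mono[of 1 K 1 "phi y"] by simp

lemma k_lower: "1 / (K * phi y) \<le> k x y"
  using k_ge[of y x] Kphi_pos[of y] by (simp add: divide_simps mult.commute)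

lemma k_pos: "0 < k x y"
  using k_lower[of y x] Kphi_pos[of y] by (smt (verit) divide_pos_pos)

text \<open>A Harnack inequality for rows: the factor depends on the column \<open>y\<close> only,
  so the inequality survives integration over \<open>x\<close> against any nonnegative
  weight.\<close>

lemma k_ratio: "k x y' \<le> K * phi y * k x y"
  using k_le[of x y'] k_ge[of y x] by linarith

definition S where "S = (\<Sum>\<^sub>\<infinity>y. phi y * s y)"

lemma S_ge: "1 \<le> S"
proof -
  have "infsum s UNIV \<le> S"
    unfolding S_def using phi_ge s_prob(1)
    by (intro infsum_mono s_prob phi_s) (simp add: mult_le_cancel_right1 leD)
  then show ?thesis by (simp add: s_prob)
qed

lemma summable_row:
  assumes "\<And>y. \<bar>b y\<bar> \<le> C * phi y"
  shows "(\<lambda>y. k x y * b y * s y) summable_on UNIV"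
proof (rule summable_on_abs_le)
  show "(\<lambda>y. C * (phi y * s y)) summable_on UNIV"
    by (intro summable_on_cmult_right phi_s)
  show "\<bar>k x y * b y * s y\<bar> \<le> C * (phi y * s y)" for y
    using mult_mono[OF k_le[of x y] assms[of y]] k_pos[of x y] s_prob(1)[of y]
    by (simp add: abs_mult mult_right_mono flip: mult.assoc)
qed

lemma summable_col:
  assumes "\<And>x. \<bar>a x\<bar> \<le> C"
  shows "(\<lambda>x. k x y * a x * r x) summable_on UNIV"
proof (rule summable_on_abs_le)
  show "(\<lambda>x. C * r x) summable_on UNIV"
    by (intro summable_on_cmult_right r_prob)
  show "\<bar>k x y * a x * r x\<bar> \<le> C * r x" for x
    using mult_mono[OF k_le[of x y] assms[of x]] k_pos[of x y] r_prob(1)[of x]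
    by (simp add: abs_mult mult_right_mono)
qed

text \<open>Both sides compute the total of \<open>k x y * a x * b y * r x * s y\<close>, by rows
  and by columns.\<close>

lemma mass_exchange:
  assumes a: "\<And>x. \<bar>a x\<bar> \<le> C" and b: "\<And>y. \<bar>b y\<bar> \<le> C' * phi y"
  shows "(\<Sum>\<^sub>\<infinity>x. a x * r x * (\<Sum>\<^sub>\<infinity>y. k x y * b y * s y)) =
    (\<Sum>\<^sub>\<infinity>y. b y * s y * (\<Sum>\<^sub>\<infinity>x. k x y * a x * r x))"
proof -
  have "(\<lambda>(x, y). a x * r x * (k x y * b y * s y)) summable_on UNIV \<times> UNIV"
  proof (rule summable_on_abs_le)
    have "(\<lambda>(x, y). C * r x * (C' * (phi y * s y))) summable_on UNIV"
      by (intro summable_tensor summable_on_cmult_right phi_s r_prob)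
    then show "(\<lambda>(x, y). C * r x * (C' * (phi y * s y))) summable_on UNIV \<times> UNIV"
      by simp
    fix z :: "'x \<times> 'y"
    obtain x y where z: "z = (x, y)" by fastforce
    have 1: "\<bar>a x * r x\<bar> \<le> C * r x"
      using a[of x] r_prob(1)[of x] by (simp add: abs_mult mult_right_mono)
    have "\<bar>k x y * b y\<bar> \<le> 1 * (C' * phi y)"
      unfolding abs_mult using k_le[of x y] k_pos[of x y] b[of y] by (intro mult_mono) auto
    then have 2: "\<bar>k x y * b y\<bar> * \<bar>s y\<bar> \<le> C' * phi y * s y"
      using s_prob(1)[of y] by (simp add: mult_right_mono)
    have "\<bar>a x * r x\<bar> * (\<bar>k x y * b y\<bar> * \<bar>s y\<bar>) \<le> C * r x * (C' * phi y * s y)"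
      by (rule mult_mono[OF 1 2 order_trans[OF abs_ge_zero 1]]) simp
    then show "\<bar>case z of (x, y) \<Rightarrow> a x * r x * (k x y * b y * s y)\<bar> \<le>
        (case z of (x, y) \<Rightarrow> C * r x * (C' * (phi y * s y)))"
      by (simp add: z abs_mult mult_ac)
  qed
  from infsum_swap_banach[OF this] show ?thesis
    by (simp add: infsum_cmult_right'[symmetric] mult_ac)
qed

text \<open>Integrating \<open>k_ratio\<close> over \<open>x\<close> compares the column equations
  at two points; with \<open>y0\<close> as one of them, \<open>b y0 = 1\<close> turns the comparison
  into bounds for \<open>b\<close>. The row equation then bounds \<open>a\<close>: from below
  through the \<open>phi\<close>-moment \<open>S\<close>, from above through its single term at
  \<open>y0\<close>.\<close>

lemma schroedinger_pair_bounds: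
  assumes "schroedinger_pair k r s y0 a b"
  shows "1 / (K * phi y0) \<le> b y" "b y \<le> K * phi y"
    "1 / (K * S) \<le> a x" "a x \<le> K * phi y0 / s y0"
proof -
  have pos: "0 < a x" "0 < b y" and b0: "b y0 = 1"
    and row: "((\<lambda>y. k x y * b y * s y) has_sum 1 / a x) UNIV"
    and col: "((\<lambda>x. k x y * a x * r x) has_sum 1 / b y) UNIV" for x y
    using assms by (auto simp: schroedinger_pair_def)
  have ratio: "1 / b y' \<le> K * phi y * (1 / b y)" for y y'
  proof (rule has_sum_mono[OF col])
    show "((\<lambda>x. K * phi y * (k x y * a x * r x)) has_sum K * phi y * (1 / b y)) UNIV"
      by (intro has_sum_cmult_right col)
    show "k x y' * a x * r x \<le> K * phi y * (k x y * a x * r x)" for x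
      using mult_right_mono[OF k_ratio[of x y' y], of "a x * r x"] pos(1)[of x] r_prob(1)[of x]
      by (simp add: mult_ac)
  qed
  show "b y \<le> K * phi y"
    using ratio[of y0 y] pos(2)[of y] by (simp add: b0 pos_le_divide_eq)
  show "1 / (K * phi y0) \<le> b y"
    using ratio[of y y0] pos(2)[of y] Kphi_pos[of y0] by (simp add: b0 divide_simps mult_ac)
  have "1 / a x \<le> K * S"
  proof (rule has_sum_mono[OF row])
    show "((\<lambda>y. K * (phi y * s y)) has_sum K * S) UNIV"
      unfolding S_def by (intro has_sum_cmult_right has_sum_infsum phi_s)
    show "k x y * b y * s y \<le> K * (phi y * s y)" for y
    proof -
      have "b y \<le> K * phi y"
        using ratio[of y0 y] pos(2)[of y] by (simp add: b0 pos_le_divide_eq)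
      then have "k x y * b y \<le> 1 * (K * phi y)"
        using k_le[of x y] pos(2)[of y] by (intro mult_mono) auto
      then show ?thesis
        using s_prob(1)[of y] mult_right_mono by (fastforce simp: mult.assoc[symmetric])
    qed
  qed
  then show "1 / (K * S) \<le> a x"
    using pos(1)[of x] K_ge S_ge by (simp add: divide_simps mult_ac)
  have "k x y0 * b y0 * s y0 \<le> 1 / a x"
    by (rule has_sum_nonneg_le[OF row])
      (use k_pos pos(2) s_prob(1) in \<open>auto intro!: mult_nonneg_nonneg simp: less_imp_le\<close>)
  moreover have "1 / (K * phi y0) * s y0 \<le> k x y0 * s y0"
    using k_lower[of y0 x] s_y0 by (intro mult_right_mono) auto
  ultimately have "s y0 / (K * phi y0) \<le> 1 / a x"
    by (simp add: b0)
  then show "a x \<le> K * phi y0 / s y0"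
    using pos(1)[of x] Kphi_pos[of y0] s_y0 by (simp add: divide_simps mult_ac)
qed

section \<open>Sinkhorn iteration with the entry at \<open>y0\<close> held fixed\<close>

definition col_sum where "col_sum a y = (\<Sum>\<^sub>\<infinity>x. k x y * a x * r x)"
text \<open>The ordinary Sinkhorn update except at \<open>y0\<close>, where the value is held at
  \<open>1\<close>; the column equation given up there is recovered only in the limit.\<close>

definition b_step where "b_step a y = (if y = y0 then 1 else 1 / col_sum a y)"
definition a_step where "a_step b x = 1 / (\<Sum>\<^sub>\<infinity>y. k x y * b y * s y)"

text \<open>The upper bound that the term at \<open>y0\<close> alone gives for every
  \<open>a_step b\<close>. As a starting value it dominates its own update, so the iteration begins
  with a decrease.\<close>

definition C where "C = K * phi y0 / s y0"

lemma s_y0_le: "s y0 \<le> 1"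
  using s has_sum_nonneg_le[of s 1 y0] by (auto simp: prob_vectors_def)

lemma C_ge: "1 \<le> C"
  unfolding C_def using s_y0 s_y0_le Kphi_ge[of y0] by (simp add: pos_le_divide_eq)

lemma col_sum_mono:
  assumes "\<And>x. a x \<le> a' x" "\<And>x. 0 \<le> a x" "\<And>x. a' x \<le> B"
  shows "col_sum a y \<le> col_sum a' y"
  unfolding col_sum_def
proof (rule infsum_mono)
  show "(\<lambda>x. k x y * a x * r x) summable_on UNIV" "(\<lambda>x. k x y * a' x * r x) summable_on UNIV"
    by (rule summable_col[where C = B], smt (verit) assms)+
  show "k x y * a x * r x \<le> k x y * a' x * r x" for x
    using assms(1)[of x] k_pos[of x y] r_prob(1)[of x] by (intro mult_right_mono mult_left_mono) auto
qed

lemma col_sum_ratio: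
  assumes "\<And>x. 0 \<le> a x" "\<And>x. a x \<le> B"
  shows "col_sum a y0 \<le> K * phi y * col_sum a y"
  unfolding col_sum_def infsum_cmult_right'[symmetric]
proof (rule infsum_mono)
  have "(\<lambda>x. k x y * a x * r x) summable_on UNIV" for y
    by (rule summable_col[where C = B], smt (verit) assms)
  then show "(\<lambda>x. k x y0 * a x * r x) summable_on UNIV"
    "(\<lambda>x. K * phi y * (k x y * a x * r x)) summable_on UNIV"
    by (auto intro: summable_on_cmult_right)
  show "k x y0 * a x * r x \<le> K * phi y * (k x y * a x * r x)" for x
    using mult_right_mono[OF k_ratio[of x y0 y], of "a x * r x"] assms(1)[of x] r_prob(1)[of x]
    by (simp add: mult_ac)
qed

text \<open>A single inequality at \<open>y0\<close> suffices: \<open>col_sum_ratio\<close> carries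
  it to all columns and thereby keeps the updates below \<open>K * phi y\<close>.\<close>

lemma b_step_bounds:
  assumes "\<And>x. 0 \<le> a x" "\<And>x. a x \<le> B" "1 \<le> col_sum a y0"
  shows "0 < col_sum a y" "0 < b_step a y" "b_step a y \<le> K * phi y"
proof -
  have ge: "1 \<le> K * phi y * col_sum a y"
    using col_sum_ratio[of a B y, OF assms(1,2)] assms(3) by linarith
  then show *: "0 < col_sum a y"
    using Kphi_pos[of y] by (smt (verit) zero_less_mult_pos)
  then show "0 < b_step a y" by (simp add: b_step_def)
  show "b_step a y \<le> K * phi y"
    using ge * Kphi_ge[of y] Kphi_ge[of y0] by (simp add: b_step_def pos_divide_le_eq)
qed

lemma a_step_bounds:
  assumes b: "\<And>y. 0 < b y" "\<And>y. b y \<le> K * phi y" and b0: "b y0 = 1"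
  shows "1 / (K * S) \<le> a_step b x" "a_step b x \<le> C" "0 < a_step b x"
    "a_step b x * (\<Sum>\<^sub>\<infinity>y. k x y * b y * s y) = 1"
proof -
  have summ: "(\<lambda>y. k x y * b y * s y) summable_on UNIV"
    by (rule summable_row[where C = K], smt (verit) assms)
  have nn: "0 \<le> k x y * b y * s y" for y
    using k_pos[of x y] b(1)[of y] s_prob(1)[of y] by simp
  have "k x y0 * b y0 * s y0 \<le> (\<Sum>\<^sub>\<infinity>y. k x y * b y * s y)"
    by (rule has_sum_nonneg_le[OF has_sum_infsum[OF summ] nn])
  moreover have "1 / (K * phi y0) * s y0 \<le> k x y0 * s y0"
    using k_lower[of y0 x] s_y0 by (intro mult_right_mono) auto
  ultimately have lower: "s y0 / (K * phi y0) \<le> (\<Sum>\<^sub>\<infinity>y. k x y * b y * s y)"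
    by (simp add: b0)
  have pos: "0 < (\<Sum>\<^sub>\<infinity>y. k x y * b y * s y)"
    using lower s_y0 Kphi_pos[of y0] by (smt (verit) divide_pos_pos)
  have upper: "(\<Sum>\<^sub>\<infinity>y. k x y * b y * s y) \<le> K * S"
    unfolding S_def infsum_cmult_right'[symmetric]
  proof (rule infsum_mono[OF summ summable_on_cmult_right[OF phi_s]])
    show "k x y * b y * s y \<le> K * (phi y * s y)" for y
      using mult_mono[OF k_le[of x y] b(2)[of y]] b(1)[of y] s_prob(1)[of y]
        mult_right_mono[of "k x y * b y" "K * phi y" "s y"]
      by (simp add: mult.assoc)
  qed
  show "0 < a_step b x" "a_step b x * (\<Sum>\<^sub>\<infinity>y. k x y * b y * s y) = 1"
    using pos by (simp_all add: a_step_def)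
  show "1 / (K * S) \<le> a_step b x"
    unfolding a_step_def using upper pos by (intro divide_left_mono) auto
  have "1 / (\<Sum>\<^sub>\<infinity>y. k x y * b y * s y) \<le> 1 / (s y0 / (K * phi y0))"
    using lower pos s_y0 Kphi_pos[of y0] by (intro divide_left_mono) auto
  then show "a_step b x \<le> C"
    by (simp add: a_step_def C_def)
qed

lemma a_step_antimono:
  assumes b: "\<And>y. 0 < b y" "\<And>y. b y \<le> K * phi y" "b y0 = 1"
    and b': "\<And>y. 0 < b' y" "\<And>y. b' y \<le> K * phi y" "b' y0 = 1" and le: "\<And>y. b y \<le> b' y"
  shows "a_step b' x \<le> a_step b x"
proof -
  have "(\<Sum>\<^sub>\<infinity>y. k x y * b y * s y) \<le> (\<Sum>\<^sub>\<infinity>y. k x y * b' y * s y)"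
  proof (rule infsum_mono)
    show "(\<lambda>y. k x y * b y * s y) summable_on UNIV" "(\<lambda>y. k x y * b' y * s y) summable_on UNIV"
      by (rule summable_row[where C = K], smt (verit) assms)+
    show "k x y * b y * s y \<le> k x y * b' y * s y" for y
      using le[of y] k_pos[of x y] s_prob(1)[of y] by (intro mult_right_mono mult_left_mono) auto
  qed
  moreover have "0 < (\<Sum>\<^sub>\<infinity>y. k x y * b y * s y)" "0 < (\<Sum>\<^sub>\<infinity>y. k x y * b' y * s y)"
    using a_step_bounds(3)[OF b, of x] a_step_bounds(3)[OF b', of x] by (auto simp: a_step_def)
  ultimately show ?thesis
    unfolding a_step_def by (intro divide_left_mono) auto
qed

text \<open>The total mass of the coupling \<open>k a b r s\<close> controls the only equation that is not imposed
  by the iteration, the one at \<open>y0\<close>.\<close>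

lemma mass_balance:
  assumes b: "\<And>y. 0 < b y" "\<And>y. b y \<le> K * phi y" "b y0 = 1"
  shows "(\<Sum>\<^sub>\<infinity>y. b y * s y * col_sum (a_step b) y) = 1"
    "(\<lambda>y. b y * s y * col_sum (a_step b) y) summable_on UNIV"
proof -
  note ab = a_step_bounds[OF b]
  have a: "\<bar>a_step b x\<bar> \<le> C" for x
    using ab(2,3)[of x] by simp
  have "\<bar>b y\<bar> \<le> K * phi y" for y
    using b(1,2)[of y] by simp
  from mass_exchange[of "a_step b", OF a this]
  have "(\<Sum>\<^sub>\<infinity>y. b y * s y * col_sum (a_step b) y) =
      (\<Sum>\<^sub>\<infinity>x. a_step b x * r x * (\<Sum>\<^sub>\<infinity>y. k x y * b y * s y))"
    by (simp add: col_sum_def)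
  also have "\<dots> = infsum r UNIV"
    using ab(4) by (intro infsum_cong) (simp add: mult_ac)
  finally show "(\<Sum>\<^sub>\<infinity>y. b y * s y * col_sum (a_step b) y) = 1"
    by (simp add: r_prob)
  then show "(\<lambda>y. b y * s y * col_sum (a_step b) y) summable_on UNIV"
    using infsum_not_exists by fastforce
qed

text \<open>Total column mass when every column except \<open>y0\<close> is exact and the one at
  \<open>y0\<close> carries \<open>s y0 * m\<close>; set against total mass one, it controls
  \<open>m\<close>.\<close>

lemma sum_split_y0:
  "((\<lambda>y. s y * (if y = y0 then m else 1)) has_sum (1 - s y0 + s y0 * m)) UNIV"
proof -
  have "(s has_sum 1) UNIV" using s by (simp add: prob_vectors_def)
  moreover have "((\<lambda>y. if y = y0 then s y0 * (m - 1) else 0) has_sum s y0 * (m - 1)) UNIV"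
    by (rule has_sum_finite_neutralI[of "{y0}"]) auto
  ultimately have "((\<lambda>y. s y + (if y = y0 then s y0 * (m - 1) else 0)) has_sum
      1 + s y0 * (m - 1)) UNIV"
    by (rule has_sum_add)
  then show ?thesis
    by (simp add: algebra_simps if_distrib cong: if_cong)
qed

text \<open>After \<open>a_step\<close> all rows are exact, so the total mass is one. Away from
  \<open>y0\<close>, lowering \<open>a\<close> can only lower the columns, which were exact before;
  the mass they lose must sit at \<open>y0\<close>, so the column sum there stays at least
  \<open>1\<close>.\<close>

lemma col_sum_step:
  assumes a: "\<And>x. 0 \<le> a x" "\<And>x. a x \<le> C" "1 \<le> col_sum a y0"
    and le: "\<And>x. a_step (b_step a) x \<le> a x"
  shows "1 \<le> col_sum (a_step (b_step a)) y0"
proof -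
  let ?b = "b_step a" and ?m = "col_sum (a_step (b_step a)) y0"
  have b: "0 < ?b y" "?b y \<le> K * phi y" "?b y0 = 1" for y
    using b_step_bounds[OF a] by (auto simp: b_step_def)
  have "1 \<le> 1 - s y0 + s y0 * ?m"
  proof (rule has_sum_mono)
    show "((\<lambda>y. ?b y * s y * col_sum (a_step ?b) y) has_sum 1) UNIV"
      using mass_balance[of ?b, OF b] by (metis has_sum_infsum)
    show "((\<lambda>y. s y * (if y = y0 then ?m else 1)) has_sum (1 - s y0 + s y0 * ?m)) UNIV"
      by (rule sum_split_y0)
    fix y
    have "?b y * col_sum (a_step ?b) y \<le> (if y = y0 then ?m else 1)"
    proof (cases "y = y0")
      case False
      have "col_sum (a_step ?b) y \<le> col_sum a y"
        by (rule col_sum_mono[where B = C]) (use le a a_step_bounds(3)[of ?b, OF b] in \<open>auto simp: less_imp_le\<close>)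
      then show ?thesis
        using False b_step_bounds(1)[of a C y, OF a] by (simp add: b_step_def)
    qed (simp add: b)
    then show "?b y * s y * col_sum (a_step ?b) y \<le> s y * (if y = y0 then ?m else 1)"
      using mult_left_mono[OF _ s_prob(1)[of y]] by (fastforce simp: mult_ac)
  qed
  then show ?thesis
    using s_y0 by (simp add: mult_le_cancel_left1)
qed

primrec iter :: "nat \<Rightarrow> 'x \<Rightarrow> real" where
  "iter 0 = (\<lambda>_. C)"
| "iter (Suc n) = a_step (b_step (iter n))"

lemma iter_0_col_sum: "1 \<le> col_sum (iter 0) y0"
proof -
  have "infsum r UNIV \<le> col_sum (iter 0) y0"
    unfolding col_sum_def
  proof (rule infsum_mono)
    show "(\<lambda>x. k x y0 * iter 0 x * r x) summable_on UNIV"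
      by (rule summable_col[where C = C]) (use C_ge in auto)
    fix x
    have "1 \<le> K * phi y0 * k x y0 * (1 / s y0)"
      using k_ge[of y0 x] s_y0 s_y0_le by (simp add: pos_le_divide_eq)
    then have "1 \<le> k x y0 * C"
      by (simp add: C_def mult_ac)
    then show "r x \<le> k x y0 * iter 0 x * r x"
      using mult_right_mono[of 1 "k x y0 * C" "r x"] r_prob(1)[of x] by simp
  qed (simp add: r_prob)
  then show ?thesis by (simp add: r_prob)
qed

text \<open>The clauses feed each other: the bound at \<open>y0\<close> bounds the next
  \<open>b\<close> and hence the next \<open>a\<close>; a smaller \<open>a\<close> gives a larger
  \<open>b\<close>, and a larger \<open>b\<close> a smaller \<open>a\<close>, so the decrease
  persists; and the decrease is what \<open>col_sum_step\<close> needs.\<close>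

lemma iter_invariant:
  "(\<forall>x. 1 / (K * S) \<le> iter n x \<and> iter n x \<le> C) \<and> 1 \<le> col_sum (iter n) y0 \<and>
    (\<forall>x. iter (Suc n) x \<le> iter n x)"
proof (induction n)
  case 0
  have KS: "1 \<le> K * S" using K_ge S_ge mult_mono[of 1 K 1 S] by simp
  then have "1 / (K * S) \<le> C"
    using C_ge by (smt (verit) divide_le_eq_1)
  moreover have "iter (Suc 0) x \<le> C" for x
    using b_step_bounds[of "iter 0" C y] iter_0_col_sum C_ge
    by (simp, intro a_step_bounds(2)) (use b_step_bounds[of "iter 0" C] iter_0_col_sum C_ge in \<open>auto simp: b_step_def\<close>)
  ultimately show ?case using iter_0_col_sum by simp
next
  case (Suc n)
  have KS: "0 < 1 / (K * S)" using K_ge S_ge by simp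
  let ?a = "iter n" and ?a' = "iter (Suc n)"
  have a: "0 \<le> ?a x" "?a x \<le> C" "1 \<le> col_sum ?a y0" for x
    using Suc KS by (smt (verit))+
  have b: "0 < b_step ?a y" "b_step ?a y \<le> K * phi y" "b_step ?a y0 = 1" for y
    using b_step_bounds[OF a] by (auto simp: b_step_def)
  have a': "1 / (K * S) \<le> ?a' x" "?a' x \<le> C" "0 \<le> ?a' x" for x
    using a_step_bounds[of "b_step ?a", OF b] by (auto simp: less_imp_le)
  have le: "?a' x \<le> ?a x" for x using Suc by simp
  have col: "1 \<le> col_sum ?a' y0"
    using col_sum_step[of ?a, OF a] le by simp
  have b': "0 < b_step ?a' y" "b_step ?a' y \<le> K * phi y" "b_step ?a' y0 = 1" for y
    using b_step_bounds[OF a'(3,2) col] by (auto simp: b_step_def)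
  have "b_step ?a y \<le> b_step ?a' y" for y
    using col_sum_mono[of ?a' ?a C y, OF le a'(3) a(2)] b_step_bounds(1)[of ?a C y, OF a] b_step_bounds(1)[of ?a' C y, OF a'(3,2) col]
    by (auto simp: b_step_def intro: divide_left_mono)
  then have "iter (Suc (Suc n)) x \<le> ?a' x" for x
    using a_step_antimono[OF b b'] by simp
  with a' col show ?case by blast
qed

theorem schroedinger_pair_exists: "\<exists>a b. schroedinger_pair k r s y0 a b"
proof -
  have KS: "0 < 1 / (K * S)" using K_ge S_ge by simp
  have it: "1 / (K * S) \<le> iter n x" "iter n x \<le> C" "1 \<le> col_sum (iter n) y0"
    "iter (Suc n) x \<le> iter n x" for n x
    using iter_invariant[of n] by auto
  have it0: "0 \<le> iter n x" for n x
    using it(1)[of n x] KS by linarith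
  have "convergent (\<lambda>n. iter n x)" for x
    using it by (intro Bseq_monoseq_convergent decseq_imp_monoseq decseq_SucI BseqI'[where K = C])
      (auto simp: it0)
  then obtain a where a: "(\<lambda>n. iter n x) \<longlonglongrightarrow> a x" for x
    unfolding convergent_def by metis
  define b where "b = b_step a"
  have a_ge: "1 / (K * S) \<le> a x" for x
    using a[of x] it(1) by (intro LIMSEQ_le_const) auto
  have a_le: "a x \<le> C" for x
    using a[of x] it(2) by (intro LIMSEQ_le_const2) auto
  have a_pos: "0 < a x" for x using a_ge[of x] KS by linarith
  have col_lim: "(\<lambda>n. col_sum (iter n) y) \<longlonglongrightarrow> col_sum a y" for y
    unfolding col_sum_def
  proof (rule infsum_tendsto_dominated)
    show "(\<lambda>x. C * r x) summable_on UNIV"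
      by (intro summable_on_cmult_right r_prob)
    show "\<bar>k x y * iter n x * r x\<bar> \<le> C * r x" for n x
      using mult_mono[OF k_le[of x y] it(2)[of n x]] k_pos[of x y] r_prob(1)[of x] it0[of n x]
      by (simp add: abs_mult mult_right_mono)
    show "(\<lambda>n. k x y * iter n x * r x) \<longlonglongrightarrow> k x y * a x * r x" for x
      by (intro tendsto_intros a)
  qed
  have col0: "1 \<le> col_sum a y0"
    using col_lim[of y0] it(3) by (intro LIMSEQ_le_const) auto
  note bb = b_step_bounds[of a C, OF less_imp_le[OF a_pos] a_le col0, folded b_def]
  have b0: "b y0 = 1" by (simp add: b_def b_step_def)
  have b_lim: "(\<lambda>n. b_step (iter n) y) \<longlonglongrightarrow> b y" for y
    using bb(1)[of y] unfolding b_def b_step_def by (auto intro!: tendsto_intros col_lim)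
  have row_lim: "(\<lambda>n. \<Sum>\<^sub>\<infinity>y. k x y * b_step (iter n) y * s y) \<longlonglongrightarrow> (\<Sum>\<^sub>\<infinity>y. k x y * b y * s y)" for x
  proof (rule infsum_tendsto_dominated)
    show "(\<lambda>y. K * (phi y * s y)) summable_on UNIV"
      by (intro summable_on_cmult_right phi_s)
    have bs: "b_step (iter n) y \<le> K * phi y" "0 < b_step (iter n) y" for n y
      using b_step_bounds(2,3)[of "iter n" C] it0 it(2,3) by auto
    show "\<bar>k x y * b_step (iter n) y * s y\<bar> \<le> K * (phi y * s y)" for n y
      using mult_mono[OF k_le[of x y] bs(1)[of n y]] k_pos[of x y] s_prob(1)[of y] bs(2)[of n y]
      by (simp add: abs_mult mult_right_mono flip: mult.assoc)
    show "(\<lambda>n. k x y * b_step (iter n) y * s y) \<longlonglongrightarrow> k x y * b y * s y" for y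
      by (intro tendsto_intros b_lim)
  qed
  note ab = a_step_bounds[of b, OF bb(2,3) b0]
  have step: "(\<lambda>n. iter (Suc n) x) \<longlonglongrightarrow> a_step b x" for x
    unfolding iter.simps a_step_def
    by (intro tendsto_intros row_lim) (use ab(4)[of x] in auto)
  have a_eq: "a_step b = a"
    by (rule ext, rule LIMSEQ_unique[OF step LIMSEQ_Suc[OF a]])
  \<comment> \<open>In the limit every column away from \<open>y0\<close> is exact by construction
    and the rows are exact as well, so conservation of mass leaves \<open>col_sum a y0 = 1\<close>
    as the only possibility.\<close>
  have "(\<Sum>\<^sub>\<infinity>y. b y * s y * col_sum a y) = (\<Sum>\<^sub>\<infinity>y. s y * (if y = y0 then col_sum a y0 else 1))"
    using bb(1) by (intro infsum_cong) (auto simp: b_def b_step_def, metis less_irrefl)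
  then have "1 - s y0 + s y0 * col_sum a y0 = 1"
    using mass_balance(1)[of b, OF bb(2,3) b0] infsumI[OF sum_split_y0] by (simp add: a_eq)
  then have "col_sum a y0 = 1" using s_y0 by (simp add: algebra_simps)
  then have b_eq: "1 / b y = col_sum a y" for y
    by (simp add: b_def b_step_def)
  have "schroedinger_pair k r s y0 a b"
    unfolding schroedinger_pair_def
  proof (intro conjI allI)
    show "((\<lambda>y. k x y * b y * s y) has_sum 1 / a x) UNIV" for x
    proof -
      have "(\<lambda>y. k x y * b y * s y) summable_on UNIV"
        by (rule summable_row[where C = K]) (use bb(2,3) in \<open>simp add: less_imp_le\<close>)
      moreover have "(\<Sum>\<^sub>\<infinity>y. k x y * b y * s y) = 1 / a x"
        using a_eq by (auto simp: a_step_def)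
      ultimately show ?thesis by (metis has_sum_infsum)
    qed
    show "((\<lambda>x. k x y * a x * r x) has_sum 1 / b y) UNIV" for y
      unfolding b_eq col_sum_def
      by (rule has_sum_infsum, rule summable_col[where C = C]) (use a_pos a_le in \<open>simp add: less_imp_le\<close>)
  qed (use a_pos bb(2) b0 in auto)
  then show ?thesis by blast
qed

end

section \<open>The linearized optimality conditions\<close>

lemma l1_spaceD:
  assumes "h \<in> l1_space w UNIV"
  shows "(\<lambda>z. w z * \<bar>h z\<bar>) summable_on UNIV"
  using assms by (simp add: l1_space_def)

lemma l1_pairing:
  assumes h: "h \<in> l1_space w UNIV" and f: "\<And>z. \<bar>f z\<bar> \<le> B * w z"
  shows "(\<lambda>z. f z * h z) summable_on UNIV" "\<bar>\<Sum>\<^sub>\<infinity>z. f z * h z\<bar> \<le> B * l1_norm w UNIV h"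
proof -
  have summ: "(\<lambda>z. B * (w z * \<bar>h z\<bar>)) summable_on UNIV"
    by (intro summable_on_cmult_right l1_spaceD[OF h])
  have le: "\<bar>f z * h z\<bar> \<le> B * (w z * \<bar>h z\<bar>)" for z
    using mult_right_mono[OF f[of z], of "\<bar>h z\<bar>"] by (simp add: abs_mult mult.assoc)
  show "(\<lambda>z. f z * h z) summable_on UNIV"
    using summ le by (rule summable_on_abs_le)
  have "\<bar>\<Sum>\<^sub>\<infinity>z. f z * h z\<bar> \<le> (\<Sum>\<^sub>\<infinity>z. B * (w z * \<bar>h z\<bar>))"
    using summ le by (rule abs_infsum_le)
  then show "\<bar>\<Sum>\<^sub>\<infinity>z. f z * h z\<bar> \<le> B * l1_norm w UNIV h"
    by (simp add: infsum_cmult_right' l1_norm_def)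
qed

lemma l1_norm_nonneg: "(\<And>z. 0 \<le> w z) \<Longrightarrow> 0 \<le> l1_norm w UNIV h"
  unfolding l1_norm_def by (intro infsum_nonneg) simp

lemma l1_space_add:
  assumes "f \<in> l1_space w UNIV" "g \<in> l1_space w UNIV" "\<And>z. 0 \<le> w z"
  shows "f + g \<in> l1_space w UNIV"
    "l1_norm w UNIV (f + g) \<le> l1_norm w UNIV f + l1_norm w UNIV g"
proof -
  have summ: "(\<lambda>z. w z * \<bar>f z\<bar> + w z * \<bar>g z\<bar>) summable_on UNIV"
    by (intro summable_on_add l1_spaceD assms)
  have le: "w z * \<bar>(f + g) z\<bar> \<le> w z * \<bar>f z\<bar> + w z * \<bar>g z\<bar>" for z
    using mult_left_mono[OF abs_triangle_ineq[of "f z" "g z"] assms(3)[of z]] by (simp add: distrib_left)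
  have summ': "(\<lambda>z. w z * \<bar>(f + g) z\<bar>) summable_on UNIV"
    by (rule summable_on_abs_le[OF summ]) (use le assms(3) in \<open>simp add: abs_mult\<close>)
  then show "f + g \<in> l1_space w UNIV" by (simp add: l1_space_def)
  have "l1_norm w UNIV (f + g) \<le> (\<Sum>\<^sub>\<infinity>z. w z * \<bar>f z\<bar> + w z * \<bar>g z\<bar>)"
    unfolding l1_norm_def by (rule infsum_mono[OF summ' summ le])
  also have "\<dots> = l1_norm w UNIV f + l1_norm w UNIV g"
    unfolding l1_norm_def by (intro infsum_add l1_spaceD assms)
  finally show "l1_norm w UNIV (f + g) \<le> l1_norm w UNIV f + l1_norm w UNIV g" .
qed

lemma l1_space_scaleR:
  assumes "f \<in> l1_space w UNIV"
  shows "a *\<^sub>R f \<in> l1_space w UNIV" "l1_norm w UNIV (a *\<^sub>R f) = \<bar>a\<bar> * l1_norm w UNIV f"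
proof -
  have eq: "(\<lambda>z. w z * \<bar>(a *\<^sub>R f) z\<bar>) = (\<lambda>z. \<bar>a\<bar> * (w z * \<bar>f z\<bar>))"
    by (simp add: scaleR_fun_def abs_mult mult_ac)
  show "a *\<^sub>R f \<in> l1_space w UNIV"
    using summable_on_cmult_right[OF l1_spaceD[OF assms], of "\<bar>a\<bar>"] by (simp add: l1_space_def eq)
  show "l1_norm w UNIV (a *\<^sub>R f) = \<bar>a\<bar> * l1_norm w UNIV f"
    unfolding l1_norm_def eq by (rule infsum_cmult_right')
qed

lemma l1_space_diff:
  assumes "f \<in> l1_space w UNIV" "g \<in> l1_space w UNIV" "\<And>z. 0 \<le> w z"
  shows "f - g \<in> l1_space w UNIV"
proof -
  have "f - g = f + (-1) *\<^sub>R g" by (simp add: fun_eq_iff scaleR_fun_def)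
  then show ?thesis using l1_space_add(1)[OF assms(1) l1_space_scaleR(1)[OF assms(2), of "-1"] assms(3)] by simp
qed

lemma l1_space_summable:
  assumes h: "h \<in> l1_space w UNIV" and w: "\<And>z. 1 \<le> w z"
  shows "h summable_on UNIV" "\<bar>infsum h UNIV\<bar> \<le> l1_norm w UNIV h"
proof -
  have le: "\<bar>h z\<bar> \<le> w z * \<bar>h z\<bar>" for z
    using mult_right_mono[OF w[of z], of "\<bar>h z\<bar>"] by simp
  show "h summable_on UNIV" by (rule summable_on_abs_le[OF l1_spaceD[OF h] le])
  show "\<bar>infsum h UNIV\<bar> \<le> l1_norm w UNIV h"
    unfolding l1_norm_def by (rule abs_infsum_le[OF l1_spaceD[OF h] le])
qed

lemma linf_space_UNIV_iff:
  "a \<in> linf_space (\<lambda>_. 1) UNIV \<longleftrightarrow> (\<exists>A. \<forall>x. \<bar>a x\<bar> \<le> A)"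
  by (auto simp: linf_space_def bdd_above_def)

lemma linf_space_omit_iff:
  assumes "\<And>y. 0 < w y"
  shows "b \<in> linf_space w (- {y1}) \<longleftrightarrow> b y1 = 0 \<and> (\<exists>B. \<forall>y. \<bar>b y\<bar> \<le> B * w y)"
proof
  assume "b \<in> linf_space w (- {y1})"
  then obtain B where B: "\<And>y. y \<noteq> y1 \<Longrightarrow> \<bar>b y\<bar> / w y \<le> B" and b: "b y1 = 0"
    by (auto simp: linf_space_def bdd_above_def)
  \<comment> \<open>A negative \<open>B\<close> is possible when \<open>y1\<close> is the only
    index; taking \<open>\<bar>B\<bar>\<close> also covers the entry at \<open>y1\<close>.\<close>
  have "\<bar>b y\<bar> \<le> \<bar>B\<bar> * w y" for y
  proof (cases "y = y1")
    case False
    have "\<bar>b y\<bar> / w y \<le> \<bar>B\<bar>" using B[OF False] by linarith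
    then show ?thesis using assms[of y] by (simp add: pos_divide_le_eq)
  qed (use b assms[of y] in simp)
  with b show "b y1 = 0 \<and> (\<exists>B. \<forall>y. \<bar>b y\<bar> \<le> B * w y)" by blast
next
  assume *: "b y1 = 0 \<and> (\<exists>B. \<forall>y. \<bar>b y\<bar> \<le> B * w y)"
  then obtain B where "\<And>y. \<bar>b y\<bar> \<le> B * w y" by blast
  then have "\<bar>b y\<bar> / w y \<le> B" for y
    using assms[of y] by (simp add: pos_divide_le_eq)
  with * show "b \<in> linf_space w (- {y1})"
    by (auto simp: linf_space_def bdd_above_def)
qed

text \<open>\<open>p\<close> is the density of the plan with respect to \<open>r \<otimes> s\<close>.\<close>

locale gibbs_density =
  fixes p :: "'x \<Rightarrow> 'y \<Rightarrow> real" and r :: "'x \<Rightarrow> real" and s :: "'y \<Rightarrow> real"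
    and phi CY :: "'y \<Rightarrow> real" and CX :: "'x \<Rightarrow> real" and y1 :: 'y and M \<theta> :: real
  assumes p_pos: "\<And>x y. 0 < p x y" and p_le: "\<And>x y. p x y \<le> M * phi y"
    and row: "\<And>x. ((\<lambda>y. p x y * s y) has_sum 1) UNIV"
    and col: "\<And>y. ((\<lambda>x. p x y * r x) has_sum 1) UNIV"
    and M_ge: "1 \<le> M" and phi_ge: "\<And>y. 1 \<le> phi y"
    and theta_pos: "0 < \<theta>" and theta_le: "\<And>x. \<theta> \<le> p x y1 * s y1"
    and r: "r \<in> prob_vectors" and s: "s \<in> prob_vectors"
    and r_pos: "\<And>x. 0 < r x" and s_pos: "\<And>y. 0 < s y"
    and CX_ge: "\<And>x. 1 \<le> CX x" and CY_ge: "\<And>y. 1 \<le> CY y"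
    and CX_r: "(\<lambda>x. CX x * r x) summable_on UNIV"
    and CY_s: "(\<lambda>y. CY y * phi y ^ 4 * s y) summable_on UNIV"
begin

definition Phi4 where "Phi4 = (\<lambda>y. CY y * phi y ^ 4)"
definition plan where "plan = (\<lambda>(x, y). p x y * r x * s y)"

abbreviation "nX \<equiv> l1_norm CX UNIV"
abbreviation "nY \<equiv> l1_norm Phi4 UNIV"
abbreviation "lX \<equiv> l1_space CX UNIV"
abbreviation "lY \<equiv> l1_space Phi4 UNIV"
abbreviation "LX \<equiv> linf_space (\<lambda>_. 1) (UNIV :: 'x set)"
abbreviation "LY \<equiv> linf_space phi (- {y1})"

abbreviation "AX \<equiv> op_AX y1 plan r"
abbreviation "AY \<equiv> op_AY y1 plan s"
abbreviation "BX \<equiv> op_BX plan r s"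
abbreviation "BY \<equiv> op_BY y1 plan r s"
abbreviation "IX \<equiv> \<lambda>a. a - AX (AY a)"
abbreviation "IY \<equiv> \<lambda>b. b - AY (AX b)"

text \<open>Conditional expectations under the plan, given \<open>x\<close> and given
  \<open>y\<close>, before the entry at \<open>y1\<close> is omitted. By \<open>row\<close> and
  \<open>col\<close> they preserve constants.\<close>

definition avX where "avX b x = (\<Sum>\<^sub>\<infinity>y. p x y * b y * s y)"
definition avY where "avY a y = (\<Sum>\<^sub>\<infinity>x. p x y * a x * r x)"

lemma phi_pow: "1 \<le> phi y ^ i" "0 < phi y ^ i" "0 < phi y"
  using phi_ge[of y] one_le_power[of "phi y" i] by auto

lemma phi_pow_le: "i \<le> 4 \<Longrightarrow> phi y ^ i \<le> Phi4 y"
  using power_increasing[of i 4 "phi y"] phi_ge[of y] mult_right_mono[OF CY_ge[of y], of "phi y ^ 4"]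
    phi_pow(2)[of y 4]
  unfolding Phi4_def by (smt (verit) mult_cancel_right1)

lemma Phi4_ge: "1 \<le> Phi4 y"
  using phi_pow_le[of 0 y] by simp

lemma r_lX: "r \<in> lX"
  using CX_r r_pos by (simp add: l1_space_def less_imp_le)

lemma s_lY: "s \<in> lY"
  using CY_s s_pos by (simp add: l1_space_def Phi4_def less_imp_le)

lemma nX_nonneg: "0 \<le> nX h" and nY_nonneg: "0 \<le> nY h'"
  by (rule l1_norm_nonneg, rule order_trans[OF zero_le_one], rule CX_ge Phi4_ge)+

text \<open>Of the four powers in \<open>Phi4\<close> the density takes one, which leaves room for
  growth of order \<open>phi y ^ 3\<close> in the other factor.\<close>

lemma lY_pairing:
  assumes "h \<in> lY" "\<And>y. \<bar>f y\<bar> \<le> B * phi y ^ 3"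
  shows "(\<lambda>y. p x y * f y * h y) summable_on UNIV"
    "\<bar>\<Sum>\<^sub>\<infinity>y. p x y * f y * h y\<bar> \<le> M * B * nY h"
proof -
  have "0 \<le> B * phi y ^ 3" for y
    using order_trans[OF abs_ge_zero assms(2)[of y]] .
  from this[of y1] have B: "0 \<le> B"
    using phi_pow(2)[of y1 3] by (simp add: zero_le_mult_iff)
  have "\<bar>p x y * f y\<bar> \<le> M * B * Phi4 y" for y
  proof -
    have "\<bar>p x y * f y\<bar> \<le> (M * phi y) * (B * phi y ^ 3)"
      unfolding abs_mult using p_pos[of x y] p_le[of x y] assms(2)[of y] by (intro mult_mono) auto
    also have "\<dots> = M * B * phi y ^ 4" by (simp add: power_numeral_reduce)
    also have "\<dots> \<le> M * B * Phi4 y"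
      using phi_pow_le[of 4 y] M_ge B by (intro mult_left_mono) auto
    finally show ?thesis .
  qed
  from l1_pairing[OF assms(1) this]
  show "(\<lambda>y. p x y * f y * h y) summable_on UNIV"
    "\<bar>\<Sum>\<^sub>\<infinity>y. p x y * f y * h y\<bar> \<le> M * B * nY h" .
qed

text \<open>The weight \<open>CX\<close> cannot absorb the growth of the density in
  \<open>y\<close>, so a factor \<open>phi y\<close> remains; this is why \<open>BY\<close> maps
  into the \<open>phi\<close>-weighted space.\<close>

lemma lX_pairing:
  assumes "h \<in> lX" "\<And>x. \<bar>f x\<bar> \<le> A"
  shows "(\<lambda>x. p x y * f x * h x) summable_on UNIV"
    "\<bar>\<Sum>\<^sub>\<infinity>x. p x y * f x * h x\<bar> \<le> M * A * nX h * phi y"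
proof -
  have A: "0 \<le> A" using order_trans[OF abs_ge_zero assms(2)] .
  have "\<bar>p x y * f x\<bar> \<le> (M * A * phi y) * CX x" for x
  proof -
    have "\<bar>p x y * f x\<bar> \<le> (M * phi y) * A"
      unfolding abs_mult using p_pos[of x y] p_le[of x y] assms(2)[of x] by (intro mult_mono) auto
    also have "\<dots> \<le> (M * phi y * A) * CX x"
      using mult_left_mono[OF CX_ge[of x], of "M * phi y * A"] M_ge A phi_ge[of y] by simp
    finally show ?thesis by (simp add: mult_ac)
  qed
  from l1_pairing[OF assms(1) this]
  show "(\<lambda>x. p x y * f x * h x) summable_on UNIV"
    "\<bar>\<Sum>\<^sub>\<infinity>x. p x y * f x * h x\<bar> \<le> M * A * nX h * phi y"
    by (simp_all add: mult_ac)
qed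

section \<open>The four operators as averages with the density\<close>

lemma BX_eq: "BX h = (\<lambda>x. \<Sum>\<^sub>\<infinity>y. p x y * h y)"
  by (rule ext, unfold op_BX_def plan_def, rule infsum_cong)
    (use r_pos s_pos in \<open>simp add: less_imp_neq[symmetric]\<close>)

lemma BY_eq: "BY h = omit y1 (\<lambda>y. \<Sum>\<^sub>\<infinity>x. p x y * h x)"
proof -
  have "(\<Sum>\<^sub>\<infinity>x. plan (x, y) / (r x * s y) * h x) = (\<Sum>\<^sub>\<infinity>x. p x y * h x)" for y
    by (rule infsum_cong) (use r_pos s_pos in \<open>simp add: plan_def less_imp_neq[symmetric]\<close>)
  then show ?thesis by (simp add: op_BY_def)
qed

lemma AX_eq: "b y1 = 0 \<Longrightarrow> AX b = avX b"
  unfolding op_AX_def avX_def plan_def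
  by (rule ext, rule infsum_cong_neutral) (use r_pos in \<open>auto simp: less_imp_neq[symmetric]\<close>)

lemma AY_eq: "AY a = omit y1 (avY a)"
proof -
  have "(\<Sum>\<^sub>\<infinity>x. plan (x, y) / s y * a x) = avY a y" for y
    unfolding avY_def by (rule infsum_cong) (use s_pos in \<open>simp add: plan_def less_imp_neq[symmetric]\<close>)
  then show ?thesis by (simp add: op_AY_def)
qed

lemma BX_bound: "h \<in> lY \<Longrightarrow> \<bar>BX h x\<bar> \<le> M * nY h"
  using lY_pairing(2)[of h "\<lambda>_. 1" 1 x] phi_pow(1) by (simp add: BX_eq)

lemma BY_bound: "h \<in> lX \<Longrightarrow> \<bar>BY h y\<bar> \<le> M * nX h * phi y"
  using lX_pairing(2)[of h "\<lambda>_. 1" 1 y] phi_pow(3)[of y1] M_ge nX_nonneg[of h]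
  by (simp add: BY_eq omit_def)

lemma avX_summable: "(\<And>y. \<bar>b y\<bar> \<le> B * phi y ^ 3) \<Longrightarrow> (\<lambda>y. p x y * b y * s y) summable_on UNIV"
  by (rule lY_pairing[OF s_lY])

lemma avY_summable: "(\<And>x. \<bar>a x\<bar> \<le> A) \<Longrightarrow> (\<lambda>x. p x y * a x * r x) summable_on UNIV"
  by (rule lX_pairing[OF r_lX])

lemma avX_bound: "(\<And>y. \<bar>b y\<bar> \<le> B * phi y ^ 3) \<Longrightarrow> \<bar>avX b x\<bar> \<le> M * B * nY s"
  unfolding avX_def by (rule lY_pairing[OF s_lY])

lemma avY_bound:
  assumes "\<And>x. \<bar>a x\<bar> \<le> A"
  shows "\<bar>avY a y\<bar> \<le> A"
proof -
  have "\<bar>avY a y\<bar> \<le> (\<Sum>\<^sub>\<infinity>x. A * (p x y * r x))"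
    unfolding avY_def
  proof (rule abs_infsum_le)
    show "(\<lambda>x. A * (p x y * r x)) summable_on UNIV"
      using col[of y] by (intro summable_on_cmult_right) (auto simp: summable_on_def)
    show "\<bar>p x y * a x * r x\<bar> \<le> A * (p x y * r x)" for x
      using mult_right_mono[OF assms[of x], of "p x y * r x"] p_pos[of x y] r_pos[of x]
      by (simp add: abs_mult mult_ac)
  qed
  then show ?thesis
    using infsumI[OF col[of y]] by (simp add: infsum_cmult_right')
qed

text \<open>The omitted column carries mass at least \<open>\<theta>\<close>; this makes \<open>AX AY\<close> a contraction.\<close>

lemma avX_contract:
  assumes "\<And>y. \<bar>b y\<bar> \<le> B" "b y1 = 0"
  shows "\<bar>avX b x\<bar> \<le> (1 - \<theta>) * B"
proof -
  have B: "0 \<le> B" using order_trans[OF abs_ge_zero assms(1)] .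
  have one: "((\<lambda>y. if y = y1 then p x y1 * s y1 else 0) has_sum p x y1 * s y1) UNIV"
    by (rule has_sum_finite_neutralI[of "{y1}"]) auto
  have hs: "((\<lambda>y. B * (p x y * s y - (if y = y1 then p x y1 * s y1 else 0))) has_sum
      B * (1 - p x y1 * s y1)) UNIV"
    by (intro has_sum_cmult_right has_sum_diff row one)
  have "\<bar>avX b x\<bar> \<le> (\<Sum>\<^sub>\<infinity>y. B * (p x y * s y - (if y = y1 then p x y1 * s y1 else 0)))"
    unfolding avX_def
  proof (rule abs_infsum_le)
    show "(\<lambda>y. B * (p x y * s y - (if y = y1 then p x y1 * s y1 else 0))) summable_on UNIV"
      using hs by (auto simp: summable_on_def)
    show "\<bar>p x y * b y * s y\<bar> \<le> B * (p x y * s y - (if y = y1 then p x y1 * s y1 else 0))" for y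
      using mult_right_mono[OF assms(1)[of y], of "p x y * s y"] p_pos[of x y] s_pos[of y] assms(2)
      by (auto simp: abs_mult mult_ac)
  qed
  also have "\<dots> = B * (1 - p x y1 * s y1)" by (rule infsumI[OF hs])
  also have "\<dots> \<le> B * (1 - \<theta>)" using theta_le[of x] B by (intro mult_left_mono) auto
  finally show ?thesis by (simp add: mult.commute)
qed

text \<open>Apply the contraction to the indicator of the complement of \<open>y1\<close> in an
  arbitrary row: \<open>1 - \<theta>\<close> then bounds an absolute value.\<close>

lemma theta_le_1: "\<theta> \<le> 1"
  using avX_contract[of "\<lambda>y. if y = y1 then 0 else 1" 1 undefined]
  by (smt (verit) abs_ge_zero mult_cancel_left1)

lemma avX_add:
  assumes "\<And>y. \<bar>b y\<bar> \<le> B * phi y ^ 3" "\<And>y. \<bar>b' y\<bar> \<le> B' * phi y ^ 3"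
  shows "avX (\<lambda>y. b y + c * b' y) x = avX b x + c * avX b' x"
  unfolding avX_def
  using infsum_add[OF avX_summable[of b B x, OF assms(1)]
      summable_on_cmult_right[OF avX_summable[of b' B' x, OF assms(2)], of c]]
  by (simp add: infsum_cmult_right' distrib_left distrib_right mult_ac)

lemma avY_add:
  assumes "\<And>x. \<bar>a x\<bar> \<le> A" "\<And>x. \<bar>a' x\<bar> \<le> A'"
  shows "avY (\<lambda>x. a x + c * a' x) y = avY a y + c * avY a' y"
  unfolding avY_def
  using infsum_add[OF avY_summable[of a A y, OF assms(1)]
      summable_on_cmult_right[OF avY_summable[of a' A' y, OF assms(2)], of c]]
  by (simp add: infsum_cmult_right' distrib_left distrib_right mult_ac)

lemma LX_iff: "a \<in> LX \<longleftrightarrow> (\<exists>A. \<forall>x. \<bar>a x\<bar> \<le> A)"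
  by (rule linf_space_UNIV_iff)

lemma LY_iff: "b \<in> LY \<longleftrightarrow> b y1 = 0 \<and> (\<exists>B. \<forall>y. \<bar>b y\<bar> \<le> B * phi y)"
  by (rule linf_space_omit_iff) (rule phi_pow)

lemma LXI: "(\<And>x. \<bar>a x\<bar> \<le> A) \<Longrightarrow> a \<in> LX"
  by (auto simp: LX_iff)

lemma LYI: "b y1 = 0 \<Longrightarrow> (\<And>y. \<bar>b y\<bar> \<le> B * phi y) \<Longrightarrow> b \<in> LY"
  by (auto simp: LY_iff)

lemma AY_y1: "AY a y1 = 0" and BY_y1: "BY h y1 = 0"
  by (simp_all add: AY_eq BY_eq omit_def)

lemma phi_le_cube:
  assumes "\<bar>b\<bar> \<le> B * phi y"
  shows "\<bar>b\<bar> \<le> B * phi y ^ 3"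
proof -
  have "0 \<le> B * phi y" using order_trans[OF abs_ge_zero assms] .
  then have "0 \<le> B" using phi_pow(3)[of y] by (simp add: zero_le_mult_iff)
  moreover have "phi y \<le> phi y ^ 3"
    using power_increasing[of 1 3 "phi y"] phi_ge[of y] by simp
  ultimately show ?thesis using assms by (smt (verit) mult_left_mono)
qed

lemma LX_axpy: "a \<in> LX \<Longrightarrow> a' \<in> LX \<Longrightarrow> (\<lambda>x. a x + c * a' x) \<in> LX"
proof -
  assume "a \<in> LX" "a' \<in> LX"
  then obtain A A' where "\<And>x. \<bar>a x\<bar> \<le> A" "\<And>x. \<bar>a' x\<bar> \<le> A'" by (auto simp: LX_iff)
  then have "\<bar>a x + c * a' x\<bar> \<le> A + \<bar>c\<bar> * A'" for x
    by (intro order_trans[OF abs_triangle_ineq] add_mono) (auto simp: abs_mult intro: mult_left_mono)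
  then show "(\<lambda>x. a x + c * a' x) \<in> LX" by (auto simp: LX_iff)
qed

lemma LY_axpy: "b \<in> LY \<Longrightarrow> b' \<in> LY \<Longrightarrow> (\<lambda>y. b y + c * b' y) \<in> LY"
proof -
  assume b: "b \<in> LY" "b' \<in> LY"
  then obtain B B' where B: "\<And>y. \<bar>b y\<bar> \<le> B * phi y" "\<And>y. \<bar>b' y\<bar> \<le> B' * phi y" by (auto simp: LY_iff)
  have "\<bar>b y + c * b' y\<bar> \<le> (B + \<bar>c\<bar> * B') * phi y" for y
    using abs_triangle_ineq[of "b y" "c * b' y"] B(1)[of y] mult_left_mono[OF B(2)[of y], of "\<bar>c\<bar>"]
    by (simp add: abs_mult distrib_right mult.assoc)
  with b show "(\<lambda>y. b y + c * b' y) \<in> LY" by (auto simp: LY_iff)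
qed

lemma AX_axpy:
  assumes "b \<in> LY" "b' \<in> LY"
  shows "AX (\<lambda>y. b y + c * b' y) = (\<lambda>x. AX b x + c * AX b' x)"
proof -
  obtain B B' where "\<And>y. \<bar>b y\<bar> \<le> B * phi y" "\<And>y. \<bar>b' y\<bar> \<le> B' * phi y" and "b y1 = 0" "b' y1 = 0"
    using assms by (auto simp: LY_iff)
  then show ?thesis
    using avX_add[of b B b' B' c] by (auto simp: AX_eq phi_le_cube)
qed

lemma AY_axpy:
  assumes "a \<in> LX" "a' \<in> LX"
  shows "AY (\<lambda>x. a x + c * a' x) = (\<lambda>y. AY a y + c * AY a' y)"
proof -
  obtain A A' where "\<And>x. \<bar>a x\<bar> \<le> A" "\<And>x. \<bar>a' x\<bar> \<le> A'"
    using assms by (auto simp: LX_iff)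
  then show ?thesis
    using avY_add[of a A a' A' c] by (auto simp: AY_eq omit_def)
qed

lemma AX_bound:
  assumes "\<And>y. \<bar>b y\<bar> \<le> B * phi y ^ 3" "b y1 = 0"
  shows "\<bar>AX b x\<bar> \<le> M * B * nY s"
  using avX_bound[of b B x, OF assms(1)] by (simp add: AX_eq assms)

lemma AY_bound: "(\<And>x. \<bar>a x\<bar> \<le> A) \<Longrightarrow> \<bar>AY a y\<bar> \<le> A"
  using avY_bound[of a A] order_trans[OF abs_ge_zero, of "a undefined" A] by (simp add: AY_eq omit_def)

lemma AX_AY_contract: "(\<And>x. \<bar>a x\<bar> \<le> A) \<Longrightarrow> \<bar>AX (AY a) x\<bar> \<le> (1 - \<theta>) * A"
  using avX_contract[of "AY a" A x] AY_bound[of a A] by (simp add: AX_eq AY_eq omit_def)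

section \<open>Mapping properties and inversion of \<open>IX\<close> and \<open>IY\<close>\<close>

lemma AX_in: "AX \<in> LY \<rightarrow> LX"
proof
  fix b assume "b \<in> LY"
  then obtain B where "\<And>y. \<bar>b y\<bar> \<le> B * phi y" "b y1 = 0" by (auto simp: LY_iff)
  then show "AX b \<in> LX"
    using AX_bound[of b B] phi_le_cube by (auto simp: LX_iff)
qed

lemma AY_in: "AY \<in> LX \<rightarrow> LY"
proof
  fix a assume "a \<in> LX"
  then obtain A where A: "\<And>x. \<bar>a x\<bar> \<le> A" by (auto simp: LX_iff)
  have "\<bar>AY a y\<bar> \<le> A * phi y" for y
    using AY_bound[of a A y, OF A] phi_ge[of y] order_trans[OF abs_ge_zero A]
    by (smt (verit) mult_le_cancel_left1)
  with AY_y1 show "AY a \<in> LY" by (rule LYI)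
qed

lemma BX_in: "BX \<in> lY \<rightarrow> LX"
  by (rule Pi_I, rule LXI, rule BX_bound)

lemma BY_in: "BY \<in> lX \<rightarrow> LY"
  by (rule Pi_I, rule LYI, rule BY_y1, rule BY_bound)

text \<open>Absorption: the supremum \<open>m\<close> of \<open>\<bar>a x\<bar>\<close> satisfies
  \<open>m \<le> e + (1 - \<theta>) * m\<close>, and membership in \<open>LX\<close> makes
  \<open>m\<close> finite, so the last term can be moved to the left.\<close>

lemma resolvent_bound:
  assumes a: "a \<in> LX" and e: "\<And>x. \<bar>a x - AX (AY a) x\<bar> \<le> e"
  shows "\<bar>a x\<bar> \<le> e / \<theta>"
proof -
  obtain A where A: "\<And>x. \<bar>a x\<bar> \<le> A" using a by (auto simp: LX_iff)
  then have bdd: "bdd_above (range (\<lambda>x. \<bar>a x\<bar>))" by (auto simp: bdd_above_def)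
  define m where "m = (SUP x. \<bar>a x\<bar>)"
  have m: "\<bar>a x\<bar> \<le> m" for x unfolding m_def by (rule cSUP_upper[OF _ bdd]) simp
  have "\<bar>a x\<bar> \<le> e + (1 - \<theta>) * m" for x
    using e[of x] AX_AY_contract[of a m x, OF m] by linarith
  then have "m \<le> e + (1 - \<theta>) * m" unfolding m_def by (intro cSUP_least) auto
  then have "m \<le> e / \<theta>" using theta_pos by (simp add: pos_le_divide_eq algebra_simps)
  with m show ?thesis by (rule order_trans)
qed

lemma IX_axpy:
  assumes "a \<in> LX" "a' \<in> LX"
  shows "IX (\<lambda>x. a x + c * a' x) = (\<lambda>x. IX a x + c * IX a' x)"
proof -
  have "AY a \<in> LY" "AY a' \<in> LY" using AY_in assms by auto
  then show ?thesis
    unfolding AY_axpy[OF assms] by (simp add: AX_axpy fun_eq_iff algebra_simps)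
qed

lemma IX_diff:
  assumes "a \<in> LX" "a' \<in> LX"
  shows "IX (a - a') = IX a - IX a'"
proof -
  have eq: "a - a' = (\<lambda>x. a x + (-1) * a' x)" by (simp add: fun_eq_iff)
  show ?thesis unfolding eq IX_axpy[OF assms] by (simp add: fun_eq_iff)
qed

lemma LX_diff: "a \<in> LX \<Longrightarrow> a' \<in> LX \<Longrightarrow> a - a' \<in> LX"
  using LX_axpy[of a a' "-1"] by (simp add: fun_diff_def)

lemma IX_in: "a \<in> LX \<Longrightarrow> IX a \<in> LX"
  using AX_in AY_in by (intro LX_diff) auto

lemma IX_inj: "inj_on IX LX"
proof (rule inj_onI)
  fix a a' assume a: "a \<in> LX" "a' \<in> LX" and eq: "IX a = IX a'"
  have z: "IX (a - a') = 0" unfolding IX_diff[OF a] by (simp add: eq)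
  have bnd: "\<bar>(a - a') x - AX (AY (a - a')) x\<bar> \<le> 0" for x
    using fun_cong[OF z, of x] by simp
  from resolvent_bound[OF LX_diff[OF a] bnd] show "a = a'"
    by (simp add: fun_eq_iff)
qed

text \<open>The Neumann series of \<open>AX AY\<close> at \<open>f\<close>, summed pointwise. Its
  tails are bounded uniformly in \<open>x\<close>, so the contraction applies to the tail as a
  function, and the equation for the partial sums passes to the limit.\<close>

lemma IX_surj:
  assumes f: "f \<in> LX"
  shows "\<exists>a\<in>LX. IX a = f"
proof -
  obtain A where A: "\<And>x. \<bar>f x\<bar> \<le> A" using f by (auto simp: LX_iff)
  define T where "T n = ((\<lambda>a. AX (AY a)) ^^ n) f" for n
  define q where "q = 1 - \<theta>"
  have q: "0 \<le> q" "q < 1" using theta_pos theta_le_1 by (auto simp: q_def)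
  have T0: "T 0 = f" and TS: "T (Suc n) = AX (AY (T n))" for n
    by (simp_all add: T_def)
  have T: "\<bar>T n x\<bar> \<le> q ^ n * A" for n x
  proof (induction n arbitrary: x)
    case (Suc n)
    then show ?case
      using AX_AY_contract[of "T n" "q ^ n * A" x] by (simp add: TS q_def mult_ac)
  qed (simp add: T0 A)
  have T_in: "T n \<in> LX" for n using T by (auto simp: LX_iff)
  define P where "P N = (\<lambda>x. \<Sum>n<N. T n x)" for N
  have P_in: "P N \<in> LX" for N
  proof (induction N)
    case (Suc N)
    then show ?case using LX_axpy[of "P N" "T N" 1] T_in by (simp add: P_def)
  qed (simp add: P_def LX_iff exI[of _ 0])
  have IP: "IX (P N) = f - T N" for N
  proof (induction N)
    case 0
    have "AX (AY (P 0)) x = 0" for x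
      using AX_AY_contract[of "P 0" 0 x] by (simp add: P_def)
    then show ?case by (auto simp: T0 P_def fun_eq_iff)
  next
    case (Suc N)
    have "P (Suc N) = (\<lambda>x. P N x + 1 * T N x)" by (simp add: P_def fun_eq_iff)
    then have "IX (P (Suc N)) = (\<lambda>x. IX (P N) x + 1 * IX (T N) x)"
      by (simp only: IX_axpy[OF P_in T_in])
    then show ?case
      unfolding Suc by (simp add: TS fun_eq_iff)
  qed
  have geo: "summable (\<lambda>n. q ^ n * A)"
    using q by (intro summable_mult2 summable_geometric) auto
  have sT: "summable (\<lambda>n. \<bar>T n x\<bar>)" for x
    by (rule summable_comparison_test'[OF geo, of 0]) (use T in auto)
  define a where "a x = (\<Sum>n. T n x)" for x
  have tail: "\<bar>(a - P N) x\<bar> \<le> q ^ N * (A / \<theta>)" for N x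
  proof -
    have "(a - P N) x = (\<Sum>n. T (n + N) x)"
      using suminf_minus_initial_segment[OF summable_rabs_cancel[OF sT[of x]], of N]
      by (simp add: a_def P_def)
    also have "\<bar>\<dots>\<bar> \<le> (\<Sum>n. \<bar>T (n + N) x\<bar>)"
      by (rule summable_rabs) (rule summable_ignore_initial_segment[OF sT])
    also have "\<dots> \<le> (\<Sum>n. q ^ n * (q ^ N * A))"
    proof (rule suminf_le)
      show "\<bar>T (n + N) x\<bar> \<le> q ^ n * (q ^ N * A)" for n
        using T[of "n + N" x] by (simp add: power_add mult_ac)
      show "summable (\<lambda>n. \<bar>T (n + N) x\<bar>)" by (rule summable_ignore_initial_segment[OF sT])
      show "summable (\<lambda>n. q ^ n * (q ^ N * A))"
        using q by (intro summable_mult2 summable_geometric) auto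
    qed
    also have "\<dots> = q ^ N * (A / \<theta>)"
      using suminf_mult2[of "\<lambda>n. q ^ n" "q ^ N * A"] suminf_geometric[of q] q
      by (simp add: summable_geometric q_def)
    finally show ?thesis .
  qed
  have "\<bar>a x\<bar> \<le> A / \<theta>" for x using tail[of 0 x] by (simp add: P_def)
  then have a_in: "a \<in> LX" by (auto simp: LX_iff)
  have "IX a x = f x" for x
  proof -
    have bnd: "\<bar>IX a x - f x\<bar> \<le> q ^ N * (A / \<theta>) + q ^ N * (A / \<theta>) + q ^ N * A" for N
    proof -
      have "IX a x - f x = (a - P N) x - AX (AY (a - P N)) x - T N x"
        using fun_cong[OF IX_diff[OF a_in P_in], of N x] fun_cong[OF IP[of N], of x] by simp
      moreover have "\<bar>AX (AY (a - P N)) x\<bar> \<le> q ^ N * (A / \<theta>)"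
      proof -
        have "\<bar>AX (AY (a - P N)) x\<bar> \<le> q * (q ^ N * (A / \<theta>))"
          using AX_AY_contract[of "a - P N", OF tail] by (simp add: q_def)
        also have "\<dots> \<le> 1 * (q ^ N * (A / \<theta>))"
          using q order_trans[OF abs_ge_zero tail[of N x]] by (intro mult_right_mono) auto
        finally show ?thesis by simp
      qed
      ultimately show ?thesis
        using tail[of N x] T[of N x] by (smt (verit))
    qed
    have "(\<lambda>N. q ^ N * (A / \<theta>) + q ^ N * (A / \<theta>) + q ^ N * A) \<longlonglongrightarrow> 0 * (A / \<theta>) + 0 * (A / \<theta>) + 0 * A"
      using q by (intro tendsto_intros LIMSEQ_power_zero) auto
    then have "\<bar>IX a x - f x\<bar> \<le> 0"
      using bnd by (intro LIMSEQ_le_const[of "\<lambda>N. q ^ N * (A / \<theta>) + q ^ N * (A / \<theta>) + q ^ N * A"]) auto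
    then show ?thesis by simp
  qed
  with a_in show ?thesis by blast
qed

lemma IX_bij: "bij_betw IX LX LX"
  unfolding bij_betw_def
proof
  show "IX ` LX = LX"
  proof
    show "LX \<subseteq> IX ` LX" using IX_surj by blast
  qed (use IX_in in blast)
qed (rule IX_inj)

text \<open>The identity \<open>(Id - AY AX)^-1 = Id + AY (Id - AX AY)^-1 AX\<close>, which moves
  the inversion from the \<open>phi\<close>-weighted space to the sup-norm space, where the
  contraction is available.\<close>

lemma IY_eq:
  assumes b: "b \<in> LY" and v: "v \<in> LX" "IX v = AX b"
  shows "IY (\<lambda>y. b y + AY v y) = b"
proof -
  have b': "AY v \<in> LY" "AX b \<in> LX" "AX (AY v) \<in> LX"
    using AX_in AY_in b v by auto
  have "AX (\<lambda>y. b y + AY v y) = (\<lambda>x. AX b x + AX (AY v) x)"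
    using AX_axpy[OF b b'(1), of 1] by simp
  also have "\<dots> = v"
    using v(2) by (simp add: fun_eq_iff algebra_simps)
  finally have eq: "AX (\<lambda>y. b y + AY v y) = v" .
  show ?thesis by (simp add: eq) (simp add: fun_eq_iff)
qed

text \<open>Both halves reduce to \<open>IX\<close>: applying \<open>AX\<close> to
  \<open>IY b = IY b'\<close> gives \<open>IX (AX b) = IX (AX b')\<close>, and surjectivity is
  \<open>IY_eq\<close>.\<close>

lemma IY_bij: "bij_betw IY LY LY"
  unfolding bij_betw_def
proof
  show "inj_on IY LY"
  proof (rule inj_onI)
    fix b b' assume b: "b \<in> LY" "b' \<in> LY" and eq: "IY b = IY b'"
    have ab: "AX b \<in> LX" "AX b' \<in> LX" using AX_in b by auto
    have in': "AY (AX b) \<in> LY" "AY (AX b') \<in> LY" using AY_in ab by auto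
    have "(\<lambda>y. b y + (-1) * b' y) = (\<lambda>y. AY (AX b) y + (-1) * AY (AX b') y)"
      using eq by (auto simp: fun_eq_iff algebra_simps)
    then have "AX (\<lambda>y. b y + (-1) * b' y) = AX (\<lambda>y. AY (AX b) y + (-1) * AY (AX b') y)"
      by simp
    then have "(\<lambda>x. AX b x + (-1) * AX b' x) = (\<lambda>x. AX (AY (AX b)) x + (-1) * AX (AY (AX b')) x)"
      unfolding AX_axpy[OF b] AX_axpy[OF in'] .
    then have "IX (AX b) = IX (AX b')" by (auto simp: fun_eq_iff algebra_simps)
    then have "AX b = AX b'" using IX_inj ab by (auto dest: inj_onD)
    with eq show "b = b'" by (simp add: fun_eq_iff)
  qed
  show "IY ` LY = LY"
  proof
    show "IY ` LY \<subseteq> LY"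
    proof (rule image_subsetI)
      fix b assume b: "b \<in> LY"
      then have "AY (AX b) \<in> LY" using AX_in AY_in by auto
      from LY_axpy[OF b this, of "-1"] show "IY b \<in> LY" by (simp add: fun_diff_def)
    qed
    show "LY \<subseteq> IY ` LY"
    proof
      fix b assume b: "b \<in> LY"
      then obtain v where v: "v \<in> LX" "IX v = AX b" using IX_surj AX_in by blast
      have "(\<lambda>y. b y + AY v y) \<in> LY" using LY_axpy[OF b, of "AY v" 1] AY_in v by auto
      then show "b \<in> IY ` LY" by (rule rev_image_eqI) (rule IY_eq[OF b v, symmetric])
    qed
  qed
qed

end

text \<open>For weights at least \<open>1\<close>,
  \<open>CX x + CY y \<le> 2 * (CX x * CY y)\<close>, and under a product weight the norm of a
  tensor factorizes; this is the origin of the factor \<open>2\<close>. The function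
  \<open>w\<close> moves from the majorant into the weight of the second factor.\<close>

lemma l1_tensor_list_bound:
  fixes CX :: "'x \<Rightarrow> real" and CY w :: "'y \<Rightarrow> real"
    and ts :: "(real \<times> ('x \<Rightarrow> real) \<times> ('y \<Rightarrow> real)) list"
  assumes CX: "\<And>x. 1 \<le> CX x" and CY: "\<And>y. 1 \<le> CY y" and w: "\<And>y. 0 \<le> w y"
    and ts: "\<And>c f g. (c, f, g) \<in> set ts \<Longrightarrow> 0 \<le> c \<and> f \<in> l1_space CX UNIV \<and> g \<in> l1_space (\<lambda>y. CY y * w y) UNIV"
    and F: "\<And>x y. \<bar>F (x, y)\<bar> \<le> (\<Sum>(c, f, g)\<leftarrow>ts. c * \<bar>f x\<bar> * \<bar>g y\<bar>) * w y"
  shows "F \<in> l1_space (CX \<oplus>\<^sub>t CY) UNIV"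
    "l1_norm (CX \<oplus>\<^sub>t CY) UNIV F \<le>
      (\<Sum>(c, f, g)\<leftarrow>ts. 2 * c * l1_norm CX UNIV f * l1_norm (\<lambda>y. CY y * w y) UNIV g)"
proof -
  let ?G = "\<lambda>(x, y). \<Sum>(c, f, g)\<leftarrow>ts. 2 * c * (CX x * \<bar>f x\<bar>) * (CY y * w y * \<bar>g y\<bar>)"
  have sum: "(?G has_sum (\<Sum>(c, f, g)\<leftarrow>ts. 2 * c * l1_norm CX UNIV f *
      l1_norm (\<lambda>y. CY y * w y) UNIV g)) UNIV"
    using ts
  proof (induction ts)
    case (Cons a ts)
    obtain c f g where a: "a = (c, f, g)" by (cases a) auto
    have "((\<lambda>(x, y). (2 * c * (CX x * \<bar>f x\<bar>)) * (CY y * w y * \<bar>g y\<bar>)) has_sum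
        ((\<Sum>\<^sub>\<infinity>x. 2 * c * (CX x * \<bar>f x\<bar>)) * (\<Sum>\<^sub>\<infinity>y. CY y * w y * \<bar>g y\<bar>))) UNIV"
      using Cons.prems[of c f g] l1_spaceD[of f CX] l1_spaceD[of g "\<lambda>y. CY y * w y"]
      by (intro has_sum_tensor summable_on_cmult_right) (auto simp: a)
    then have "((\<lambda>(x, y). (2 * c * (CX x * \<bar>f x\<bar>)) * (CY y * w y * \<bar>g y\<bar>)) has_sum
        (2 * c * l1_norm CX UNIV f * l1_norm (\<lambda>y. CY y * w y) UNIV g)) UNIV"
      by (simp add: l1_norm_def infsum_cmult_right' mult.assoc)
    moreover have "((\<lambda>(x, y). \<Sum>(c, f, g)\<leftarrow>ts. 2 * c * (CX x * \<bar>f x\<bar>) * (CY y * w y * \<bar>g y\<bar>)) has_sum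
        (\<Sum>(c, f, g)\<leftarrow>ts. 2 * c * l1_norm CX UNIV f * l1_norm (\<lambda>y. CY y * w y) UNIV g)) UNIV"
      using Cons.prems by (intro Cons.IH) auto
    ultimately show ?case
      using has_sum_add by (fastforce simp: a case_prod_unfold)
  qed (simp add: case_prod_unfold)
  have nonneg: "0 \<le> CX x" "0 \<le> CY y" for x y
    using CX[of x] CY[of y] by linarith+
  have le: "(CX \<oplus>\<^sub>t CY) z * \<bar>F z\<bar> \<le> ?G z" for z
  proof -
    obtain x y where z: "z = (x, y)" by (cases z)
    have sum2: "CX x + CY y \<le> 2 * (CX x * CY y)"
      using mult_left_mono[OF CY[of y], of "CX x"] mult_right_mono[OF CX[of x], of "CY y"] nonneg(1)[of x] nonneg(2)[of y]
      by simp
    have S: "0 \<le> (\<Sum>(c, f, g)\<leftarrow>ts. c * \<bar>f x\<bar> * \<bar>g y\<bar>)"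
      by (intro sum_list_nonneg) (use ts in auto)
    have "(CX x + CY y) * \<bar>F (x, y)\<bar> \<le>
        (2 * (CX x * CY y)) * ((\<Sum>(c, f, g)\<leftarrow>ts. c * \<bar>f x\<bar> * \<bar>g y\<bar>) * w y)"
      using sum2 F[of x y] nonneg(1)[of x] nonneg(2)[of y] w[of y] S by (intro mult_mono) auto
    also have "\<dots> = ?G (x, y)"
      by (simp add: sum_list_const_mult[symmetric] sum_list_mult_const[symmetric] case_prod_unfold mult_ac)
    finally show ?thesis by (simp add: z dsum_def)
  qed
  have summG: "?G summable_on UNIV" using sum by (auto simp: summable_on_def)
  have summF: "(\<lambda>z. (CX \<oplus>\<^sub>t CY) z * \<bar>F z\<bar>) summable_on UNIV"
  proof (rule summable_on_abs_le[OF summG])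
    fix z
    have "0 \<le> (CX \<oplus>\<^sub>t CY) z" using nonneg by (auto simp: dsum_def case_prod_unfold)
    then show "\<bar>(CX \<oplus>\<^sub>t CY) z * \<bar>F z\<bar>\<bar> \<le> ?G z"
      using le[of z] by simp
  qed
  then show "F \<in> l1_space (CX \<oplus>\<^sub>t CY) UNIV" by (simp add: l1_space_def)
  show "l1_norm (CX \<oplus>\<^sub>t CY) UNIV F \<le>
      (\<Sum>(c, f, g)\<leftarrow>ts. 2 * c * l1_norm CX UNIV f * l1_norm (\<lambda>y. CY y * w y) UNIV g)"
    unfolding l1_norm_def[of "CX \<oplus>\<^sub>t CY"] infsumI[OF sum, symmetric]
    by (rule infsum_mono[OF summF summG le])
qed

section \<open>Solution of the linearized system and the candidate derivative\<close>

context gibbs_density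
begin

abbreviation "V \<equiv> l1_space (CX \<oplus>\<^sub>t CY) (UNIV :: ('x \<times> 'y) set)"
abbreviation "nV \<equiv> l1_norm (CX \<oplus>\<^sub>t CY) (UNIV :: ('x \<times> 'y) set)"

lemma V_bound:
  assumes "\<And>c f g. (c, f, g) \<in> set ts \<Longrightarrow> 0 \<le> c \<and> f \<in> lX \<and> g \<in> lY"
    and "\<And>x y. \<bar>F (x, y)\<bar> \<le> (\<Sum>(c, f, g)\<leftarrow>ts. c * \<bar>f x\<bar> * \<bar>g y\<bar>) * phi y ^ 4"
  shows "F \<in> V" "nV F \<le> (\<Sum>(c, f, g)\<leftarrow>ts. 2 * c * nX f * nY g)"
  using l1_tensor_list_bound[of CX CY "\<lambda>y. phi y ^ 4" ts F] assms CX_ge CY_ge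
    phi_pow(2)[THEN less_imp_le] unfolding Phi4_def by auto

text \<open>Elimination of the second unknown from \<open>a + AX b = BX hY\<close>,
  \<open>b + AY a = BY hX\<close>, the linearized Schroedinger system.\<close>

definition solA where "solA hX hY = inv_into LX IX (BX hY - AX (BY hX))"
definition solB where "solB hX hY = BY hX - AY (solA hX hY)"

lemma solution:
  assumes hX: "hX \<in> lX" and hY: "hY \<in> lY"
  shows "solA hX hY \<in> LX" "solB hX hY \<in> LY"
    "solA hX hY x + AX (solB hX hY) x = BX hY x" "solB hX hY y + AY (solA hX hY) y = BY hX y"
    "\<bar>solA hX hY x\<bar> \<le> (M * nY hY + M * (M * nX hX) * nY s) / \<theta>"
    "\<bar>solB hX hY y\<bar> \<le> (M * nX hX + (M * nY hY + M * (M * nX hX) * nY s) / \<theta>) * phi y"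
proof -
  have in': "BX hY \<in> LX" "BY hX \<in> LY" "AX (BY hX) \<in> LX"
    using BX_in BY_in AX_in hX hY by auto
  have f: "BX hY - AX (BY hX) \<in> LX" by (intro LX_diff in')
  then have "BX hY - AX (BY hX) \<in> IX ` LX"
    using IX_bij by (simp add: bij_betw_def)
  then have a: "solA hX hY \<in> LX" and IA: "IX (solA hX hY) = BX hY - AX (BY hX)"
    unfolding solA_def by (rule inv_into_into, rule f_inv_into_f)
  show "solA hX hY \<in> LX" by (rule a)
  have AYa: "AY (solA hX hY) \<in> LY" using AY_in a by auto
  have B: "solB hX hY = (\<lambda>y. BY hX y + (-1) * AY (solA hX hY) y)"
    by (simp add: solB_def fun_eq_iff)
  show "solB hX hY \<in> LY" unfolding B by (rule LY_axpy[OF in'(2) AYa])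
  show "solB hX hY y + AY (solA hX hY) y = BY hX y" by (simp add: B)
  show "solA hX hY x + AX (solB hX hY) x = BX hY x"
    unfolding B AX_axpy[OF in'(2) AYa] using fun_cong[OF IA, of x] by simp
  have bnd: "\<bar>solA hX hY x\<bar> \<le> (M * nY hY + M * (M * nX hX) * nY s) / \<theta>" for x
  proof (rule resolvent_bound[OF a])
    fix x
    have "solA hX hY x - AX (AY (solA hX hY)) x = BX hY x - AX (BY hX) x"
      using fun_cong[OF IA, of x] by simp
    moreover have "\<bar>AX (BY hX) x\<bar> \<le> M * (M * nX hX) * nY s"
      by (rule AX_bound[OF phi_le_cube[OF BY_bound[OF hX]] BY_y1])
    ultimately show "\<bar>solA hX hY x - AX (AY (solA hX hY)) x\<bar> \<le> M * nY hY + M * (M * nX hX) * nY s"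
      using BX_bound[OF hY, of x] by linarith
  qed
  then show "\<bar>solA hX hY x\<bar> \<le> (M * nY hY + M * (M * nX hX) * nY s) / \<theta>" .
  let ?A = "(M * nY hY + M * (M * nX hX) * nY s) / \<theta>"
  have "\<bar>AY (solA hX hY) y\<bar> \<le> ?A" by (rule AY_bound[OF bnd])
  moreover from this have "?A \<le> ?A * phi y"
    using mult_left_mono[OF phi_ge[of y], of ?A] by simp
  ultimately show "\<bar>solB hX hY y\<bar> \<le> (M * nX hX + ?A) * phi y"
    using BY_bound[OF hX, of y] by (simp add: B distrib_right)
qed

lemma solution_unique:
  assumes hX: "hX \<in> lX" and hY: "hY \<in> lY" and a: "a \<in> LX" and b: "b \<in> LY"
    and 1: "\<And>x. a x + AX b x = BX hY x" and 2: "\<And>y. b y + AY a y = BY hX y"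
  shows "a = solA hX hY" "b = solB hX hY"
proof -
  have AYa: "AY a \<in> LY" and BYh: "BY hX \<in> LY" using AY_in BY_in a hX by auto
  have b_eq: "b = (\<lambda>y. BY hX y + (-1) * AY a y)"
    using 2 by (simp add: fun_eq_iff algebra_simps)
  have AXb: "AX b = (\<lambda>x. AX (BY hX) x + (-1) * AX (AY a) x)"
    unfolding b_eq by (rule AX_axpy[OF BYh AYa])
  have "IX a = BX hY - AX (BY hX)"
  proof
    show "IX a x = (BX hY - AX (BY hX)) x" for x
      using 1[of x] fun_cong[OF AXb, of x] by simp
  qed
  then show a_eq: "a = solA hX hY"
    unfolding solA_def using inv_into_f_f[OF IX_inj a] by simp
  show "b = solB hX hY"
    unfolding solB_def a_eq[symmetric] by (subst b_eq) (simp add: fun_eq_iff)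
qed

text \<open>The outer block matrix inverts the matrix with rows \<open>Id, AX\<close> and
  \<open>AY, Id\<close>. It suffices that its output solves the system, since the solution is
  unique; \<open>IY_eq\<close> expresses the lower right block through \<open>IX\<close>.\<close>

lemma block_solution:
  assumes hX: "hX \<in> lX" and hY: "hY \<in> lY"
  shows "block_op (inv_into LX IX) (\<lambda>v. - inv_into LX IX (AX v))
      (\<lambda>u. - AY (inv_into LX IX u)) (inv_into LY IY)
      (block_op (\<lambda>_. 0) BX BY (\<lambda>_. 0) (hX, hY)) = (solA hX hY, solB hX hY)"
proof -
  have in': "BX hY \<in> LX" "BY hX \<in> LY" "AX (BY hX) \<in> LX"
    using BX_in BY_in AX_in hX hY by auto
  define u where "u = inv_into LX IX (BX hY)"
  define v where "v = inv_into LX IX (AX (BY hX))"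
  have img: "IX ` LX = LX" using IX_bij by (simp add: bij_betw_def)
  have u: "u \<in> LX" "IX u = BX hY" and v: "v \<in> LX" "IX v = AX (BY hX)"
    unfolding u_def v_def using in' by (auto simp: img intro!: inv_into_into f_inv_into_f[of _ IX LX])
  have AYv: "AY v \<in> LY" "AY u \<in> LY" using AY_in u v by auto
  have "(\<lambda>y. BY hX y + AY v y) \<in> LY" using LY_axpy[OF in'(2) AYv(1), of 1] by simp
  then have w: "inv_into LY IY (BY hX) = (\<lambda>y. BY hX y + AY v y)"
    using IY_bij IY_eq[OF in'(2) v] inv_into_f_f[of IY LY "\<lambda>y. BY hX y + AY v y"]
    by (simp add: bij_betw_def)
  define a where "a = (\<lambda>x. u x + (-1) * v x)"
  define b where "b = (\<lambda>y. (BY hX y + AY v y) + (-1) * AY u y)"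
  have a: "a \<in> LX" unfolding a_def by (rule LX_axpy[OF u(1) v(1)])
  have BYv: "(\<lambda>y. BY hX y + AY v y) \<in> LY" using LY_axpy[OF in'(2) AYv(1), of 1] by simp
  have b: "b \<in> LY" unfolding b_def by (rule LY_axpy[OF BYv AYv(2)])
  have AYa: "AY a = (\<lambda>y. AY u y + (-1) * AY v y)"
    unfolding a_def by (rule AY_axpy[OF u(1) v(1)])
  have AXb: "AX b = (\<lambda>x. (AX (BY hX) x + AX (AY v) x) + (-1) * AX (AY u) x)"
    unfolding b_def AX_axpy[OF BYv AYv(2)] using AX_axpy[OF in'(2) AYv(1), of 1] by simp
  have 1: "a x + AX b x = BX hY x" for x
    using fun_cong[OF u(2), of x] fun_cong[OF v(2), of x] by (simp add: AXb a_def)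
  have 2: "b y + AY a y = BY hX y" for y
    by (simp add: AYa b_def)
  note sol = solution_unique[OF hX hY a b 1 2]
  show ?thesis
    unfolding block_op_def sol[symmetric]
    by (simp add: w u_def[symmetric] v_def[symmetric])
      (simp add: a_def b_def fun_eq_iff)
qed

text \<open>First variation of the plan when the marginals move along \<open>hX\<close>,
  \<open>hY\<close> and the logarithms of the scalings along \<open>- a\<close>, \<open>- b\<close>.
  The latter stay free because uniqueness has to range over all candidates.\<close>

definition tangent where
  "tangent a b hX hY = (\<lambda>(x, y). p x y * (r x * hY y + hX x * s y) - plan (x, y) * (a x + b y))"

text \<open>The row sums differ from \<open>hX\<close> by \<open>r x\<close> times the residual of
  the first linearized equation. Since \<open>r x > 0\<close>, correct first marginals and that
  equation are equivalent.\<close>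

lemma tangent_row:
  assumes hY: "hY \<in> lY" and b: "b \<in> LY"
  shows "((\<lambda>y. tangent a b hX hY (x, y)) has_sum r x * (BX hY x - a x - AX b x) + hX x) UNIV"
proof -
  obtain B where B: "\<And>y. \<bar>b y\<bar> \<le> B * phi y" and b1: "b y1 = 0" using b by (auto simp: LY_iff)
  have 1: "((\<lambda>y. p x y * hY y) has_sum BX hY x) UNIV"
    using lY_pairing(1)[OF hY, of "\<lambda>_. 1" 1 x] phi_pow(1) by (simp add: BX_eq)
  have 2: "((\<lambda>y. p x y * b y * s y) has_sum AX b x) UNIV"
    using avX_summable[of b B x, OF phi_le_cube[OF B]] by (simp add: AX_eq b1 avX_def)
  have "((\<lambda>y. r x * (p x y * hY y) + hX x * (p x y * s y) -
      (r x * a x * (p x y * s y) + r x * (p x y * b y * s y))) has_sum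
      (r x * BX hY x + hX x * 1 - (r x * a x * 1 + r x * AX b x))) UNIV"
    by (intro has_sum_add has_sum_diff has_sum_cmult_right 1 2 row)
  then show ?thesis
    by (simp add: tangent_def plan_def algebra_simps)
qed

lemma tangent_col:
  assumes hX: "hX \<in> lX" and a: "a \<in> LX" and y: "y \<noteq> y1"
  shows "((\<lambda>x. tangent a b hX hY (x, y)) has_sum s y * (BY hX y - b y - AY a y) + hY y) UNIV"
proof -
  obtain A where A: "\<And>x. \<bar>a x\<bar> \<le> A" using a by (auto simp: LX_iff)
  have 1: "((\<lambda>x. p x y * hX x) has_sum BY hX y) UNIV"
    using lX_pairing(1)[OF hX, of "\<lambda>_. 1" 1 y] y by (simp add: BY_eq omit_def)
  have 2: "((\<lambda>x. p x y * a x * r x) has_sum AY a y) UNIV"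
    using avY_summable[of a A y, OF A] y by (simp add: AY_eq avY_def omit_def)
  have "((\<lambda>x. hY y * (p x y * r x) + s y * (p x y * hX x) -
      (s y * (p x y * a x * r x) + s y * b y * (p x y * r x))) has_sum
      (hY y * 1 + s y * BY hX y - (s y * AY a y + s y * b y * 1))) UNIV"
    by (intro has_sum_add has_sum_diff has_sum_cmult_right 1 2 col)
  then show ?thesis
    by (simp add: tangent_def plan_def algebra_simps)
qed

lemma tangent_bound:
  assumes hX: "hX \<in> lX" and hY: "hY \<in> lY"
    and a: "\<And>x. \<bar>a x\<bar> \<le> A" and b: "\<And>y. \<bar>b y\<bar> \<le> B * phi y" and AB: "0 \<le> A" "0 \<le> B"
  shows "tangent a b hX hY \<in> V"
    "nV (tangent a b hX hY) \<le> 2 * M * (nX r * nY hY + nX hX * nY s + (A + B) * nX r * nY s)"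
proof -
  let ?ts = "[(M, r, hY), (M, hX, s), (M * (A + B), r, s)]"
  have le: "\<bar>tangent a b hX hY (x, y)\<bar> \<le> (\<Sum>(c, f, g)\<leftarrow>?ts. c * \<bar>f x\<bar> * \<bar>g y\<bar>) * phi y ^ 4" for x y
  proof -
    have "\<bar>a x + b y\<bar> \<le> (A + B) * phi y"
      using a[of x] b[of y] mult_left_mono[OF phi_ge[of y] AB(1)] by (simp add: distrib_right)
    then have "\<bar>r x * hY y + hX x * s y - r x * s y * (a x + b y)\<bar> \<le>
        r x * \<bar>hY y\<bar> + \<bar>hX x\<bar> * s y + r x * s y * ((A + B) * phi y)"
      using r_pos[of x] s_pos[of y]
      by (intro order_trans[OF abs_triangle_ineq4] add_mono order_trans[OF abs_triangle_ineq])
        (auto simp: abs_mult intro!: mult_left_mono)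
    also have "\<dots> \<le> (r x * \<bar>hY y\<bar> + \<bar>hX x\<bar> * s y + r x * s y * (A + B)) * phi y ^ 3"
    proof -
      have "phi y \<le> phi y ^ 3"
        using power_increasing[of 1 3 "phi y"] phi_ge[of y] by simp
      then have "r x * s y * (A + B) * phi y \<le> r x * s y * (A + B) * phi y ^ 3"
        using r_pos[of x] s_pos[of y] AB by (intro mult_left_mono) auto
      moreover have "r x * \<bar>hY y\<bar> + \<bar>hX x\<bar> * s y \<le> (r x * \<bar>hY y\<bar> + \<bar>hX x\<bar> * s y) * phi y ^ 3"
        using mult_left_mono[OF phi_pow(1)[of y 3], of "r x * \<bar>hY y\<bar> + \<bar>hX x\<bar> * s y"] r_pos[of x] s_pos[of y]
        by simp
      ultimately show ?thesis by (simp add: algebra_simps)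
    qed
    finally have 1: "\<bar>r x * hY y + hX x * s y - r x * s y * (a x + b y)\<bar> \<le>
        (r x * \<bar>hY y\<bar> + \<bar>hX x\<bar> * s y + r x * s y * (A + B)) * phi y ^ 3" .
    have "tangent a b hX hY (x, y) = p x y * (r x * hY y + hX x * s y - r x * s y * (a x + b y))"
      by (simp add: tangent_def plan_def algebra_simps)
    also have "\<bar>\<dots>\<bar> \<le> (M * phi y) * ((r x * \<bar>hY y\<bar> + \<bar>hX x\<bar> * s y + r x * s y * (A + B)) * phi y ^ 3)"
      unfolding abs_mult[of "p x y"] using p_pos[of x y] p_le[of x y]
      by (intro mult_mono 1) auto
    also have "\<dots> = (\<Sum>(c, f, g)\<leftarrow>?ts. c * \<bar>f x\<bar> * \<bar>g y\<bar>) * phi y ^ 4"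
      using r_pos[of x] s_pos[of y] by (simp add: power_numeral_reduce algebra_simps)
    finally show ?thesis .
  qed
  have ts: "0 \<le> c \<and> f \<in> lX \<and> g \<in> lY" if "(c, f, g) \<in> set ?ts" for c f g
    using that M_ge AB r_lX s_lY hX hY by auto
  show "tangent a b hX hY \<in> V" by (rule V_bound(1)[OF ts le])
  show "nV (tangent a b hX hY) \<le> 2 * M * (nX r * nY hY + nX hX * nY s + (A + B) * nX r * nY s)"
    using V_bound(2)[OF ts le] by (simp add: algebra_simps)
qed

definition deriv_plan where
  "deriv_plan hX hY = tangent (solA hX hY) (solB hX hY) hX hY"

lemma deriv_plan_bound:
  "\<exists>K. \<forall>hX\<in>lX. \<forall>hY\<in>lY. deriv_plan hX hY \<in> V \<and> nV (deriv_plan hX hY) \<le> K * (nX hX + nY hY)"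
proof -
  define S where "S = nY s"
  define R where "R = nX r"
  define L where "L = (M + M * M * S) / \<theta>"
  have nn: "0 \<le> S" "0 \<le> R" by (simp_all add: S_def R_def nX_nonneg nY_nonneg)
  have L: "0 \<le> L" using nn M_ge theta_pos by (simp add: L_def)
  define K where "K = 2 * M * (R + S + (L + (M + L)) * R * S)"
  have "deriv_plan hX hY \<in> V \<and> nV (deriv_plan hX hY) \<le> K * (nX hX + nY hY)"
    if h: "hX \<in> lX" "hY \<in> lY" for hX hY
  proof -
    define n where "n = nX hX + nY hY"
    have n: "0 \<le> n" "nX hX \<le> n" "nY hY \<le> n"
      using nX_nonneg[of hX] nY_nonneg[of hY] by (auto simp: n_def)
    have "M * nY hY + M * (M * nX hX) * S \<le> M * n + M * (M * n) * S"
      using n M_ge nn by (intro add_mono mult_left_mono mult_right_mono) auto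
    then have A: "(M * nY hY + M * (M * nX hX) * S) / \<theta> \<le> L * n"
      using theta_pos by (simp add: L_def divide_right_mono algebra_simps)
    have a: "\<bar>solA hX hY x\<bar> \<le> L * n" for x
      using solution(5)[OF h, of x] A by (simp add: S_def)
    have b: "\<bar>solB hX hY y\<bar> \<le> ((M + L) * n) * phi y" for y
    proof -
      have "M * nX hX + (M * nY hY + M * (M * nX hX) * S) / \<theta> \<le> (M + L) * n"
      proof -
        have "M * nX hX \<le> M * n" using n(2) M_ge by (intro mult_left_mono) auto
        with A show ?thesis unfolding distrib_right by (rule add_mono[rotated])
      qed
      from solution(6)[OF h, of y] mult_right_mono[OF this, of "phi y"] show ?thesis
        unfolding S_def[symmetric] using phi_pow(3)[of y] by (simp add: order_trans)
    qed
    have nonneg: "0 \<le> L * n" "0 \<le> (M + L) * n" using L n M_ge by auto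
    note T = tangent_bound[of hX hY "solA hX hY" "L * n" "solB hX hY" "(M + L) * n", OF h a b nonneg]
    have "2 * M * (R * nY hY + nX hX * S + (L * n + (M + L) * n) * R * S) \<le>
        2 * M * (R * n + n * S + (L * n + (M + L) * n) * R * S)"
      using n nn M_ge by (intro mult_left_mono add_mono mult_right_mono) auto
    also have "\<dots> = K * n" by (simp add: K_def algebra_simps)
    finally show ?thesis using T by (simp add: deriv_plan_def R_def S_def n_def)
  qed
  then show ?thesis by blast
qed

lemma fill_mass_0_omit:
  assumes "hY summable_on UNIV" "infsum hY UNIV = 0"
  shows "fill_mass 0 y1 (omit y1 hY) = hY"
proof -
  have summ: "hY summable_on - {y1}" by (rule summable_on_UNIV_subset[OF assms(1)])
  have "infsum hY UNIV = infsum hY (insert y1 (- {y1}))" by (simp add: insert_UNIV Compl_insert)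
  also have "\<dots> = hY y1 + infsum hY (- {y1})" by (rule infsum_insert) (use summ in auto)
  finally have "hY y1 = - infsum hY (- {y1})" using assms(2) by simp
  moreover have "infsum (omit y1 hY) (- {y1}) = infsum hY (- {y1})"
    by (rule infsum_cong) (auto simp: omit_def)
  ultimately have "fill_mass 0 y1 (omit y1 hY) = (omit y1 hY)(y1 := hY y1)"
    unfolding fill_mass_def by simp
  then show ?thesis by (simp add: omit_def)
qed

text \<open>The first component forces \<open>H\<close> to be minus a tangent; the marginal
  equations for this tangent are then the linearized system, which has a unique solution. The factor
  \<open>lam\<close> appears because \<open>D_vars\<close> works with potentials, that is,
  \<open>lam\<close> times the logarithms of the scalings.\<close>

lemma D_vars_iff:
  assumes hX: "hX \<in> lX" and hY: "hY \<in> lY" "infsum hY UNIV = 0"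
    and a: "a \<in> LX" and b: "b \<in> LY" and lam: "lam > 0"
  shows "D_vars lam y1 plan (H, a, b) = D_data y1 plan r s (hX, omit y1 hY) \<longleftrightarrow>
    H = - deriv_plan hX hY \<and> a = lam *\<^sub>R solA hX hY \<and> b = lam *\<^sub>R solB hX hY"
proof -
  define a' where "a' = (1 / lam) *\<^sub>R a"
  define b' where "b' = (1 / lam) *\<^sub>R b"
  have in': "a' \<in> LX" "b' \<in> LY"
    using LX_axpy[OF LXI[of "\<lambda>_. 0" 0] a, of "1 / lam"] LY_axpy[OF LYI[of "\<lambda>_. 0" 0] b, of "1 / lam"]
    by (simp_all add: a'_def b'_def scaleR_fun_def)
  have ab: "a = lam *\<^sub>R a'" "b = lam *\<^sub>R b'"
    using lam by (auto simp: a'_def b'_def scaleR_fun_def)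
  have b1: "b' y1 = 0" using in' by (auto simp: LY_iff)
  have fill: "fill_mass 0 y1 (omit y1 hY) = hY"
    by (rule fill_mass_0_omit[OF l1_space_summable(1)[OF hY(1) Phi4_ge] hY(2)])
  have star: "A_star_T y1 (a, b) (x, y) = lam * (a' x + b' y)" for x y
    by (simp add: A_star_T_def ab scaleR_fun_def b1 distrib_left)
  have plan_rs: "plan (x, y) / (r \<otimes>\<^sub>t s) (x, y) = p x y" for x y
    using r_pos[of x] s_pos[of y] by (simp add: plan_def tensor_def)
  have first: "H - (1 / lam) *\<^sub>R (plan * A_star_T y1 (a, b)) =
      - (\<lambda>z. plan z / (r \<otimes>\<^sub>t s) z) * (r \<otimes>\<^sub>t hY + hX \<otimes>\<^sub>t s) \<longleftrightarrow> H = - tangent a' b' hX hY"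
  proof -
    have "((1 / lam) *\<^sub>R (plan * A_star_T y1 (a, b))) (x, y) = plan (x, y) * (a' x + b' y)" for x y
      using lam by (simp add: scaleR_fun_def star)
    moreover have "(- (\<lambda>z. plan z / (r \<otimes>\<^sub>t s) z) * (r \<otimes>\<^sub>t hY + hX \<otimes>\<^sub>t s)) (x, y) =
        - (p x y * (r x * hY y + hX x * s y))" for x y
      by (simp add: plan_rs) (simp add: tensor_def)
    ultimately have "H - (1 / lam) *\<^sub>R (plan * A_star_T y1 (a, b)) =
        - (\<lambda>z. plan z / (r \<otimes>\<^sub>t s) z) * (r \<otimes>\<^sub>t hY + hX \<otimes>\<^sub>t s) \<longleftrightarrow>
      (\<forall>x y. H (x, y) - plan (x, y) * (a' x + b' y) = - (p x y * (r x * hY y + hX x * s y)))"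
      unfolding fun_eq_iff split_paired_All minus_apply by simp
    also have "\<dots> \<longleftrightarrow> (\<forall>x y. H (x, y) = (- tangent a' b' hX hY) (x, y))"
      by (intro iff_allI) (auto simp: tangent_def)
    finally show ?thesis by (simp add: fun_eq_iff)
  qed
  have star_H: "A_star y1 (- tangent a' b' hX hY) = (- hX, - omit y1 hY) \<longleftrightarrow>
      (\<forall>x. a' x + AX b' x = BX hY x) \<and> (\<forall>y. b' y + AY a' y = BY hX y)"
  proof -
    have row: "(\<Sum>\<^sub>\<infinity>y. (- tangent a' b' hX hY) (x, y)) = - (r x * (BX hY x - a' x - AX b' x) + hX x)" for x
      using infsumI[OF tangent_row[OF hY(1) in'(2), of a' hX x]] by (simp add: infsum_uminus)
    have col: "(\<Sum>\<^sub>\<infinity>x. (- tangent a' b' hX hY) (x, y)) = - (s y * (BY hX y - b' y - AY a' y) + hY y)"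
      if "y \<noteq> y1" for y
      using infsumI[OF tangent_col[OF hX in'(1) that, of b' hY]] by (simp add: infsum_uminus)
    have "(\<lambda>x. \<Sum>\<^sub>\<infinity>y. (- tangent a' b' hX hY) (x, y)) = - hX \<longleftrightarrow> (\<forall>x. a' x + AX b' x = BX hY x)"
    proof -
      have "- (r x * (BX hY x - a' x - AX b' x) + hX x) = (- hX) x \<longleftrightarrow> a' x + AX b' x = BX hY x" for x
      proof -
        have "- (r x * (BX hY x - a' x - AX b' x) + hX x) = (- hX) x \<longleftrightarrow>
            r x * (BX hY x - a' x - AX b' x) = 0" by auto
        also have "\<dots> \<longleftrightarrow> a' x + AX b' x = BX hY x" using r_pos[of x] by auto
        finally show ?thesis .
      qed
      then show ?thesis unfolding row fun_eq_iff by blast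
    qed
    moreover have "omit y1 (\<lambda>y. \<Sum>\<^sub>\<infinity>x. (- tangent a' b' hX hY) (x, y)) = - omit y1 hY \<longleftrightarrow>
        (\<forall>y. b' y + AY a' y = BY hX y)"
    proof -
      have "omit y1 (\<lambda>y. \<Sum>\<^sub>\<infinity>x. (- tangent a' b' hX hY) (x, y)) = - omit y1 hY \<longleftrightarrow>
        (\<forall>y. y \<noteq> y1 \<longrightarrow> (\<Sum>\<^sub>\<infinity>x. (- tangent a' b' hX hY) (x, y)) = - hY y)"
        by (auto simp: omit_def fun_eq_iff)
      also have "\<dots> \<longleftrightarrow> (\<forall>y. y \<noteq> y1 \<longrightarrow> s y * (BY hX y - b' y - AY a' y) = 0)"
        using col by auto
      also have "\<dots> \<longleftrightarrow> (\<forall>y. y \<noteq> y1 \<longrightarrow> b' y + AY a' y = BY hX y)"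
        using s_pos by (intro iff_allI imp_cong refl) (smt (verit) mult_eq_0_iff)
      \<comment> \<open>All three terms vanish at \<open>y1\<close>, where they are omitted
        entries.\<close>
      also have "\<dots> \<longleftrightarrow> (\<forall>y. b' y + AY a' y = BY hX y)"
        using b1 AY_y1 BY_y1 by (metis add_0)
      finally show ?thesis .
    qed
    ultimately show ?thesis by (simp add: A_star_def)
  qed
  have sol: "(\<forall>x. a' x + AX b' x = BX hY x) \<and> (\<forall>y. b' y + AY a' y = BY hX y) \<longleftrightarrow>
      a' = solA hX hY \<and> b' = solB hX hY"
    using solution_unique[OF hX hY(1) in'] solution(3,4)[OF hX hY(1)] by blast
  have ab_iff: "a' = solA hX hY \<and> b' = solB hX hY \<longleftrightarrow>
      a = lam *\<^sub>R solA hX hY \<and> b = lam *\<^sub>R solB hX hY"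
    using lam unfolding ab by auto
  have "D_vars lam y1 plan (H, a, b) = D_data y1 plan r s (hX, omit y1 hY) \<longleftrightarrow>
      H = - tangent a' b' hX hY \<and> A_star y1 H = (- hX, - omit y1 hY)"
    unfolding D_vars_def D_data_def using first by (simp add: fill)
  also have "\<dots> \<longleftrightarrow> H = - tangent a' b' hX hY \<and> a' = solA hX hY \<and> b' = solB hX hY"
    using star_H sol by auto
  also have "\<dots> \<longleftrightarrow> H = - deriv_plan hX hY \<and> a' = solA hX hY \<and> b' = solB hX hY"
    by (auto simp: deriv_plan_def)
  finally show ?thesis unfolding ab_iff .
qed

end

section \<open>First-order expansion of the plan\<close>

text \<open>\<open>u\<close> and \<open>v\<close> are the ratios of the exponentiated potentials for the perturbed marginals
  \<open>r + t g\<close> and \<open>s + t h\<close> to those for \<open>r\<close> and \<open>s\<close>.\<close>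

lemma abs_combination_le:
  fixes A B c :: real
  assumes "\<bar>a\<bar> \<le> A" "\<bar>b\<bar> \<le> B" "0 \<le> c"
  shows "\<bar>c * (a * g + b * h)\<bar> \<le> c * (A * \<bar>g\<bar> + B * \<bar>h\<bar>)"
proof -
  have "\<bar>a * g + b * h\<bar> \<le> A * \<bar>g\<bar> + B * \<bar>h\<bar>"
    using abs_triangle_ineq[of "a * g" "b * h"] mult_right_mono[OF assms(1), of "\<bar>g\<bar>"]
      mult_right_mono[OF assms(2), of "\<bar>h\<bar>"] by (simp add: abs_mult)
  with assms(3) show ?thesis by (simp add: abs_mult mult_left_mono)
qed

text \<open>With \<open>U\<close> the product of the two ratios, every term inside the factor
  \<open>t * p\<close> on the right carries a difference of directions, a factor
  \<open>U - 1\<close>, a further factor \<open>t\<close>, or a deviation \<open>a + A\<close>,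
  \<open>b + B\<close> from the linearized solution. Each of these can be estimated
  separately.\<close>

lemma expansion_identity:
  fixes t :: real
  assumes "U - 1 = t * (a + b + t * a * b)"
  shows "p * U * (r + t * g) * (s + t * h) - p * r * s - t * (p * (r * h0 + g0 * s) - p * r * s * (A + B)) =
    t * (p * (s * (U * (g - g0) + (U - 1) * g0) + r * (U * (h - h0) + (U - 1) * h0) + t * (U * g * h) +
      ((a + A) + (b + B) + t * a * b) * r * s))"
  using assms by algebra

text \<open>\<open>row'\<close> and \<open>col'\<close> are the perturbed Schroedinger equations
  after division by the base scalings, so that the density \<open>p\<close> becomes the kernel.
  \<open>Q\<close> bounds the ratios, \<open>N\<close> the directions, and \<open>d\<close> the
  distance to the limiting directions \<open>g0\<close>, \<open>h0\<close>.\<close>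

locale perturbed_density = gibbs_density +
  fixes t :: real and g g0 u :: "'a \<Rightarrow> real" and h h0 v :: "'b \<Rightarrow> real" and Q N d :: real
  assumes t_pos: "0 < t" and Q_ge: "1 \<le> Q" and N_nonneg: "0 \<le> N" and d_nonneg: "0 \<le> d"
    and g: "g \<in> lX" "nX g \<le> N" and g0: "g0 \<in> lX" "nX g0 \<le> N" and gd: "nX (g - g0) \<le> d"
    and h: "h \<in> lY" "nY h \<le> N" and h0: "h0 \<in> lY" "nY h0 \<le> N" and hd: "nY (h - h0) \<le> d"
    and u_pos: "\<And>x. 0 < u x" and u_le: "\<And>x. u x \<le> Q" and u_ge: "\<And>x. 1 / u x \<le> Q"
    and v_pos: "\<And>y. 0 < v y" and v_le: "\<And>y. v y \<le> Q * phi y" and v_y1: "v y1 = 1"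
    and row': "\<And>x. ((\<lambda>y. p x y * v y * (s y + t * h y)) has_sum 1 / u x) UNIV"
    and col': "\<And>y. ((\<lambda>x. p x y * u x * (r x + t * g x)) has_sum 1 / v y) UNIV"
begin

section \<open>Exact expansions and a priori bounds for the ratios\<close>

lemma pow_le: "i \<le> j \<Longrightarrow> phi y ^ i \<le> phi y ^ j"
  using phi_ge[of y] by (rule power_increasing[rotated])

lemma nonneg: "0 \<le> M" "0 \<le> Q" "0 \<le> nY s" "0 \<le> nX r"
  using M_ge Q_ge nX_nonneg nY_nonneg by auto

lemma u_abs: "\<bar>u x\<bar> \<le> Q" and v_abs: "\<bar>v y\<bar> \<le> Q * phi y" and v_abs3: "\<bar>v y\<bar> \<le> Q * phi y ^ 3"
proof -
  show "\<bar>u x\<bar> \<le> Q" and *: "\<bar>v y\<bar> \<le> Q * phi y"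
    using u_pos[of x] u_le[of x] v_pos[of y] v_le[of y] by auto
  from * show "\<bar>v y\<bar> \<le> Q * phi y ^ 3" by (rule phi_le_cube)
qed

lemma g_diff: "g - g0 \<in> lX" and h_diff: "h - h0 \<in> lY"
  by (intro l1_space_diff g h g0 h0 order_trans[OF zero_le_one CX_ge] order_trans[OF zero_le_one Phi4_ge])+

lemma row_expansion: "1 / u x = avX v x + t * (\<Sum>\<^sub>\<infinity>y. p x y * v y * h y)"
proof -
  have "1 / u x = (\<Sum>\<^sub>\<infinity>y. p x y * v y * s y + t * (p x y * v y * h y))"
    using infsumI[OF row'[of x]] by (simp add: algebra_simps)
  also have "\<dots> = avX v x + (\<Sum>\<^sub>\<infinity>y. t * (p x y * v y * h y))"
    unfolding avX_def
    by (intro infsum_add summable_on_cmult_right lY_pairing(1)[where B = Q] s_lY h v_abs3)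
  finally show ?thesis by (simp add: infsum_cmult_right')
qed

lemma col_expansion: "1 / v y = avY u y + t * (\<Sum>\<^sub>\<infinity>x. p x y * u x * g x)"
proof -
  have "1 / v y = (\<Sum>\<^sub>\<infinity>x. p x y * u x * r x + t * (p x y * u x * g x))"
    using infsumI[OF col'[of y]] by (simp add: algebra_simps)
  also have "\<dots> = avY u y + (\<Sum>\<^sub>\<infinity>x. t * (p x y * u x * g x))"
    unfolding avY_def
    by (intro infsum_add summable_on_cmult_right lX_pairing(1)[where A = Q] r_lX g u_abs)
  finally show ?thesis by (simp add: infsum_cmult_right')
qed

lemma h_term: "\<bar>\<Sum>\<^sub>\<infinity>y. p x y * v y * h y\<bar> \<le> M * Q * N"
  using lY_pairing(2)[of h v Q x, OF h(1) v_abs3] mult_left_mono[OF h(2), of "M * Q"] nonneg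
  by simp

lemma g_term: "\<bar>\<Sum>\<^sub>\<infinity>x. p x y * u x * g x\<bar> \<le> M * Q * N * phi y"
proof -
  have "M * Q * nX g * phi y \<le> M * Q * N * phi y"
    using nonneg g phi_pow(3)[of y] by (intro mult_right_mono mult_left_mono) auto
  then show ?thesis
    using lX_pairing(2)[of g u Q y, OF g(1) u_abs] by linarith
qed

lemma avY_const: "avY (\<lambda>_. m) y = m"
  using infsumI[OF col[of y]] by (simp add: avY_def infsum_cmult_right' mult_ac)

lemma avX_const: "avX (\<lambda>_. m) x = m"
  using infsumI[OF row[of x]] by (simp add: avX_def infsum_cmult_right' mult_ac)

lemma avY_mono:
  assumes "\<And>x. a x \<le> a' x" "\<And>x. \<bar>a x\<bar> \<le> A" "\<And>x. \<bar>a' x\<bar> \<le> A'"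
  shows "avY a y \<le> avY a' y"
  unfolding avY_def
proof (rule infsum_mono)
  show "(\<lambda>x. p x y * a x * r x) summable_on UNIV" by (rule avY_summable[where A = A]) (rule assms)
  show "(\<lambda>x. p x y * a' x * r x) summable_on UNIV" by (rule avY_summable[where A = A']) (rule assms)
  show "p x y * a x * r x \<le> p x y * a' x * r x" for x
    using assms(1)[of x] p_pos[of x y] r_pos[of x] by simp
qed

lemma avX_mono:
  assumes "\<And>y. b y \<le> b' y" "\<And>y. \<bar>b y\<bar> \<le> B * phi y ^ 3" "\<And>y. \<bar>b' y\<bar> \<le> B' * phi y ^ 3"
  shows "avX b x \<le> avX b' x"
  unfolding avX_def
proof (rule infsum_mono)
  show "(\<lambda>y. p x y * b y * s y) summable_on UNIV" by (rule avX_summable[where B = B]) (rule assms)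
  show "(\<lambda>y. p x y * b' y * s y) summable_on UNIV" by (rule avX_summable[where B = B']) (rule assms)
  show "p x y * b y * s y \<le> p x y * b' y * s y" for y
    using assms(1)[of y] p_pos[of x y] s_pos[of y] by simp
qed

lemma avX_diff:
  assumes "\<And>y. \<bar>b y\<bar> \<le> B * phi y ^ 3" "\<And>y. \<bar>b' y\<bar> \<le> B' * phi y ^ 3"
  shows "avX (\<lambda>y. b y - b' y) x = avX b x - avX b' x"
  using avX_add[of b B b' B' "-1" x] assms by simp

lemma avY_diff:
  assumes "\<And>x. \<bar>a x\<bar> \<le> A" "\<And>x. \<bar>a' x\<bar> \<le> A'"
  shows "avY (\<lambda>x. a x - a' x) y = avY a y - avY a' y"
  using avY_add[of a A a' A' "-1" y] assms by simp

text \<open>The exact update of \<open>v\<close> for the unperturbed first marginal, with the normalization at \<open>y1\<close>.\<close>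

definition w where "w y = (if y = y1 then 1 else 1 / avY u y)"

text \<open>The constants \<open>K1\<close>, \<dots>, \<open>K13\<close> do not depend on \<open>t\<close>, \<open>d\<close>, \<open>u\<close>, \<open>v\<close> or the directions, so the final
  bound is uniform along a sequence.\<close>

definition K1 where "K1 = M * N * Q ^ 3"

lemma K1_nonneg: "0 \<le> K1"
  unfolding K1_def using nonneg N_nonneg by simp

lemma avY_u: "1 / Q \<le> avY u y" "avY u y \<le> Q" "0 < avY u y"
proof -
  have 1: "1 / Q \<le> u x" for x
    using u_ge[of x] u_pos[of x] Q_ge by (simp add: divide_simps mult_ac)
  have Q: "0 < 1 / Q" using Q_ge by simp
  show *: "1 / Q \<le> avY u y"
    using avY_mono[of "\<lambda>_. 1 / Q" u "1 / Q" Q y] 1 u_abs Q by (simp add: avY_const)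
  show "avY u y \<le> Q"
    using avY_bound[of u Q y, OF u_abs] by simp
  show "0 < avY u y" using * Q by linarith
qed

lemma w_bounds: "0 < w y" "w y \<le> Q"
proof -
  show "0 < w y" using avY_u(3)[of y] by (simp add: w_def)
  have "1 / avY u y \<le> Q"
    using avY_u(1,3)[of y] Q_ge by (simp add: divide_simps mult_ac)
  then show "w y \<le> Q" using Q_ge by (simp add: w_def)
qed

text \<open>Up to sign, \<open>v - w\<close> is \<open>v * w\<close> times the difference of the
  reciprocals, which \<open>col_expansion\<close> shows to be of order \<open>t\<close>. One power
  of \<open>phi\<close> comes from \<open>v\<close>, the other from pairing the density with
  \<open>g\<close>; the three factors \<open>Q\<close> in \<open>K1\<close> bound \<open>v\<close>,
  \<open>w\<close> and \<open>u\<close>.\<close>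

lemma v_w: "\<bar>v y - w y\<bar> \<le> K1 * t * phi y ^ 2"
proof (cases "y = y1")
  case True
  then show ?thesis using K1_nonneg t_pos phi_pow(2)[of y 2] by (simp add: w_def v_y1)
next
  case False
  have "v y - w y = - (v y * w y * (1 / v y - avY u y))"
    using False v_pos[of y] avY_u(3)[of y] by (simp add: w_def field_simps)
  also have "1 / v y - avY u y = t * (\<Sum>\<^sub>\<infinity>x. p x y * u x * g x)"
    by (simp add: col_expansion)
  also have "\<bar>- (v y * w y * (t * (\<Sum>\<^sub>\<infinity>x. p x y * u x * g x)))\<bar> \<le>
      (Q * phi y) * Q * (t * (M * Q * N * phi y))"
    unfolding abs_minus_cancel abs_mult
    using v_abs[of y] w_bounds[of y] t_pos g_term[of y] nonneg phi_pow(3)[of y]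
    by (intro mult_mono) auto
  also have "\<dots> = K1 * t * phi y ^ 2"
    by (simp add: K1_def power2_eq_square power3_eq_cube)
  finally show ?thesis .
qed

lemma v_w3: "\<bar>v y - w y\<bar> \<le> K1 * t * phi y ^ 3"
  using v_w[of y] mult_left_mono[OF pow_le[of 2 3 y], of "K1 * t"] K1_nonneg t_pos by simp

lemma w_abs3: "\<bar>w y\<bar> \<le> Q * phi y ^ 3"
proof -
  have "Q \<le> Q * phi y ^ 3"
    using mult_left_mono[OF phi_pow(1)[of y 3] nonneg(2)] by simp
  then show ?thesis using w_bounds[of y] by linarith
qed

definition K2 where "K2 = M * Q * N + M * K1 * nY s"

lemma K2_nonneg: "0 \<le> K2"
  unfolding K2_def using nonneg N_nonneg K1_nonneg by simp

text \<open>Replacing \<open>v\<close> by \<open>w\<close> closes the system up to order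
  \<open>t\<close>: \<open>1 / u\<close> is nearly an average of \<open>w\<close>, which is
  determined by \<open>u\<close> alone. In \<open>K2\<close> the first term is the pairing with
  \<open>h\<close>, the second the averaged difference \<open>v - w\<close>.\<close>

lemma u_av_w: "\<bar>1 / u x - avX w x\<bar> \<le> K2 * t"
proof -
  have "\<bar>avX v x - avX w x\<bar> \<le> M * (K1 * t) * nY s"
    using avX_bound[of "\<lambda>y. v y - w y" "K1 * t" x, OF v_w3] avX_diff[of v Q w Q x, OF v_abs3 w_abs3]
    by simp
  moreover have "\<bar>t * (\<Sum>\<^sub>\<infinity>y. p x y * v y * h y)\<bar> \<le> t * (M * Q * N)"
    unfolding abs_mult using t_pos h_term[of x] by (intro mult_mono) auto
  ultimately show ?thesis
    unfolding row_expansion K2_def by (simp add: algebra_simps)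
qed

lemma split_y1:
  "((\<lambda>y. p x y * (if y = y1 then 1 else m) * s y) has_sum m + (1 - m) * (p x y1 * s y1)) UNIV"
proof -
  have one: "((\<lambda>y. if y = y1 then (1 - m) * (p x y1 * s y1) else 0) has_sum (1 - m) * (p x y1 * s y1)) UNIV"
    by (rule has_sum_finite_neutralI[of "{y1}"]) auto
  have "((\<lambda>y. m * (p x y * s y) + (if y = y1 then (1 - m) * (p x y1 * s y1) else 0)) has_sum
      m * 1 + (1 - m) * (p x y1 * s y1)) UNIV"
    by (intro has_sum_add has_sum_cmult_right row one)
  also have "(\<lambda>y. m * (p x y * s y) + (if y = y1 then (1 - m) * (p x y1 * s y1) else 0)) =
      (\<lambda>y. p x y * (if y = y1 then 1 else m) * s y)"
    by (auto simp: fun_eq_iff algebra_simps)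
  finally show ?thesis by simp
qed

lemma avX_split: "avX (\<lambda>y. if y = y1 then 1 else m) x = m + (1 - m) * (p x y1 * s y1)"
  unfolding avX_def by (rule infsumI[OF split_y1])

lemma split_abs3: "\<bar>if y = y1 then 1 else m\<bar> \<le> (1 + \<bar>m\<bar>) * phi y ^ 3"
  using mult_left_mono[OF phi_pow(1)[of y 3], of "1 + \<bar>m\<bar>"] by auto

text \<open>The fixed entry at \<open>y1\<close> pulls the extreme values of \<open>1 / u\<close> towards \<open>1\<close>.\<close>

lemma u_near_1: "\<bar>1 / u x - 1\<bar> \<le> K2 * t / \<theta>"
proof -
  have bdd: "bdd_below (range (\<lambda>x. 1 / u x))" "bdd_above (range (\<lambda>x. 1 / u x))"
    using u_pos u_ge by (auto intro!: bdd_belowI[of _ 0] bdd_aboveI[of _ Q] simp: less_imp_le)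
  define m where "m = (INF x. 1 / u x)"
  define m' where "m' = (SUP x. 1 / u x)"
  have m: "m \<le> 1 / u x" and m': "1 / u x \<le> m'" for x
    unfolding m_def m'_def by (auto intro!: cINF_lower cSUP_upper bdd)
  have Q0: "0 < 1 / Q" using Q_ge by simp
  have "1 / Q \<le> 1 / u x" for x
    using u_pos[of x] u_le[of x] by (intro divide_left_mono) auto
  then have "1 / Q \<le> m" unfolding m_def by (intro cINF_greatest) auto
  then have m_pos: "0 < m" using Q0 by linarith
  have m'_pos: "0 < m'" using m'[of undefined] u_pos[of undefined] by (smt (verit) divide_pos_pos)
  \<comment> \<open>The lower bound \<open>m\<close> for \<open>1 / u\<close> survives averaging
    over \<open>x\<close>: it gives \<open>w \<ge> m\<close> away from \<open>y1\<close>, while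
    \<open>w = 1\<close> at \<open>y1\<close>. Averaging over \<open>y\<close> then improves the
    lower bound for \<open>1 / u\<close> beyond \<open>m\<close> whenever \<open>m < 1\<close>, up
    to \<open>K2 * t\<close>; the supremum \<open>m'\<close> is treated in the same way.\<close>
  have "u x \<le> 1 / m" for x
    using m[of x] m_pos u_pos[of x] by (simp add: divide_simps mult_ac)
  then have "avY u y \<le> 1 / m" for y
    using avY_mono[of u "\<lambda>_. 1 / m" Q "1 / m" y] u_abs m_pos by (simp add: avY_const)
  then have w_ge: "(if y = y1 then 1 else m) \<le> w y" for y
    using m_pos avY_u(3)[of y] by (simp add: w_def divide_simps mult_ac)
  have "1 / m' \<le> u x" for x
    using m'[of x] m'_pos u_pos[of x] by (simp add: divide_simps mult_ac)
  then have "1 / m' \<le> avY u y" for y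
    using avY_mono[of "\<lambda>_. 1 / m'" u "1 / m'" Q y] u_abs m'_pos by (simp add: avY_const)
  then have w_le: "w y \<le> (if y = y1 then 1 else m')" for y
    using m'_pos avY_u(3)[of y] by (simp add: w_def divide_simps mult_ac)
  have lower: "m + (1 - m) * (p x y1 * s y1) - K2 * t \<le> 1 / u x" for x
    using avX_mono[of "\<lambda>y. if y = y1 then 1 else m" w "1 + \<bar>m\<bar>" Q x, OF w_ge split_abs3 w_abs3] u_av_w[of x]
    by (simp add: avX_split)
  have upper: "1 / u x \<le> m' + (1 - m') * (p x y1 * s y1) + K2 * t" for x
    using avX_mono[of w "\<lambda>y. if y = y1 then 1 else m'" Q "1 + \<bar>m'\<bar>" x, OF w_le w_abs3 split_abs3] u_av_w[of x]
    by (simp add: avX_split)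
  have pos: "0 \<le> K2 * t / \<theta>" using K2_nonneg t_pos theta_pos by simp
  have "1 - K2 * t / \<theta> \<le> m"
  proof (cases "1 \<le> m")
    case False
    have "m + (1 - m) * \<theta> - K2 * t \<le> 1 / u x" for x
      using lower[of x] mult_left_mono[OF theta_le[of x], of "1 - m"] False by linarith
    then have "m + (1 - m) * \<theta> - K2 * t \<le> (INF x. 1 / u x)"
      by (intro cINF_greatest) auto
    then have "m + (1 - m) * \<theta> - K2 * t \<le> m" by (simp only: m_def)
    then have "(1 - m) \<le> K2 * t / \<theta>" using theta_pos by (simp add: pos_le_divide_eq)
    then show ?thesis by simp
  qed (use pos in simp)
  moreover have "m' \<le> 1 + K2 * t / \<theta>"
  proof (cases "m' \<le> 1")
    case False
    have "1 / u x \<le> m' + (1 - m') * \<theta> + K2 * t" for x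
      using upper[of x] mult_left_mono_neg[OF theta_le[of x], of "1 - m'"] False by linarith
    then have "(SUP x. 1 / u x) \<le> m' + (1 - m') * \<theta> + K2 * t"
      by (intro cSUP_least) auto
    then have "m' \<le> m' + (1 - m') * \<theta> + K2 * t" by (simp only: m'_def)
    then have "(m' - 1) * \<theta> \<le> K2 * t" by (simp add: algebra_simps)
    then have "m' - 1 \<le> K2 * t / \<theta>" using theta_pos by (simp add: pos_le_divide_eq)
    then show ?thesis by simp
  qed (use pos in simp)
  ultimately show ?thesis
    using m[of x] m'[of x] by (simp add: abs_le_iff)
qed

definition K3 where "K3 = Q * K2 / \<theta>"

lemma K3_nonneg: "0 \<le> K3"
  unfolding K3_def using nonneg K2_nonneg theta_pos by simp

lemma u_1: "\<bar>u x - 1\<bar> \<le> K3 * t"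
proof -
  have "u x - 1 = - (u x * (1 / u x - 1))" using u_pos[of x] by (simp add: field_simps)
  then have "\<bar>u x - 1\<bar> = \<bar>u x\<bar> * \<bar>1 / u x - 1\<bar>" by (simp only: abs_minus_cancel abs_mult)
  also have "\<dots> \<le> Q * (K2 * t / \<theta>)"
    using u_abs[of x] u_near_1[of x] nonneg by (intro mult_mono) auto
  finally show ?thesis by (simp add: K3_def)
qed

definition K4 where "K4 = K1 + Q * K3"

lemma K4_nonneg: "0 \<le> K4"
  unfolding K4_def using nonneg K1_nonneg K3_nonneg by simp

text \<open>\<open>w - 1\<close> inherits the bound of \<open>u - 1\<close> because averages
  preserve constants; the growth \<open>phi y ^ 2\<close> stems from \<open>v_w\<close>
  alone.\<close>

lemma v_1: "\<bar>v y - 1\<bar> \<le> K4 * t * phi y ^ 2"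
proof -
  have "\<bar>w y - 1\<bar> \<le> Q * (K3 * t)"
  proof (cases "y = y1")
    case False
    have "\<bar>avY u y - 1\<bar> \<le> K3 * t"
      using avY_bound[of "\<lambda>x. u x - 1" "K3 * t" y, OF u_1] avY_diff[of u Q "\<lambda>_. 1" 1 y] u_abs
      by (simp add: avY_const)
    moreover have "w y - 1 = - (w y * (avY u y - 1))"
      using False avY_u(3)[of y] by (simp add: w_def field_simps)
    then have "\<bar>w y - 1\<bar> = \<bar>w y\<bar> * \<bar>avY u y - 1\<bar>" by (simp only: abs_minus_cancel abs_mult)
    ultimately show ?thesis
      using w_bounds[of y] nonneg by (auto intro!: mult_mono)
  qed (use nonneg K3_nonneg t_pos in \<open>simp add: w_def\<close>)
  also have "\<dots> \<le> Q * (K3 * t) * phi y ^ 2"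
    using mult_left_mono[OF phi_pow(1)[of y 2], of "Q * (K3 * t)"] nonneg K3_nonneg t_pos by simp
  finally show ?thesis
    using v_w[of y] by (simp add: K4_def algebra_simps)
qed

text \<open>Difference quotients \<open>a\<close>, \<open>b\<close> and their deviations \<open>da\<close>, \<open>db\<close> from the solution of the
  linearized system, whose sign is opposite because \<open>u\<close> and \<open>v\<close> decrease when the marginals grow.\<close>

definition a where "a x = (u x - 1) / t"
definition b where "b y = (v y - 1) / t"
definition da where "da x = a x + solA g0 h0 x"
definition db where "db y = b y + solB g0 h0 y"

lemma a_bound: "\<bar>a x\<bar> \<le> K3"
  using u_1[of x] t_pos by (simp add: a_def pos_divide_le_eq)

lemma b_bound: "\<bar>b y\<bar> \<le> K4 * phi y ^ 2"
  using v_1[of y] t_pos by (simp add: b_def pos_divide_le_eq mult_ac)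

lemma b_bound3: "\<bar>b y\<bar> \<le> K4 * phi y ^ 3"
  using b_bound[of y] mult_left_mono[OF pow_le[of 2 3 y] K4_nonneg] by simp

lemma u_a: "u x = 1 + t * a x" and v_b: "v y = 1 + t * b y"
  using t_pos by (simp_all add: a_def b_def)

lemma b_y1: "b y1 = 0"
  by (simp add: b_def v_y1)

text \<open>Increments of the reciprocals: \<open>1 / u x = 1 + t * c x\<close> and
  \<open>1 / v y = 1 + t * c' y\<close> hold exactly, which gives the exact equations
  \<open>a = - u c\<close> and \<open>b = - v c'\<close> without any Taylor remainder.\<close>

definition c where "c x = avX b x + (\<Sum>\<^sub>\<infinity>y. p x y * v y * h y)"
definition c' where "c' y = avY a y + (\<Sum>\<^sub>\<infinity>x. p x y * u x * g x)"

definition K5 where "K5 = M * K4 * nY s + M * Q * N"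
definition K6 where "K6 = K3 + M * Q * N"

lemma K5_nonneg: "0 \<le> K5" and K6_nonneg: "0 \<le> K6"
  unfolding K5_def K6_def using nonneg K4_nonneg K3_nonneg N_nonneg by simp_all

lemma c_bound: "\<bar>c x\<bar> \<le> K5"
  using avX_bound[of b K4 x, OF b_bound3] h_term[of x] unfolding c_def K5_def by linarith

lemma c'_bound: "\<bar>c' y\<bar> \<le> K6 * phi y"
  using avY_bound[of a K3 y, OF a_bound] g_term[of y] mult_left_mono[OF phi_ge[of y] K3_nonneg]
  unfolding c'_def K6_def by (simp add: distrib_right)

lemma a_eq: "a x = - (u x * c x)"
proof -
  have "avX v x = 1 + t * avX b x"
  proof -
    have "avX (\<lambda>y. 1 + t * b y) x = avX (\<lambda>_. 1) x + t * avX b x"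
      by (rule avX_add[where B = 1 and B' = K4]) (use phi_pow(1) b_bound3 in auto)
    then show ?thesis by (simp add: v_b[abs_def, symmetric] avX_const)
  qed
  then have "1 / u x = 1 + t * c x"
    unfolding row_expansion c_def by (simp add: distrib_left)
  then have "1 = u x * (1 + t * c x)" using u_pos[of x] by (simp add: field_simps)
  then have "t * a x = t * (- (u x * c x))"
    using u_a[of x] by (simp add: algebra_simps)
  then show ?thesis using t_pos mult_left_cancel[of t "a x" "- (u x * c x)"] by simp
qed

lemma b_eq: "b y = - (v y * c' y)" if "y \<noteq> y1"
proof -
  have "avY u y = 1 + t * avY a y"
  proof -
    have "avY (\<lambda>x. 1 + t * a x) y = avY (\<lambda>_. 1) y + t * avY a y"
      by (rule avY_add[where A = 1 and A' = K3]) (use a_bound in auto)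
    then show ?thesis by (simp add: u_a[abs_def, symmetric] avY_const)
  qed
  then have "1 / v y = 1 + t * c' y"
    unfolding col_expansion c'_def by (simp add: distrib_left)
  then have "1 = v y * (1 + t * c' y)" using v_pos[of y] by (simp add: field_simps)
  then have "t * b y = t * (- (v y * c' y))"
    using v_b[of y] by (simp add: algebra_simps)
  then show ?thesis using t_pos mult_left_cancel[of t "b y" "- (v y * c' y)"] by simp
qed

section \<open>Deviation of the difference quotients from the linearized solution\<close>

lemma solA_LX: "solA g0 h0 \<in> LX" and solB_LY: "solB g0 h0 \<in> LY"
  by (rule solution[OF g0(1) h0(1)])+

lemma db_y1: "db y1 = 0"
  using solB_LY by (simp add: db_def b_y1 LY_iff)

text \<open>Splits \<open>v h - h0 = v (h - h0) + (v - 1) h0\<close>: the first part is controlled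
  by \<open>d\<close>, the second by \<open>t\<close>.\<close>

lemma h_diff_term: "\<bar>(\<Sum>\<^sub>\<infinity>y. p x y * v y * h y) - BX h0 x\<bar> \<le> M * Q * d + M * (K4 * t) * N"
proof -
  have 1: "(\<lambda>y. p x y * v y * (h - h0) y) summable_on UNIV"
    "\<bar>\<Sum>\<^sub>\<infinity>y. p x y * v y * (h - h0) y\<bar> \<le> M * Q * nY (h - h0)"
    by (rule lY_pairing[OF h_diff v_abs3])+
  have v3: "\<bar>v y - 1\<bar> \<le> (K4 * t) * phi y ^ 3" for y
    using v_1[of y] mult_left_mono[OF pow_le[of 2 3 y], of "K4 * t"] K4_nonneg t_pos by simp
  have 2: "(\<lambda>y. p x y * (v y - 1) * h0 y) summable_on UNIV"
    "\<bar>\<Sum>\<^sub>\<infinity>y. p x y * (v y - 1) * h0 y\<bar> \<le> M * (K4 * t) * nY h0"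
    by (rule lY_pairing[OF h0(1) v3])+
  have 3: "(\<lambda>y. p x y * h0 y) summable_on UNIV"
    using lY_pairing(1)[OF h0(1), of "\<lambda>_. 1" 1 x] phi_pow(1) by simp
  have "(\<Sum>\<^sub>\<infinity>y. p x y * v y * h y) - BX h0 x = (\<Sum>\<^sub>\<infinity>y. p x y * v y * h y - p x y * h0 y)"
    unfolding BX_eq
    by (intro infsum_diff_real[symmetric] 3 lY_pairing(1)[OF h(1) v_abs3])
  also have "\<dots> = (\<Sum>\<^sub>\<infinity>y. p x y * v y * (h - h0) y + p x y * (v y - 1) * h0 y)"
    by (intro infsum_cong) (simp add: algebra_simps)
  also have "\<dots> = (\<Sum>\<^sub>\<infinity>y. p x y * v y * (h - h0) y) + (\<Sum>\<^sub>\<infinity>y. p x y * (v y - 1) * h0 y)"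
    by (rule infsum_add[OF 1(1) 2(1)])
  finally have eq: "(\<Sum>\<^sub>\<infinity>y. p x y * v y * h y) - BX h0 x =
    (\<Sum>\<^sub>\<infinity>y. p x y * v y * (h - h0) y) + (\<Sum>\<^sub>\<infinity>y. p x y * (v y - 1) * h0 y)" .
  have "M * Q * nY (h - h0) \<le> M * Q * d" "M * (K4 * t) * nY h0 \<le> M * (K4 * t) * N"
    using nonneg K4_nonneg t_pos hd h0(2) by (auto intro!: mult_left_mono)
  then show ?thesis using 1(2) 2(2) unfolding eq by linarith
qed

lemma g_diff_term:
  assumes y: "y \<noteq> y1"
  shows "\<bar>(\<Sum>\<^sub>\<infinity>x. p x y * u x * g x) - BY g0 y\<bar> \<le> (M * Q * d + M * (K3 * t) * N) * phi y"
proof -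
  have 1: "(\<lambda>x. p x y * u x * (g - g0) x) summable_on UNIV"
    "\<bar>\<Sum>\<^sub>\<infinity>x. p x y * u x * (g - g0) x\<bar> \<le> M * Q * nX (g - g0) * phi y"
    by (rule lX_pairing[OF g_diff u_abs])+
  have 2: "(\<lambda>x. p x y * (u x - 1) * g0 x) summable_on UNIV"
    "\<bar>\<Sum>\<^sub>\<infinity>x. p x y * (u x - 1) * g0 x\<bar> \<le> M * (K3 * t) * nX g0 * phi y"
    by (rule lX_pairing[OF g0(1) u_1])+
  have 3: "(\<lambda>x. p x y * g0 x) summable_on UNIV"
    using lX_pairing(1)[OF g0(1), of "\<lambda>_. 1" 1 y] by simp
  have "(\<Sum>\<^sub>\<infinity>x. p x y * u x * g x) - BY g0 y = (\<Sum>\<^sub>\<infinity>x. p x y * u x * g x - p x y * g0 x)"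
    unfolding BY_eq omit_def using y
    by (simp, intro infsum_diff_real[symmetric] 3 lX_pairing(1)[OF g(1) u_abs])
  also have "\<dots> = (\<Sum>\<^sub>\<infinity>x. p x y * u x * (g - g0) x + p x y * (u x - 1) * g0 x)"
    by (intro infsum_cong) (simp add: algebra_simps)
  also have "\<dots> = (\<Sum>\<^sub>\<infinity>x. p x y * u x * (g - g0) x) + (\<Sum>\<^sub>\<infinity>x. p x y * (u x - 1) * g0 x)"
    by (rule infsum_add[OF 1(1) 2(1)])
  finally have eq: "(\<Sum>\<^sub>\<infinity>x. p x y * u x * g x) - BY g0 y =
    (\<Sum>\<^sub>\<infinity>x. p x y * u x * (g - g0) x) + (\<Sum>\<^sub>\<infinity>x. p x y * (u x - 1) * g0 x)" .
  have "M * Q * nX (g - g0) * phi y \<le> M * Q * d * phi y"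
    "M * (K3 * t) * nX g0 * phi y \<le> M * (K3 * t) * N * phi y"
    using nonneg K3_nonneg t_pos gd g0(2) phi_pow(3)[of y]
    by (auto intro!: mult_left_mono mult_right_mono)
  then show ?thesis using 1(2) 2(2) unfolding eq distrib_right by linarith
qed

definition K7 where "K7 = M * Q + M * K3 * N + K4 * K6"

lemma K7_nonneg: "0 \<le> K7"
  unfolding K7_def using nonneg K3_nonneg K4_nonneg K6_nonneg N_nonneg by simp

lemma t_d_bounds: "t \<le> t + d" "d \<le> t + d" "0 \<le> t + d" "0 \<le> t"
  using t_pos d_nonneg by auto

definition e' where "e' y = db y + AY da y"

lemma da_LX: "da \<in> LX"
proof -
  have "a \<in> LX" using a_bound by (rule LXI)
  from LX_axpy[OF this solA_LX, of 1] show ?thesis by (simp add: da_def[abs_def])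
qed

lemma AY_da: "AY da = (\<lambda>y. AY a y + AY (solA g0 h0) y)"
proof -
  have "a \<in> LX" using a_bound by (rule LXI)
  from AY_axpy[OF this solA_LX, of 1] show ?thesis by (simp add: da_def[abs_def])
qed

text \<open>The residual consists of the change in the pairing with the direction and of
  \<open>(v - 1) * c'\<close>, the error of replacing \<open>b = - v c'\<close> by
  \<open>b = - c'\<close>; the latter grows like \<open>phi y ^ 2 * phi y\<close>.\<close>

lemma e'_bound: "\<bar>e' y\<bar> \<le> K7 * (t + d) * phi y ^ 3"
proof (cases "y = y1")
  case True
  then show ?thesis using db_y1 AY_y1 K7_nonneg t_d_bounds phi_pow(2)[of y 3] by (simp add: e'_def)
next
  case False
  have AYa: "AY a y = avY a y" using False by (simp add: AY_eq omit_def)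
  have sol: "solB g0 h0 y + AY (solA g0 h0) y = BY g0 y"
    by (rule solution(4)[OF g0(1) h0(1)])
  have eq: "e' y = - ((\<Sum>\<^sub>\<infinity>x. p x y * u x * g x) - BY g0 y) - (v y - 1) * c' y"
    unfolding e'_def db_def AY_da b_eq[OF False] sol[symmetric]
    by (simp add: AYa c'_def algebra_simps)
  have "\<bar>e' y\<bar> \<le> (M * Q * d + M * (K3 * t) * N) * phi y + (K4 * t * phi y ^ 2) * (K6 * phi y)"
  proof -
    have "\<bar>(v y - 1) * c' y\<bar> \<le> (K4 * t * phi y ^ 2) * (K6 * phi y)"
      unfolding abs_mult using v_1[of y] c'_bound[of y] by (intro mult_mono) auto
    then show ?thesis using g_diff_term[OF False] unfolding eq by linarith
  qed
  also have "\<dots> \<le> (M * Q * d + M * (K3 * t) * N) * phi y ^ 3 + (K4 * t * K6) * phi y ^ 3"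
  proof -
    have "phi y \<le> phi y ^ 3" using pow_le[of 1 3 y] by simp
    moreover have "0 \<le> M * Q * d + M * (K3 * t) * N"
      using nonneg d_nonneg K3_nonneg t_pos N_nonneg by simp
    ultimately have "(M * Q * d + M * (K3 * t) * N) * phi y \<le> (M * Q * d + M * (K3 * t) * N) * phi y ^ 3"
      by (rule mult_left_mono)
    moreover have "(K4 * t * phi y ^ 2) * (K6 * phi y) = (K4 * t * K6) * phi y ^ 3"
      by (simp add: power2_eq_square power3_eq_cube)
    ultimately show ?thesis by linarith
  qed
  also have "\<dots> = (M * Q * d + M * K3 * N * t + K4 * K6 * t) * phi y ^ 3"
    by (simp add: algebra_simps)
  also have "\<dots> \<le> (M * Q * (t + d) + M * K3 * N * (t + d) + K4 * K6 * (t + d)) * phi y ^ 3"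
    using nonneg t_d_bounds K3_nonneg K4_nonneg K6_nonneg N_nonneg phi_pow(2)[of y 3]
    by (intro mult_right_mono add_mono mult_left_mono) auto
  also have "\<dots> = K7 * (t + d) * phi y ^ 3" by (simp add: K7_def algebra_simps)
  finally show ?thesis .
qed

definition K8 where "K8 = K3 * K5 + M * Q + M * K4 * N"

lemma K8_nonneg: "0 \<le> K8"
  unfolding K8_def using nonneg K3_nonneg K4_nonneg K5_nonneg N_nonneg by simp

lemma e_bound: "\<bar>da x + avX db x\<bar> \<le> K8 * (t + d)"
proof -
  obtain B where B: "\<And>y. \<bar>solB g0 h0 y\<bar> \<le> B * phi y" and B1: "solB g0 h0 y1 = 0"
    using solB_LY by (auto simp: LY_iff)
  have avdb: "avX db x = avX b x + AX (solB g0 h0) x"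
    using avX_add[of b K4 "solB g0 h0" B 1 x, OF b_bound3 phi_le_cube[OF B]]
    by (simp add: db_def[abs_def] AX_eq B1)
  have sol: "solA g0 h0 x + AX (solB g0 h0) x = BX h0 x"
    by (rule solution(3)[OF g0(1) h0(1)])
  have eq: "da x + avX db x = - ((\<Sum>\<^sub>\<infinity>y. p x y * v y * h y) - BX h0 x) - (u x - 1) * c x"
    unfolding da_def a_eq avdb sol[symmetric] by (simp add: c_def algebra_simps)
  have "\<bar>da x + avX db x\<bar> \<le> (M * Q * d + M * (K4 * t) * N) + (K3 * t) * K5"
  proof -
    have "\<bar>(u x - 1) * c x\<bar> \<le> (K3 * t) * K5"
      unfolding abs_mult using u_1[of x] c_bound[of x] K5_nonneg by (intro mult_mono) auto
    then show ?thesis using h_diff_term[of x] unfolding eq by linarith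
  qed
  also have "\<dots> = M * Q * d + M * K4 * N * t + K3 * K5 * t" by (simp add: algebra_simps)
  also have "\<dots> \<le> M * Q * (t + d) + M * K4 * N * (t + d) + K3 * K5 * (t + d)"
    using nonneg t_d_bounds K3_nonneg K4_nonneg K5_nonneg N_nonneg
    by (intro add_mono mult_left_mono) auto
  also have "\<dots> = K8 * (t + d)" by (simp add: K8_def algebra_simps)
  finally show ?thesis .
qed

definition K9 where "K9 = (K8 + M * K7 * nY s) / \<theta>"
definition K10 where "K10 = K9 + K7"

lemma K9_nonneg: "0 \<le> K9" and K10_nonneg: "0 \<le> K10"
  unfolding K9_def K10_def using nonneg K8_nonneg K7_nonneg theta_pos by simp_all

text \<open>Inserting \<open>db = e' - AY da\<close> into the first equation leaves
  \<open>da - AX (AY da)\<close> equal to a residual of order \<open>t + d\<close>, and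
  \<open>resolvent_bound\<close> applies. Averaging \<open>e'\<close> pairs growth
  \<open>phi y ^ 3\<close> and the density with \<open>s\<close>, which uses up all four
  powers.\<close>

lemma da_bound: "\<bar>da x\<bar> \<le> K9 * (t + d)"
proof -
  have "\<bar>da x - AX (AY da) x\<bar> \<le> (K8 + M * K7 * nY s) * (t + d)" for x
  proof -
    obtain A where A: "\<And>x. \<bar>da x\<bar> \<le> A" using da_LX by (auto simp: LX_iff)
    have AYd: "\<bar>AY da y\<bar> \<le> A * phi y ^ 3" for y
    proof -
      have "\<bar>AY da y\<bar> \<le> A" by (rule AY_bound[OF A])
      also have "\<dots> \<le> A * phi y ^ 3"
        using mult_left_mono[OF phi_pow(1)[of y 3], of A] order_trans[OF abs_ge_zero A] by simp
      finally show ?thesis .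
    qed
    have "avX db x = avX (\<lambda>y. e' y - AY da y) x" by (simp add: e'_def)
    also have "\<dots> = avX e' x - AX (AY da) x"
      using avX_diff[of e' "K7 * (t + d)" "AY da" A x, OF e'_bound AYd] by (simp add: AX_eq AY_y1)
    finally have "da x - AX (AY da) x = (da x + avX db x) - avX e' x" by simp
    moreover have "\<bar>avX e' x\<bar> \<le> M * (K7 * (t + d)) * nY s"
      by (rule avX_bound[OF e'_bound])
    ultimately have "\<bar>da x - AX (AY da) x\<bar> \<le> K8 * (t + d) + M * (K7 * (t + d)) * nY s"
      using e_bound[of x] by linarith
    then show ?thesis by (simp add: algebra_simps)
  qed
  from resolvent_bound[OF da_LX this] show ?thesis by (simp add: K9_def)
qed

lemma db_bound: "\<bar>db y\<bar> \<le> K10 * (t + d) * phi y ^ 3"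
proof -
  have "\<bar>AY da y\<bar> \<le> K9 * (t + d)" by (rule AY_bound[OF da_bound])
  also have "\<dots> \<le> K9 * (t + d) * phi y ^ 3"
    using mult_left_mono[OF phi_pow(1)[of y 3], of "K9 * (t + d)"] K9_nonneg t_d_bounds by simp
  finally show ?thesis
    using e'_bound[of y] by (simp add: e'_def K10_def algebra_simps)
qed

section \<open>The remainder of the first-order expansion\<close>

definition plan' where "plan' = (\<lambda>(x, y). p x y * u x * v y * (r x + t * g x) * (s y + t * h y))"

definition remainder where "remainder = (1 / t) *\<^sub>R (plan' - plan) - deriv_plan g0 h0"

lemma uv_eq: "u x * v y - 1 = t * (a x + b y + t * a x * b y)"
  using u_a[of x] v_b[of y] by algebra

lemma remainder_eq:
  "remainder (x, y) = p x y * (s y * (u x * v y * (g - g0) x + (u x * v y - 1) * g0 x) +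
    r x * (u x * v y * (h - h0) y + (u x * v y - 1) * h0 y) + t * (u x * v y * g x * h y) +
    (da x + db y + t * a x * b y) * r x * s y)"
proof -
  have "t * remainder (x, y) = p x y * u x * v y * (r x + t * g x) * (s y + t * h y) - p x y * r x * s y -
      t * (p x y * (r x * h0 y + g0 x * s y) - p x y * r x * s y * (solA g0 h0 x + solB g0 h0 y))"
  proof -
    have "remainder (x, y) = (plan' (x, y) - plan (x, y)) / t - deriv_plan g0 h0 (x, y)"
      by (simp add: remainder_def scaleR_fun_def)
    then have "t * remainder (x, y) = t * ((plan' (x, y) - plan (x, y)) / t) - t * deriv_plan g0 h0 (x, y)"
      by (simp only: right_diff_distrib)
    also have "t * ((plan' (x, y) - plan (x, y)) / t) = plan' (x, y) - plan (x, y)"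
      using t_pos by simp
    finally have "t * remainder (x, y) = plan' (x, y) - plan (x, y) - t * deriv_plan g0 h0 (x, y)" .
    then show ?thesis
      by (simp add: deriv_plan_def tangent_def plan'_def plan_def)
  qed
  also have "\<dots> = t * (p x y * (s y * (u x * v y * (g - g0) x + (u x * v y - 1) * g0 x) +
    r x * (u x * v y * (h - h0) y + (u x * v y - 1) * h0 y) + t * (u x * v y * g x * h y) +
    (da x + db y + t * a x * b y) * r x * s y))"
    using expansion_identity[of "u x * v y" t "a x" "b y" "p x y" "r x" "g x" "s y" "h y" "h0 y" "g0 x"
        "solA g0 h0 x" "solB g0 h0 y", OF uv_eq]
    by (simp add: da_def db_def mult.assoc)
  finally show ?thesis using t_pos by simp
qed

definition K11 where "K11 = K3 * Q + K4"
definition K12 where "K12 = K9 + K10 + K3 * K4"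

lemma K11_nonneg: "0 \<le> K11" and K12_nonneg: "0 \<le> K12"
  unfolding K11_def K12_def using nonneg K3_nonneg K4_nonneg K9_nonneg K10_nonneg by simp_all

lemma uv_bound: "\<bar>u x * v y\<bar> \<le> Q\<^sup>2 * phi y ^ 3"
proof -
  have "\<bar>u x * v y\<bar> \<le> Q * (Q * phi y ^ 3)"
    unfolding abs_mult using u_abs[of x] v_abs3[of y] nonneg by (intro mult_mono) auto
  then show ?thesis by (simp add: power2_eq_square mult_ac)
qed

lemma uv_1: "\<bar>u x * v y - 1\<bar> \<le> t * K11 * phi y ^ 3"
proof -
  have eq: "u x * v y - 1 = t * (a x * v y + b y)"
    using u_a[of x] v_b[of y] by algebra
  have "\<bar>t * (a x * v y + b y)\<bar> \<le> t * (K3 * (Q * phi y ^ 3) + K4 * phi y ^ 3)"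
    unfolding abs_mult using t_pos a_bound[of x] v_abs3[of y] b_bound3[of y] K3_nonneg
    by (intro mult_mono order_trans[OF abs_triangle_ineq] add_mono) (auto simp: abs_mult intro: mult_mono)
  then show ?thesis unfolding eq by (simp add: K11_def algebra_simps)
qed

lemma rest_bound: "\<bar>da x + db y + t * a x * b y\<bar> \<le> (t + d) * K12 * phi y ^ 3"
proof -
  have "\<bar>t * a x * b y\<bar> \<le> t * K3 * (K4 * phi y ^ 3)"
    unfolding abs_mult using t_pos a_bound[of x] b_bound3[of y] K3_nonneg
    by (intro mult_mono) auto
  also have "\<dots> \<le> (t + d) * K3 * (K4 * phi y ^ 3)"
    using t_d_bounds K3_nonneg K4_nonneg phi_pow(2)[of y 3] by (intro mult_right_mono) auto
  finally have 1: "\<bar>t * a x * b y\<bar> \<le> (t + d) * K3 * (K4 * phi y ^ 3)" .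
  have "K9 * (t + d) \<le> K9 * (t + d) * phi y ^ 3"
    using mult_left_mono[OF phi_pow(1)[of y 3], of "K9 * (t + d)"] K9_nonneg t_d_bounds by simp
  then have "\<bar>da x\<bar> \<le> K9 * (t + d) * phi y ^ 3" using da_bound[of x] by linarith
  then have "\<bar>da x + db y + t * a x * b y\<bar> \<le> K9 * (t + d) * phi y ^ 3 + K10 * (t + d) * phi y ^ 3 +
      (t + d) * K3 * (K4 * phi y ^ 3)"
    using db_bound[of y] 1 by linarith
  then show ?thesis by (simp add: K12_def algebra_simps)
qed

definition K13 where
  "K13 = 2 * M * (Q\<^sup>2 * nY s + K11 * N * nY s + Q\<^sup>2 * nX r + K11 * N * nX r + Q\<^sup>2 * N * N + K12 * nX r * nY s)"

lemma remainder_bound: "remainder \<in> V" "nV remainder \<le> K13 * (t + d)"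
proof -
  \<comment> \<open>One entry for each of the six terms of \<open>remainder_eq\<close> with the
    products distributed, in the same order and with its bound as coefficient; the density
    contributes \<open>M\<close> and the fourth power of \<open>phi\<close>.\<close>
  let ?ts = "[(M * Q\<^sup>2, g - g0, s), (M * (t * K11), g0, s), (M * Q\<^sup>2, r, h - h0),
    (M * (t * K11), r, h0), (M * (t * Q\<^sup>2), g, h), (M * ((t + d) * K12), r, s)]"
  have le: "\<bar>remainder (x, y)\<bar> \<le> (\<Sum>(c, f, g)\<leftarrow>?ts. c * \<bar>f x\<bar> * \<bar>g y\<bar>) * phi y ^ 4" for x y
  proof -
    let ?P = "phi y ^ 3"
    have P: "0 < ?P" by (rule phi_pow)
    have 1: "\<bar>s y * (u x * v y * (g - g0) x + (u x * v y - 1) * g0 x)\<bar> \<le>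
        s y * ((Q\<^sup>2 * ?P) * \<bar>(g - g0) x\<bar> + (t * K11 * ?P) * \<bar>g0 x\<bar>)"
      by (rule abs_combination_le[OF uv_bound uv_1 less_imp_le[OF s_pos]])
    have 2: "\<bar>r x * (u x * v y * (h - h0) y + (u x * v y - 1) * h0 y)\<bar> \<le>
        r x * ((Q\<^sup>2 * ?P) * \<bar>(h - h0) y\<bar> + (t * K11 * ?P) * \<bar>h0 y\<bar>)"
      by (rule abs_combination_le[OF uv_bound uv_1 less_imp_le[OF r_pos]])
    have 3: "\<bar>t * (u x * v y * g x * h y)\<bar> \<le> t * ((Q\<^sup>2 * ?P) * \<bar>g x\<bar> * \<bar>h y\<bar>)"
      using abs_combination_le[OF uv_bound[of x y] uv_bound[of x y], of t "g x * h y" 0] t_pos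
      by (simp add: abs_mult mult.assoc)
    have 4: "\<bar>(da x + db y + t * a x * b y) * r x * s y\<bar> \<le> ((t + d) * K12 * ?P) * r x * s y"
      using abs_combination_le[OF rest_bound[of x y] rest_bound[of x y], of 1 "r x * s y" 0]
        r_pos[of x] s_pos[of y] by (simp add: mult.assoc)
    let ?X = "s y * ((Q\<^sup>2 * ?P) * \<bar>(g - g0) x\<bar> + (t * K11 * ?P) * \<bar>g0 x\<bar>) +
        r x * ((Q\<^sup>2 * ?P) * \<bar>(h - h0) y\<bar> + (t * K11 * ?P) * \<bar>h0 y\<bar>) +
        t * ((Q\<^sup>2 * ?P) * \<bar>g x\<bar> * \<bar>h y\<bar>) + ((t + d) * K12 * ?P) * r x * s y"
    have "\<bar>remainder (x, y)\<bar> \<le> (M * phi y) * ?X"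
      unfolding remainder_eq abs_mult[of "p x y"]
    proof (rule mult_mono)
      show "\<bar>p x y\<bar> \<le> M * phi y" using p_pos[of x y] p_le[of x y] by simp
      show "\<bar>s y * (u x * v y * (g - g0) x + (u x * v y - 1) * g0 x) +
          r x * (u x * v y * (h - h0) y + (u x * v y - 1) * h0 y) + t * (u x * v y * g x * h y) +
          (da x + db y + t * a x * b y) * r x * s y\<bar> \<le> ?X"
        by (intro order_trans[OF abs_triangle_ineq add_mono[OF _ 4]]
            order_trans[OF abs_triangle_ineq add_mono[OF _ 3]] order_trans[OF abs_triangle_ineq add_mono[OF 1 2]])
      show "0 \<le> M * phi y" using nonneg phi_pow(3)[of y] by simp
    qed simp
    also have "\<dots> = (\<Sum>(c, f, g)\<leftarrow>?ts. c * \<bar>f x\<bar> * \<bar>g y\<bar>) * phi y ^ 4"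
      using r_pos[of x] s_pos[of y] by (simp add: power_numeral_reduce algebra_simps)
    finally show ?thesis .
  qed
  have ts: "0 \<le> c \<and> f \<in> lX \<and> g \<in> lY" if "(c, f, g) \<in> set ?ts" for c f g
    using that nonneg t_d_bounds K11_nonneg K12_nonneg r_lX s_lY g(1) g0(1) h(1) h0(1) g_diff h_diff by auto
  show "remainder \<in> V" by (rule V_bound(1)[OF ts le])
  have "nV remainder \<le> (\<Sum>(c, f, g)\<leftarrow>?ts. 2 * c * nX f * nY g)"
    by (rule V_bound(2)[OF ts le])
  also have "\<dots> = 2 * M * (Q\<^sup>2 * nX (g - g0) * nY s + t * (K11 * nX g0 * nY s) + Q\<^sup>2 * nX r * nY (h - h0) +
      t * (K11 * nX r * nY h0) + t * (Q\<^sup>2 * nX g * nY h) + (t + d) * (K12 * nX r * nY s))"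
    by (simp add: algebra_simps)
  also have "\<dots> \<le> 2 * M * (Q\<^sup>2 * (t + d) * nY s + (t + d) * (K11 * N * nY s) + Q\<^sup>2 * nX r * (t + d) +
      (t + d) * (K11 * nX r * N) + (t + d) * (Q\<^sup>2 * N * N) + (t + d) * (K12 * nX r * nY s))"
    using nonneg t_d_bounds K11_nonneg K12_nonneg N_nonneg g(2) g0(2) h(2) h0(2) gd hd nX_nonneg nY_nonneg
    by (intro mult_left_mono add_mono mult_mono mult_right_mono order_refl) auto
  also have "\<dots> = K13 * (t + d)" by (simp add: K13_def algebra_simps)
  finally show "nV remainder \<le> K13 * (t + d)" .
qed

end

section \<open>The contingent cone of the probability vectors\<close>

text \<open>Truncating \<open>h\<close> to a large finite set and correcting the mass at one point gives a direction
  along which \<open>r\<close> can actually be moved.\<close>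

lemma feasible_direction_approx:
  fixes r h w :: "'a \<Rightarrow> real"
  assumes r: "r \<in> prob_vectors" "\<And>x. 0 < r x" "r \<in> l1_space w UNIV"
    and w: "\<And>x. 1 \<le> w x" and h: "h \<in> l1_space w UNIV" "infsum h UNIV = 0" and e: "0 < e"
  shows "\<exists>h' \<delta>. 0 < \<delta> \<and> l1_norm w UNIV (h' - h) < e \<and>
    (\<forall>t. 0 < t \<and> t \<le> \<delta> \<longrightarrow> r + t *\<^sub>R h' \<in> prob_vectors \<inter> l1_space w UNIV)"
proof -
  have w0: "0 \<le> w x" for x using w[of x] by linarith
  obtain x0 :: 'a where True by blast
  define f where "f z = w z * \<bar>h z\<bar>" for z
  have f: "f summable_on UNIV" and f0: "0 \<le> f z" for z
    using l1_spaceD[OF h(1)] w0 by (auto simp: f_def[abs_def])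
  \<comment> \<open>Half of \<open>e\<close> is shared between the tail of \<open>h\<close>, at most
    \<open>\<eta>\<close>, and the mass correction at \<open>x0\<close>, at most
    \<open>w x0 * \<eta>\<close>.\<close>
  define \<eta> where "\<eta> = (e / 2) / (1 + w x0)"
  have "0 < 1 + w x0" using w0[of x0] by linarith
  then have "\<eta> * (1 + w x0) = e / 2" "0 < \<eta>"
    using e by (metis \<eta>_def nonzero_eq_divide_eq less_irrefl, simp add: \<eta>_def)
  then have eta: "0 < \<eta>" "\<eta> * (1 + w x0) < e"
    using e by simp_all
  obtain F0 where F0: "finite F0" "dist (sum f F0) (infsum f UNIV) \<le> \<eta>"
    using has_sum_finite_approximation[OF has_sum_infsum[OF f] eta(1)] by blast
  define F where "F = insert x0 F0"
  have F: "finite F" "x0 \<in> F" "F \<noteq> {}" using F0 by (auto simp: F_def)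
  have split: "infsum k UNIV = sum k F + infsum k (- F)" if "k summable_on UNIV" for k :: "'a \<Rightarrow> real"
    using infsum_Un_disjoint[of k F "- F"] F(1) summable_on_UNIV_subset[OF that] by (simp add: Compl_partition)
  have tail: "infsum f (- F) \<le> \<eta>"
  proof -
    have "sum f F0 \<le> sum f F" using F(1) f0 by (intro sum_mono2) (auto simp: F_def)
    then show ?thesis using split[OF f] F0(2) by (simp add: dist_real_def abs_le_iff)
  qed
  have h_summ: "h summable_on UNIV" using l1_space_summable[OF h(1) w] by blast
  define m where "m = sum h F"
  have "m = - infsum h (- F)" using split[OF h_summ] h(2) by (simp add: m_def)
  moreover have "\<bar>infsum h (- F)\<bar> \<le> infsum f (- F)"
  proof (rule abs_infsum_le)
    show "f summable_on - F" by (rule summable_on_UNIV_subset[OF f])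
    show "\<bar>h z\<bar> \<le> f z" for z
      using mult_right_mono[OF w[of z], of "\<bar>h z\<bar>"] by (simp add: f_def)
  qed
  ultimately have m: "\<bar>m\<bar> \<le> \<eta>" using tail by linarith
  define h' where "h' z = (if z \<in> F then h z else 0) - (if z = x0 then m else 0)" for z
  have h'_out: "h' z = 0" if "z \<notin> F" for z using that F(2) by (auto simp: h'_def)
  have "(h' has_sum sum h' F) UNIV"
    by (rule has_sum_finite_neutralI[OF F(1)]) (auto simp: h'_out)
  moreover have "sum h' F = 0"
    using F by (simp add: h'_def sum_subtractf m_def)
  ultimately have h'_sum: "(h' has_sum 0) UNIV" by simp
  have h'_l1: "h' \<in> l1_space w UNIV"
  proof -
    have "((\<lambda>z. w z * \<bar>h' z\<bar>) has_sum (\<Sum>z\<in>F. w z * \<bar>h' z\<bar>)) UNIV"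
      by (rule has_sum_finite_neutralI[OF F(1)]) (auto simp: h'_out)
    then show ?thesis by (auto simp: l1_space_def summable_on_def)
  qed
  have norm: "l1_norm w UNIV (h' - h) < e"
  proof -
    have 1: "((\<lambda>z. if z \<in> F then 0 else f z) has_sum infsum f (- F)) UNIV"
    proof -
      have "(f has_sum infsum f (- F)) (- F) \<longleftrightarrow> ((\<lambda>z. if z \<in> F then 0 else f z) has_sum infsum f (- F)) UNIV"
        by (rule has_sum_cong_neutral) auto
      then show ?thesis using has_sum_infsum[OF summable_on_UNIV_subset[OF f]] by blast
    qed
    have 2: "((\<lambda>z. if z = x0 then w x0 * \<bar>m\<bar> else 0) has_sum w x0 * \<bar>m\<bar>) UNIV"
      by (rule has_sum_finite_neutralI[of "{x0}"]) auto
    have "l1_norm w UNIV (h' - h) \<le> infsum f (- F) + w x0 * \<bar>m\<bar>"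
    proof -
      have le: "w z * \<bar>(h' - h) z\<bar> \<le> (if z \<in> F then 0 else f z) + (if z = x0 then w x0 * \<bar>m\<bar> else 0)" for z
        using F(2) by (auto simp: h'_def f_def)
      have "(\<lambda>z. w z * \<bar>(h' - h) z\<bar>) summable_on UNIV"
        by (rule l1_spaceD[OF l1_space_diff[OF h'_l1 h(1) w0]])
      then show ?thesis
        unfolding l1_norm_def using has_sum_mono[OF has_sum_infsum has_sum_add[OF 1 2]] le by blast
    qed
    also have "\<dots> \<le> \<eta> + w x0 * \<eta>"
      using tail m w0[of x0] by (intro add_mono mult_left_mono) auto
    also have "\<dots> < e" using eta(2) by (simp add: algebra_simps)
    finally show ?thesis .
  qed
  \<comment> \<open>Only the entries in the finite set \<open>F\<close> move, and each tolerates
    steps up to \<open>r z / (\<bar>h' z\<bar> + 1)\<close> without becoming negative; the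
    \<open>1\<close> covers entries with \<open>h' z = 0\<close>.\<close>
  define \<delta> where "\<delta> = Min ((\<lambda>z. r z / (\<bar>h' z\<bar> + 1)) ` F)"
  have delta: "0 < \<delta>" unfolding \<delta>_def
    using F r(2) by (subst Min_gr_iff) (auto intro!: divide_pos_pos add_nonneg_pos)
  have "r + t *\<^sub>R h' \<in> prob_vectors \<inter> l1_space w UNIV" if t: "0 < t" "t \<le> \<delta>" for t
  proof
    show "r + t *\<^sub>R h' \<in> l1_space w UNIV"
      by (rule l1_space_add(1)[OF r(3) l1_space_scaleR(1)[OF h'_l1] w0])
    have "0 \<le> r z + t * h' z" for z
    proof (cases "z \<in> F")
      case True
      have "t \<le> r z / (\<bar>h' z\<bar> + 1)"
        using t(2) F(1) True unfolding \<delta>_def by (meson Min_le finite_imageI image_eqI order_trans)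
      then have "t * (\<bar>h' z\<bar> + 1) \<le> r z" by (simp add: pos_le_divide_eq add_nonneg_pos)
      then have "t * \<bar>h' z\<bar> \<le> r z" using t(1) by (simp add: distrib_left)
      moreover have "- (t * \<bar>h' z\<bar>) \<le> t * h' z"
        using mult_left_mono[of "- \<bar>h' z\<bar>" "h' z" t] t(1) by simp
      ultimately show ?thesis by linarith
    qed (simp add: h'_out less_imp_le[OF r(2)])
    moreover have "((\<lambda>z. r z + t * h' z) has_sum 1 + t * 0) UNIV"
      using r(1) by (intro has_sum_add has_sum_cmult_right h'_sum) (simp add: prob_vectors_def)
    ultimately show "r + t *\<^sub>R h' \<in> prob_vectors"
      by (simp add: prob_vectors_def scaleR_fun_def plus_fun_def)
  qed
  with delta norm show ?thesis by blast
qed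

text \<open>Summation is continuous in the weighted norm, so difference quotients of probability
  vectors have limits of mean zero. Conversely, the \<open>n\<close>-th approximating direction has
  error below \<open>1 / real (Suc n)\<close> in each component, and its step is cut to a length at
  which both marginals remain probability vectors.\<close>

lemma contingent_cone_prob_vectors:
  fixes r wX :: "'x \<Rightarrow> real" and s wY :: "'y \<Rightarrow> real"
  defines "U \<equiv> l1_space wX UNIV \<times> l1_space wY UNIV"
    and "nU \<equiv> (\<lambda>(hX, hY). l1_norm wX UNIV hX + l1_norm wY UNIV hY)"
    and "U0 \<equiv> (prob_vectors \<inter> l1_space wX UNIV) \<times> (prob_vectors \<inter> l1_space wY UNIV)"
  assumes r: "r \<in> prob_vectors" "\<And>x. 0 < r x" "r \<in> l1_space wX UNIV"
    and s: "s \<in> prob_vectors" "\<And>y. 0 < s y" "s \<in> l1_space wY UNIV"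
    and wX: "\<And>x. 1 \<le> wX x" and wY: "\<And>y. 1 \<le> wY y"
  shows "contingent_cone U nU U0 (r, s) =
    {hX \<in> l1_space wX UNIV. infsum hX UNIV = 0} \<times> {hY \<in> l1_space wY UNIV. infsum hY UNIV = 0}"
    (is "_ = ?C")
proof
  have w0: "0 \<le> wX x" "0 \<le> wY y" for x y
    using wX[of x] wY[of y] by linarith+
  have zero: "infsum h UNIV = 0"
    if lim: "e \<longlonglongrightarrow> 0" and h: "h \<in> l1_space w UNIV" and w: "\<And>z. 1 \<le> w z"
      and r: "r \<in> prob_vectors" "r \<in> l1_space w UNIV"
      and k: "\<And>n. k n \<in> prob_vectors \<inter> l1_space w UNIV"
      and le: "\<And>n. l1_norm w UNIV ((1 / t n) *\<^sub>R (k n - r) - h) \<le> e n"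
    for h r w :: "'z \<Rightarrow> real" and k :: "nat \<Rightarrow> 'z \<Rightarrow> real" and e t :: "nat \<Rightarrow> real"
  proof -
    have w0: "0 \<le> w z" for z using w[of z] by linarith
    have "\<bar>infsum h UNIV\<bar> \<le> e n" for n
    proof -
      have "((\<lambda>z. (1 / t n) * (k n z - r z)) has_sum (1 / t n) * (1 - 1)) UNIV"
        using k[of n] r by (intro has_sum_cmult_right has_sum_diff) (auto simp: prob_vectors_def)
      moreover have "h summable_on UNIV" using l1_space_summable[OF h w] by blast
      ultimately have "((\<lambda>z. (1 / t n) * (k n z - r z) - h z) has_sum 0 - infsum h UNIV) UNIV"
        by (intro has_sum_diff has_sum_infsum) simp_all
      then have "infsum ((1 / t n) *\<^sub>R (k n - r) - h) UNIV = - infsum h UNIV"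
        by (intro infsumI) (simp add: scaleR_fun_def fun_diff_def)
      moreover have "(1 / t n) *\<^sub>R (k n - r) - h \<in> l1_space w UNIV"
        using k[of n] r by (intro l1_space_diff l1_space_scaleR h w0) auto
      ultimately show ?thesis
        using l1_space_summable(2)[of "(1 / t n) *\<^sub>R (k n - r) - h" w] w le[of n] by simp
    qed
    then have "\<bar>infsum h UNIV\<bar> \<le> 0" by (intro LIMSEQ_le_const[OF lim]) auto
    then show ?thesis by simp
  qed
  show "contingent_cone U nU U0 (r, s) \<subseteq> ?C"
  proof
    fix z assume "z \<in> contingent_cone U nU U0 (r, s)"
    then obtain t k where zU: "z \<in> U" and k: "\<And>n. k n \<in> U0"
      and lim: "(\<lambda>n::nat. nU ((1 / t n) *\<^sub>R (k n - (r, s)) - z)) \<longlonglongrightarrow> 0"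
      unfolding contingent_cone_def by blast
    obtain hX hY where z: "z = (hX, hY)" by (cases z)
    with zU have h: "hX \<in> l1_space wX UNIV" "hY \<in> l1_space wY UNIV" by (simp_all add: U_def)
    have kk: "fst (k n) \<in> prob_vectors \<inter> l1_space wX UNIV" "snd (k n) \<in> prob_vectors \<inter> l1_space wY UNIV" for n
      using k[of n] by (auto simp: U0_def)
    have n_eq: "nU ((1 / t n) *\<^sub>R (k n - (r, s)) - z) =
        l1_norm wX UNIV ((1 / t n) *\<^sub>R (fst (k n) - r) - hX) + l1_norm wY UNIV ((1 / t n) *\<^sub>R (snd (k n) - s) - hY)" for n
      by (cases "k n") (simp add: nU_def z)
    have le: "l1_norm wX UNIV ((1 / t n) *\<^sub>R (fst (k n) - r) - hX) \<le> nU ((1 / t n) *\<^sub>R (k n - (r, s)) - z)"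
      "l1_norm wY UNIV ((1 / t n) *\<^sub>R (snd (k n) - s) - hY) \<le> nU ((1 / t n) *\<^sub>R (k n - (r, s)) - z)" for n
      unfolding n_eq le_add_same_cancel1 le_add_same_cancel2 by (intro l1_norm_nonneg w0)+
    have "infsum hX UNIV = 0" by (rule zero[OF lim h(1) wX r(1,3) kk(1) le(1)])
    moreover have "infsum hY UNIV = 0" by (rule zero[OF lim h(2) wY s(1,3) kk(2) le(2)])
    ultimately show "z \<in> ?C" using h z by simp
  qed
  show "?C \<subseteq> contingent_cone U nU U0 (r, s)"
  proof
    fix z assume "z \<in> ?C"
    then obtain hX hY where z: "z = (hX, hY)" and hX: "hX \<in> l1_space wX UNIV" "infsum hX UNIV = 0"
      and hY: "hY \<in> l1_space wY UNIV" "infsum hY UNIV = 0" by auto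
    have "\<forall>n::nat. \<exists>h' \<delta>. 0 < \<delta> \<and> l1_norm wX UNIV (h' - hX) < 1 / real (Suc n) \<and>
      (\<forall>t. 0 < t \<and> t \<le> \<delta> \<longrightarrow> r + t *\<^sub>R h' \<in> prob_vectors \<inter> l1_space wX UNIV)"
      by (intro allI feasible_direction_approx r wX hX) simp
    then obtain fX dX where X: "\<And>n. 0 < dX n" "\<And>n. l1_norm wX UNIV (fX n - hX) < 1 / real (Suc n)"
      "\<And>n t. 0 < t \<Longrightarrow> t \<le> dX n \<Longrightarrow> r + t *\<^sub>R fX n \<in> prob_vectors \<inter> l1_space wX UNIV"
      by metis
    have "\<forall>n::nat. \<exists>h' \<delta>. 0 < \<delta> \<and> l1_norm wY UNIV (h' - hY) < 1 / real (Suc n) \<and>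
      (\<forall>t. 0 < t \<and> t \<le> \<delta> \<longrightarrow> s + t *\<^sub>R h' \<in> prob_vectors \<inter> l1_space wY UNIV)"
      by (intro allI feasible_direction_approx s wY hY) simp
    then obtain fY dY where Y: "\<And>n. 0 < dY n" "\<And>n. l1_norm wY UNIV (fY n - hY) < 1 / real (Suc n)"
      "\<And>n t. 0 < t \<Longrightarrow> t \<le> dY n \<Longrightarrow> s + t *\<^sub>R fY n \<in> prob_vectors \<inter> l1_space wY UNIV"
      by metis
    define t where "t n = min (1 / real (Suc n)) (min (dX n) (dY n))" for n
    have t: "0 < t n" "t n \<le> dX n" "t n \<le> dY n" "t n \<le> 1 / real (Suc n)" for n
      using X(1)[of n] Y(1)[of n] by (auto simp: t_def)
    define k where "k n = (r + t n *\<^sub>R fX n, s + t n *\<^sub>R fY n)" for n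
    have "k n \<in> U0" for n
      unfolding k_def U0_def using X(3)[OF t(1,2)] Y(3)[OF t(1,3)] by auto
    moreover have lim0: "(\<lambda>n. 1 / real (Suc n)) \<longlonglongrightarrow> 0"
      by (rule LIMSEQ_Suc[OF lim_1_over_n])
    then have "t \<longlonglongrightarrow> 0"
      by (rule tendsto_sandwich[OF always_eventually always_eventually tendsto_const, rotated 2])
        (use t in \<open>auto simp: less_imp_le\<close>)
    moreover have "(\<lambda>n. nU ((1 / t n) *\<^sub>R (k n - (r, s)) - z)) \<longlonglongrightarrow> 0"
    proof (rule tendsto_sandwich[OF always_eventually always_eventually tendsto_const])
      have eq: "nU ((1 / t n) *\<^sub>R (k n - (r, s)) - z) = l1_norm wX UNIV (fX n - hX) + l1_norm wY UNIV (fY n - hY)" for n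
        using t(1)[of n] by (simp add: k_def nU_def z)
      show "\<forall>n. 0 \<le> nU ((1 / t n) *\<^sub>R (k n - (r, s)) - z)"
        unfolding eq by (intro allI add_nonneg_nonneg l1_norm_nonneg w0)
      show "\<forall>n. nU ((1 / t n) *\<^sub>R (k n - (r, s)) - z) \<le> 1 / real (Suc n) + 1 / real (Suc n)"
        unfolding eq using X(2) Y(2) by (intro allI add_mono less_imp_le) auto
      show "(\<lambda>n. 1 / real (Suc n) + 1 / real (Suc n)) \<longlonglongrightarrow> 0"
        using tendsto_add[OF lim0 lim0] by simp
    qed
    ultimately show "z \<in> contingent_cone U nU U0 (r, s)"
      unfolding contingent_cone_def using t(1) hX hY z by (auto simp: U_def)
  qed
qed

text \<open>The contingent cone is a product of two such spaces and hence equals its linear hull,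
  the domain on which the derivative has to be linear.\<close>

lemma subspace_mean_zero:
  fixes w :: "'a \<Rightarrow> real"
  assumes w: "\<And>z. 1 \<le> w z"
  shows "subspace {h \<in> l1_space w UNIV. infsum h UNIV = 0}"
proof (rule subspaceI)
  have w0: "0 \<le> w z" for z using w[of z] by linarith
  show "0 \<in> {h \<in> l1_space w UNIV. infsum h UNIV = 0}"
    by (simp add: l1_space_def zero_fun_def)
  fix x y assume xy: "x \<in> {h \<in> l1_space w UNIV. infsum h UNIV = 0}"
  show "a *\<^sub>R x \<in> {h \<in> l1_space w UNIV. infsum h UNIV = 0}" for a
    using xy l1_space_scaleR(1)[of x w a] by (simp add: scaleR_fun_def infsum_cmult_right')
  assume y: "y \<in> {h \<in> l1_space w UNIV. infsum h UNIV = 0}"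
  have "x summable_on UNIV" "y summable_on UNIV"
    using xy y by (auto intro: l1_space_summable(1)[where w = w] w)
  from infsum_add[OF this] have "infsum (\<lambda>z. x z + y z) UNIV = 0"
    using xy y by simp
  then show "x + y \<in> {h \<in> l1_space w UNIV. infsum h UNIV = 0}"
    using xy y l1_space_add(1)[of x w y, OF _ _ w0] by (simp add: plus_fun_def)
qed

section \<open>Linearity of the derivative and its two representations\<close>

context gibbs_density
begin

text \<open>Linearity is inherited from the equations through uniqueness of their solution, without
  inspecting the inverse of \<open>IX\<close>.\<close>

lemma solution_axpy:
  assumes h: "hX \<in> lX" "hY \<in> lY" and k: "kX \<in> lX" "kY \<in> lY"
  shows "solA (hX + c *\<^sub>R kX) (hY + c *\<^sub>R kY) = (\<lambda>x. solA hX hY x + c * solA kX kY x)"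
    "solB (hX + c *\<^sub>R kX) (hY + c *\<^sub>R kY) = (\<lambda>y. solB hX hY y + c * solB kX kY y)"
proof -
  have w0: "0 \<le> CX x" "0 \<le> Phi4 y" for x y
    using CX_ge[of x] Phi4_ge[of y] by linarith+
  have hk: "hX + c *\<^sub>R kX \<in> lX" "hY + c *\<^sub>R kY \<in> lY"
    by (intro l1_space_add(1) l1_space_scaleR(1) h k w0)+
  note sh = solution[OF h] and sk = solution[OF k]
  have BX: "BX (hY + c *\<^sub>R kY) x = BX hY x + c * BX kY x" for x
  proof -
    have "(\<lambda>y. p x y * hY y) summable_on UNIV" "(\<lambda>y. p x y * kY y) summable_on UNIV"
      using lY_pairing(1)[OF h(2), of "\<lambda>_. 1" 1 x] lY_pairing(1)[OF k(2), of "\<lambda>_. 1" 1 x] phi_pow(1) by simp_all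
    from infsum_add[OF this(1) summable_on_cmult_right[OF this(2), of c]] show ?thesis
      by (simp add: BX_eq scaleR_fun_def infsum_cmult_right' distrib_left mult_ac)
  qed
  have BY: "BY (hX + c *\<^sub>R kX) y = BY hX y + c * BY kX y" for y
  proof -
    have "(\<lambda>x. p x y * hX x) summable_on UNIV" "(\<lambda>x. p x y * kX x) summable_on UNIV"
      using lX_pairing(1)[OF h(1), of "\<lambda>_. 1" 1 y] lX_pairing(1)[OF k(1), of "\<lambda>_. 1" 1 y] by simp_all
    from infsum_add[OF this(1) summable_on_cmult_right[OF this(2), of c]] show ?thesis
      by (simp add: BY_eq omit_def scaleR_fun_def infsum_cmult_right' distrib_left mult_ac)
  qed
  have 1: "(\<lambda>x. solA hX hY x + c * solA kX kY x) x + AX (\<lambda>y. solB hX hY y + c * solB kX kY y) x =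
      BX (hY + c *\<^sub>R kY) x" for x
    unfolding BX AX_axpy[OF sh(2) sk(2)] sh(3)[symmetric] sk(3)[symmetric] by (simp add: algebra_simps)
  have 2: "(\<lambda>y. solB hX hY y + c * solB kX kY y) y + AY (\<lambda>x. solA hX hY x + c * solA kX kY x) y =
      BY (hX + c *\<^sub>R kX) y" for y
    unfolding BY AY_axpy[OF sh(1) sk(1)] sh(4)[symmetric] sk(4)[symmetric] by (simp add: algebra_simps)
  note * = solution_unique[OF hk LX_axpy[OF sh(1) sk(1)] LY_axpy[OF sh(2) sk(2)] 1 2]
  show "solA (hX + c *\<^sub>R kX) (hY + c *\<^sub>R kY) = (\<lambda>x. solA hX hY x + c * solA kX kY x)"
    "solB (hX + c *\<^sub>R kX) (hY + c *\<^sub>R kY) = (\<lambda>y. solB hX hY y + c * solB kX kY y)"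
    using * by simp_all
qed

lemma deriv_plan_axpy:
  assumes h: "hX \<in> lX" "hY \<in> lY" and k: "kX \<in> lX" "kY \<in> lY"
  shows "deriv_plan (hX + c *\<^sub>R kX) (hY + c *\<^sub>R kY) = deriv_plan hX hY + c *\<^sub>R deriv_plan kX kY"
  unfolding deriv_plan_def solution_axpy[OF assms]
  by (simp add: tangent_def fun_eq_iff scaleR_fun_def algebra_simps)

lemma deriv_plan_linear:
  assumes h: "hX \<in> lX" "hY \<in> lY" and k: "kX \<in> lX" "kY \<in> lY"
  shows "deriv_plan (hX + kX) (hY + kY) = deriv_plan hX hY + deriv_plan kX kY"
    "deriv_plan (c *\<^sub>R hX) (c *\<^sub>R hY) = c *\<^sub>R deriv_plan hX hY"
proof -
  show "deriv_plan (hX + kX) (hY + kY) = deriv_plan hX hY + deriv_plan kX kY"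
    using deriv_plan_axpy[OF assms, of 1] by simp
  have z: "0 \<in> lX" "0 \<in> lY" by (simp_all add: l1_space_def zero_fun_def)
  have "deriv_plan 0 0 = 0"
    using deriv_plan_axpy[OF z z, of "-1"] by simp
  then show "deriv_plan (c *\<^sub>R hX) (c *\<^sub>R hY) = c *\<^sub>R deriv_plan hX hY"
    using deriv_plan_axpy[OF z h, of c] by simp
qed

lemma D_vars_unique_solution:
  assumes h: "hX \<in> lX" "hY \<in> lY" "infsum hY UNIV = 0" and lam: "lam > 0"
  shows "w \<in> V \<times> LX \<times> LY \<and> D_vars lam y1 plan w = D_data y1 plan r s (hX, omit y1 hY) \<longleftrightarrow>
    w = (- deriv_plan hX hY, lam *\<^sub>R solA hX hY, lam *\<^sub>R solB hX hY)"
proof -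
  have "deriv_plan hX hY \<in> V"
    using deriv_plan_bound h by blast
  then have V: "- deriv_plan hX hY \<in> V"
    using l1_space_scaleR(1)[of "deriv_plan hX hY" _ "-1"] by simp
  have z: "(\<lambda>_. 0) \<in> LX" "(\<lambda>_. 0) \<in> LY" by (auto intro: LXI[of _ 0] LYI[of _ 0])
  have "lam *\<^sub>R solA hX hY \<in> LX" "lam *\<^sub>R solB hX hY \<in> LY"
    using LX_axpy[OF z(1) solution(1)[OF h(1,2)], of lam] LY_axpy[OF z(2) solution(2)[OF h(1,2)], of lam]
    by (simp_all add: scaleR_fun_def)
  with V show ?thesis
    using D_vars_iff[OF h _ _ lam] by (cases w) auto
qed

lemma D_vars_inv_pi_eq:
  assumes h: "hX \<in> lX" "hY \<in> lY" "infsum hY UNIV = 0" and lam: "lam > 0"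
  shows "D_vars_inv_pi (V \<times> LX \<times> LY) lam y1 plan (D_data y1 plan r s (hX, omit y1 hY)) = - deriv_plan hX hY"
  unfolding D_vars_inv_pi_def D_vars_unique_solution[OF assms] by simp

lemma deriv_plan_eq_block:
  assumes h: "hX \<in> lX" "hY \<in> lY"
  shows "(\<lambda>z. plan z / (r \<otimes>\<^sub>t s) z) * (r \<otimes>\<^sub>t hY + hX \<otimes>\<^sub>t s) -
    plan * A_star_T y1 (block_op (inv_into LX IX) (\<lambda>v. - inv_into LX IX (AX v))
      (\<lambda>u. - AY (inv_into LX IX u)) (inv_into LY IY) (block_op (\<lambda>_. 0) BX BY (\<lambda>_. 0) (hX, hY))) =
    deriv_plan hX hY"
proof -
  have b1: "solB hX hY y1 = 0"
    using solution(2)[OF h] by (simp add: LY_iff)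
  have plan_rs: "plan (x, y) / (r \<otimes>\<^sub>t s) (x, y) = p x y" for x y
    using r_pos[of x] s_pos[of y] by (simp add: plan_def tensor_def)
  have "((\<lambda>z. plan z / (r \<otimes>\<^sub>t s) z) * (r \<otimes>\<^sub>t hY + hX \<otimes>\<^sub>t s)) (x, y) =
      p x y * (r x * hY y + hX x * s y)" for x y
    unfolding times_fun_apply plan_rs by (simp add: tensor_def)
  moreover have "(plan * A_star_T y1 (solA hX hY, solB hX hY)) (x, y) =
      plan (x, y) * (solA hX hY x + solB hX hY y)" for x y
    by (simp add: A_star_T_def b1)
  ultimately show ?thesis
    unfolding block_solution[OF h] fun_eq_iff split_paired_All minus_apply
    by (simp add: deriv_plan_def tangent_def)
qed

text \<open>The order of the quantifiers is the point: \<open>C\<close> precedes \<open>t\<close>,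
  \<open>d\<close>, the directions and the ratios, so one constant serves a whole sequence of
  perturbations.\<close>

lemma remainder_uniform:
  "\<exists>C. \<forall>t g g0 u h h0 v d. perturbed_density p r s phi CY CX y1 M \<theta> t g g0 u h h0 v Q N d \<longrightarrow>
    nV ((1 / t) *\<^sub>R ((\<lambda>(x, y). p x y * u x * v y * (r x + t * g x) * (s y + t * h y)) - plan) -
      deriv_plan g0 h0) \<le> C * (t + d)"
proof (intro exI allI impI)
  fix t g g0 u h h0 v d
  assume "perturbed_density p r s phi CY CX y1 M \<theta> t g g0 u h h0 v Q N d"
  from perturbed_density.remainder_bound(2)[OF this,
      unfolded perturbed_density.remainder_def[OF this] perturbed_density.plan'_def[OF this]]
  show "nV ((1 / t) *\<^sub>R ((\<lambda>(x, y). p x y * u x * v y * (r x + t * g x) * (s y + t * h y)) - plan) -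
      deriv_plan g0 h0) \<le> perturbed_density.K13 r s phi CY CX M \<theta> Q N * (t + d)" .
qed

end

section \<open>Dominated costs\<close>

locale dominated_cost =
  fixes c :: "'x \<times> 'y \<Rightarrow> real" and cXm cXp :: "'x \<Rightarrow> real" and cYm cYp :: "'y \<Rightarrow> real" and lam B :: real
  assumes lam: "0 < lam" and dom: "dominating c cXm cXp cYm cYp"
    and B: "\<And>x. cXp x - cXm x \<le> B" and B_nonneg: "0 \<le> B"
begin

abbreviation "wX \<equiv> cost_weight cXm cXp"
abbreviation "wY \<equiv> cost_weight cYm cYp"
abbreviation "phiY \<equiv> exp_weight lam cYm cYp"
abbreviation "PhiY \<equiv> (\<lambda>y. wY y * phiY y ^ 4)"

definition "K = exp (B / lam)"
text \<open>Subtracting the lower dominating functions makes the kernel at most \<open>1\<close> and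
  merely shifts the potentials. \<open>K\<close> then bounds
  \<open>exp ((cXp x - cXm x) / lam)\<close> for all \<open>x\<close>, so the lower bound of the
  kernel depends on \<open>y\<close> only.\<close>

definition "kern x y = exp (- (c (x, y) - cXm x - cYm y) / lam)"
definition "gibbs a b r s = (\<lambda>(x, y). kern x y * a x * b y * r x * s y)"

lemma dom_le:
  "cXm x \<le> cXp x" "cYm y \<le> cYp y" "cXm x + cYm y \<le> c (x, y)" "c (x, y) \<le> cXp x + cYp y"
  using dom by (auto simp: dominating_def)

lemma wX_ge: "1 \<le> wX x" and wY_ge: "1 \<le> wY y"
  by (auto simp: cost_weight_def)

lemma phiY_ge: "1 \<le> phiY y"
  using dom_le(2)[of y] lam by (simp add: exp_weight_def)

lemma phiY_pow_le: "i \<le> 4 \<Longrightarrow> phiY y ^ i \<le> phiY y ^ 4"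
  using phiY_ge[of y] by (rule power_increasing[rotated])

lemma PhiY_ge: "wY y \<le> PhiY y" "phiY y \<le> PhiY y" "1 \<le> PhiY y"
proof -
  have 1: "1 \<le> phiY y ^ 4" "phiY y \<le> phiY y ^ 4"
    using phiY_pow_le[of 0 y] phiY_pow_le[of 1 y] by auto
  show "wY y \<le> PhiY y"
    using mult_left_mono[OF 1(1), of "wY y"] wY_ge[of y] by simp
  with wY_ge[of y] show "1 \<le> PhiY y" by linarith
  show "phiY y \<le> PhiY y"
    using mult_mono[OF wY_ge[of y] 1(2)] wY_ge[of y] phiY_ge[of y] by simp
qed

lemma K_ge: "1 \<le> K"
  using lam B_nonneg by (simp add: K_def)

lemma kernel_marginalsI:
  assumes r: "r \<in> prob_vectors" and s: "s \<in> prob_vectors" "s \<in> l1_space PhiY UNIV" "0 < s y0"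
  shows "kernel_marginals kern phiY K r s y0"
proof
  show "1 \<le> K" "r \<in> prob_vectors" "s \<in> prob_vectors" "0 < s y0" using K_ge r s by auto
  show "1 \<le> phiY y" for y by (rule phiY_ge)
  show "kern x y \<le> 1" for x y
    using dom_le(3)[of x y] lam by (simp add: kern_def divide_nonpos_pos)
  show "1 \<le> K * phiY y * kern x y" for x y
  proof -
    have "0 \<le> B / lam + (cYp y - cYm y) / lam + - (c (x, y) - cXm x - cYm y) / lam"
    proof -
      have "B / lam + (cYp y - cYm y) / lam + - (c (x, y) - cXm x - cYm y) / lam =
          (B + cXm x + cYp y - c (x, y)) / lam"
        by (simp flip: add_divide_distrib)
      then show ?thesis using dom_le(4)[of x y] B[of x] lam by simp
    qed
    then show ?thesis
      unfolding K_def kern_def exp_weight_def exp_add[symmetric] by simp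
  qed
  show "(\<lambda>y. phiY y * s y) summable_on UNIV"
  proof (rule summable_on_abs_le[OF l1_spaceD[OF s(2)]])
    show "\<bar>phiY y * s y\<bar> \<le> PhiY y * \<bar>s y\<bar>" for y
      using mult_right_mono[OF PhiY_ge(2)[of y], of "\<bar>s y\<bar>"] phiY_ge[of y] by (simp add: abs_mult)
  qed
qed

lemma gibbs_coupling:
  assumes "schroedinger_pair kern r s y0 a b"
    and r: "r \<in> prob_vectors" and s: "s \<in> prob_vectors"
  shows "gibbs a b r s \<in> couplings r s"
proof -
  have pos: "0 < a x" "0 < b y" and row: "((\<lambda>y. kern x y * b y * s y) has_sum 1 / a x) UNIV"
    and col: "((\<lambda>x. kern x y * a x * r x) has_sum 1 / b y) UNIV" for x y
    using assms(1) by (auto simp: schroedinger_pair_def)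
  show ?thesis
    unfolding couplings_def
  proof (intro CollectI conjI allI)
    show "0 \<le> gibbs a b r s z" for z
      using pos prob_vectorsD(1)[OF r] prob_vectorsD(1)[OF s]
      by (auto simp: gibbs_def kern_def case_prod_unfold less_imp_le)
    show "((\<lambda>y. gibbs a b r s (x, y)) has_sum r x) UNIV" for x
      using has_sum_cmult_right[OF row[of x], of "a x * r x"] pos(1)[of x]
      by (simp add: gibbs_def mult_ac)
    show "((\<lambda>x. gibbs a b r s (x, y)) has_sum s y) UNIV" for y
      using has_sum_cmult_right[OF col[of y], of "b y * s y"] pos(2)[of y]
      by (simp add: gibbs_def mult_ac)
  qed
qed

lemma abs_ln_le:
  fixes lo z hi :: real
  assumes "0 < lo" "lo \<le> z" "z \<le> hi"
  shows "\<bar>ln z\<bar> \<le> \<bar>ln lo\<bar> + \<bar>ln hi\<bar>"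
proof -
  have "ln lo \<le> ln z" "ln z \<le> ln hi" using assms by auto
  then show ?thesis by linarith
qed

text \<open>The point is integrability of the potentials \<open>cXm + lam ln a\<close> and
  \<open>cYm + lam ln b\<close>. The scaling \<open>b\<close> may grow like \<open>phiY\<close>, but
  its logarithm then grows only like \<open>(cYp - cYm) / lam\<close>, which the weight
  \<open>wY\<close> controls.\<close>

lemma is_erot_plan_iff:
  assumes ab: "schroedinger_pair kern r s y0 a b"
    and r: "r \<in> prob_vectors" "r \<in> l1_space wX UNIV"
    and s: "s \<in> prob_vectors" "s \<in> l1_space PhiY UNIV" "0 < s y0"
  shows "is_erot_plan lam c r s q \<longleftrightarrow> q = gibbs a b r s"
proof -
  interpret km: kernel_marginals kern phiY K r s y0 by (rule kernel_marginalsI[OF r(1) s])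
  have pos: "0 < a x" "0 < b y" for x y
    using ab by (auto simp: schroedinger_pair_def)
  note bounds = km.schroedinger_pair_bounds[OF ab]
  define La where "La = \<bar>ln (1 / (K * km.S))\<bar> + \<bar>ln (K * phiY y0 / s y0)\<bar>"
  have La: "\<bar>ln (a x)\<bar> \<le> La" for x
    unfolding La_def using K_ge km.S_ge by (intro abs_ln_le bounds) simp
  define Lb where "Lb = \<bar>ln (1 / (K * phiY y0))\<bar> + ln K"
  have Lb: "\<bar>ln (b y)\<bar> \<le> Lb + ln (phiY y)" for y
  proof -
    have "\<bar>ln (b y)\<bar> \<le> \<bar>ln (1 / (K * phiY y0))\<bar> + \<bar>ln (K * phiY y)\<bar>"
      using km.Kphi_pos[of y0] by (intro abs_ln_le bounds) simp
    also have "ln (K * phiY y) = ln K + ln (phiY y)"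
      using K_ge phiY_ge[of y] by (intro ln_mult_pos) auto
    also have "\<bar>ln K + ln (phiY y)\<bar> = ln K + ln (phiY y)"
      using K_ge phiY_ge[of y] by simp
    finally show ?thesis by (simp add: Lb_def)
  qed
  have nn: "0 \<le> La" "0 \<le> Lb"
    using K_ge by (auto simp: La_def Lb_def)
  define A where "A x = cXm x + lam * ln (a x)" for x
  define D where "D y = cYm y + lam * ln (b y)" for y
  have A: "\<bar>A x\<bar> \<le> (1 + lam * La) * wX x" for x
  proof -
    have "\<bar>A x\<bar> \<le> \<bar>cXm x\<bar> + lam * La"
      unfolding A_def using lam mult_left_mono[OF La[of x], of lam]
      by (intro order_trans[OF abs_triangle_ineq]) (simp add: abs_mult)
    also have "\<dots> \<le> wX x + lam * La * wX x"
      using mult_left_mono[OF wX_ge[of x], of "lam * La"] lam nn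
      by (intro add_mono) (auto simp: cost_weight_def)
    finally show ?thesis by (simp add: distrib_right)
  qed
  have D: "\<bar>D y\<bar> \<le> (3 + lam * Lb) * PhiY y" for y
  proof -
    have "lam * ln (phiY y) = cYp y - cYm y"
      using lam by (simp add: exp_weight_def)
    moreover have "lam * \<bar>ln (b y)\<bar> \<le> lam * Lb + lam * ln (phiY y)"
      using mult_left_mono[OF Lb[of y], of lam] lam by (simp add: distrib_left)
    ultimately have "\<bar>D y\<bar> \<le> \<bar>cYm y\<bar> + (lam * Lb + (cYp y - cYm y))"
      unfolding D_def using lam by (intro order_trans[OF abs_triangle_ineq]) (simp add: abs_mult)
    also have "\<dots> \<le> 3 * wY y + lam * Lb * wY y"
    proof -
      have "lam * Lb * 1 \<le> lam * Lb * wY y"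
        using lam nn by (intro mult_left_mono wY_ge) auto
      moreover have "\<bar>cYm y\<bar> + (cYp y - cYm y) \<le> 3 * wY y"
        by (simp add: cost_weight_def)
      ultimately show ?thesis by linarith
    qed
    also have "\<dots> = (3 + lam * Lb) * wY y" by (simp add: distrib_right)
    also have "\<dots> \<le> (3 + lam * Lb) * PhiY y"
      using PhiY_ge(1)[of y] lam nn by (intro mult_left_mono) auto
    finally show ?thesis .
  qed
  have summX: "(\<lambda>x. \<bar>f x\<bar> * r x) summable_on UNIV" if "\<And>x. \<bar>f x\<bar> \<le> C * wX x" for f C
    using l1_pairing(1)[of r wX "\<lambda>x. \<bar>f x\<bar>" C] r(2) that by simp
  have summY: "(\<lambda>y. \<bar>f y\<bar> * s y) summable_on UNIV" if "\<And>y. \<bar>f y\<bar> \<le> C * PhiY y" for f C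
    using l1_pairing(1)[of s PhiY "\<lambda>y. \<bar>f y\<bar>" C] s(2) that by simp
  show ?thesis
  proof (rule gibbs_plan_unique[OF lam gibbs_coupling[OF ab r(1) s(1)], where A = A and B = D and CX = wX and CY = wY])
    fix x y assume rs: "0 < r x" "0 < s y"
    have "gibbs a b r s (x, y) / (r x * s y) = kern x y * (a x * b y)"
      using rs by (simp add: gibbs_def)
    moreover have "ln (kern x y * (a x * b y)) = - (c (x, y) - cXm x - cYm y) / lam + (ln (a x) + ln (b y))"
      using pos(1)[of x] pos(2)[of y] km.k_pos[of x y] by (simp add: ln_mult_pos) (simp add: kern_def)
    ultimately have "c (x, y) + lam * ln (gibbs a b r s (x, y) / (r x * s y)) = A x + D y"
      using lam by (simp add: A_def D_def field_simps)
    moreover have "0 < gibbs a b r s (x, y)"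
      using rs pos(1)[of x] pos(2)[of y] km.k_pos[of x y] by (simp add: gibbs_def)
    ultimately show "0 < gibbs a b r s (x, y) \<and>
        c (x, y) + lam * ln (gibbs a b r s (x, y) / (r x * s y)) = A x + D y" by blast
  next
    show "(\<lambda>x. \<bar>A x\<bar> * r x) summable_on UNIV" by (rule summX[OF A])
    show "(\<lambda>y. \<bar>D y\<bar> * s y) summable_on UNIV" by (rule summY[OF D])
    show "(\<lambda>x. \<bar>wX x\<bar> * r x) summable_on UNIV"
      by (rule summX[of _ 1]) (simp add: cost_weight_def)
    show "(\<lambda>y. \<bar>wY y\<bar> * s y) summable_on UNIV"
      by (rule summY[of _ 1]) (use PhiY_ge(1) wY_ge in \<open>simp add: abs_of_nonneg order_trans[OF zero_le_one]\<close>)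
    show "\<bar>c (x, y)\<bar> \<le> wX x + wY y" for x y
      using dom_le(3,4)[of x y] by (auto simp: cost_weight_def)
    show "r summable_on UNIV" by (rule km.r_prob)
  qed
qed

lemma erot_plan_eq:
  assumes "schroedinger_pair kern r s y0 a b"
    "r \<in> prob_vectors" "r \<in> l1_space wX UNIV"
    "s \<in> prob_vectors" "s \<in> l1_space PhiY UNIV" "0 < s y0"
  shows "erot_plan lam c r s = gibbs a b r s"
  unfolding erot_plan_def is_erot_plan_iff[OF assms] by simp

lemma prob_vectors_pos_ex:
  assumes "s \<in> prob_vectors"
  shows "\<exists>y. 0 < s y"
proof (rule ccontr)
  assume "\<not> (\<exists>y. 0 < s y)"
  then have "s = (\<lambda>_. 0)"
    using prob_vectorsD(1)[OF assms] by (auto simp: fun_eq_iff not_less intro: antisym)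
  then show False using prob_vectorsD(3)[OF assms] by simp
qed

lemma erot_plan_ex1:
  assumes r: "r \<in> prob_vectors" "r \<in> l1_space wX UNIV" and s: "s \<in> prob_vectors" "s \<in> l1_space PhiY UNIV"
  shows "\<exists>!q. is_erot_plan lam c r s q" "erot_plan lam c r s \<in> couplings r s"
proof -
  \<comment> \<open>Marginals in the domain need not charge a prescribed point, so the normalization
    is placed at some point that they do charge.\<close>
  obtain y0 where y0: "0 < s y0" using prob_vectors_pos_ex[OF s(1)] by blast
  interpret km: kernel_marginals kern phiY K r s y0 by (rule kernel_marginalsI[OF r(1) s y0])
  obtain a b where ab: "schroedinger_pair kern r s y0 a b" using km.schroedinger_pair_exists by blast
  show "\<exists>!q. is_erot_plan lam c r s q"
    unfolding is_erot_plan_iff[OF ab r s y0] by simp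
  show "erot_plan lam c r s \<in> couplings r s"
    unfolding erot_plan_eq[OF ab r s y0] by (rule gibbs_coupling[OF ab r(1) s(1)])
qed

lemma erot_plan_l1:
  assumes r: "r \<in> prob_vectors" "r \<in> l1_space wX UNIV" and s: "s \<in> prob_vectors" "s \<in> l1_space PhiY UNIV"
  shows "erot_plan lam c r s \<in> l1_space (wX \<oplus>\<^sub>t wY) UNIV"
proof -
  let ?q = "erot_plan lam c r s"
  have q: "?q \<in> couplings r s" by (rule erot_plan_ex1[OF assms])
  then have q0: "0 \<le> ?q z" for z unfolding couplings_def by blast
  have X: "(\<lambda>x. \<bar>wX x\<bar> * r x) summable_on UNIV"
    using l1_spaceD[OF r(2)] prob_vectorsD(1)[OF r(1)] by (simp add: cost_weight_def)
  have Y: "(\<lambda>y. \<bar>wY y\<bar> * s y) summable_on UNIV"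
  proof (rule summable_on_abs_le[OF l1_spaceD[OF s(2)]])
    show "\<bar>\<bar>wY y\<bar> * s y\<bar> \<le> PhiY y * \<bar>s y\<bar>" for y
      using mult_right_mono[OF PhiY_ge(1)[of y], of "\<bar>s y\<bar>"] wY_ge[of y] by (simp add: abs_mult)
  qed
  have "(\<lambda>z. wX (fst z) * ?q z + wY (snd z) * ?q z) summable_on UNIV"
    using has_sum_add[OF coupling_has_sum_fst[OF q X] coupling_has_sum_snd[OF q Y]]
    by (auto simp: summable_on_def)
  then show ?thesis
    using q0 by (simp add: l1_space_def dsum_def case_prod_unfold distrib_right)
qed

end

section \<open>The EROT plan at the base marginals and at their perturbations\<close>

locale base_marginals = dominated_cost c cXm cXp cYm cYp lam B
  for c :: "'x \<times> 'y \<Rightarrow> real" and cXm cXp :: "'x \<Rightarrow> real" and cYm cYp :: "'y \<Rightarrow> real" and lam B :: real +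
  fixes r :: "'x \<Rightarrow> real" and s :: "'y \<Rightarrow> real" and y1 :: 'y and a0 :: "'x \<Rightarrow> real" and b0 :: "'y \<Rightarrow> real"
  assumes r: "r \<in> prob_vectors" "r \<in> l1_space wX UNIV" "\<And>x. 0 < r x"
    and s: "s \<in> prob_vectors" "s \<in> l1_space PhiY UNIV" "\<And>y. 0 < s y"
    and pair: "schroedinger_pair kern r s y1 a0 b0"
begin

sublocale km: kernel_marginals kern phiY K r s y1
  by (rule kernel_marginalsI[OF r(1) s])

definition "p x y = kern x y * a0 x * b0 y"
text \<open>Products of the bounds in \<open>pair_bounds\<close>: \<open>M\<close> from
  \<open>kern x y \<le> 1\<close>, \<open>a0 x \<le> km.C\<close> and
  \<open>b0 y \<le> K * phiY y\<close>; then \<open>\<theta>\<close> from the lower bounds of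
  \<open>kern x y1\<close> and \<open>a0 x\<close> together with \<open>b0 y1 = 1\<close>.\<close>

definition "M = km.C * K"
definition "\<theta> = 1 / (K * phiY y1) * (1 / (K * km.S)) * s y1"

lemma pair_pos: "0 < a0 x" "0 < b0 y" "b0 y1 = 1"
  using pair by (auto simp: schroedinger_pair_def)

lemma pair_row: "((\<lambda>y. kern x y * b0 y * s y) has_sum 1 / a0 x) UNIV"
  and pair_col: "((\<lambda>x. kern x y * a0 x * r x) has_sum 1 / b0 y) UNIV"
  using pair by (auto simp: schroedinger_pair_def)

lemmas pair_bounds = km.schroedinger_pair_bounds[OF pair]

sublocale G: gibbs_density p r s phiY wY wX y1 M \<theta>
proof
  show "0 < p x y" for x y
    using km.k_pos[of x y] pair_pos by (simp add: p_def)
  show "p x y \<le> M * phiY y" for x y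
  proof -
    have "kern x y * a0 x * b0 y \<le> 1 * km.C * (K * phiY y)"
      using km.k_le[of x y] km.k_pos[of x y] pair_bounds(2)[of y] pair_bounds(4)[of x] pair_pos(1)[of x]
        pair_pos(2)[of y] km.C_ge
      unfolding km.C_def[symmetric] by (intro mult_mono) auto
    then show ?thesis by (simp add: p_def M_def mult_ac)
  qed
  show "((\<lambda>y. p x y * s y) has_sum 1) UNIV" for x
    using has_sum_cmult_right[OF pair_row[of x], of "a0 x"] pair_pos(1)[of x] by (simp add: p_def mult_ac)
  show "((\<lambda>x. p x y * r x) has_sum 1) UNIV" for y
    using has_sum_cmult_right[OF pair_col[of y], of "b0 y"] pair_pos(2)[of y] by (simp add: p_def mult_ac)
  show "1 \<le> M" using mult_mono[OF km.C_ge K_ge] km.C_ge by (simp add: M_def)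
  show "1 \<le> phiY y" for y by (rule phiY_ge)
  show "0 < \<theta>" using km.Kphi_pos[of y1] K_ge km.S_ge s(3)[of y1] by (simp add: \<theta>_def)
  show "\<theta> \<le> p x y1 * s y1" for x
  proof -
    have "1 / (K * phiY y1) * (1 / (K * km.S)) \<le> kern x y1 * a0 x"
      using km.k_lower[of y1 x] pair_bounds(3)[of x] km.k_pos[of x y1] K_ge km.S_ge
      by (intro mult_mono) auto
    then have "1 / (K * phiY y1) * (1 / (K * km.S)) * s y1 \<le> kern x y1 * a0 x * s y1"
      using s(3)[of y1] by (intro mult_right_mono) auto
    then show ?thesis unfolding \<theta>_def p_def pair_pos(3) mult_1_right .
  qed
  show "r \<in> prob_vectors" "s \<in> prob_vectors" "0 < r x" "0 < s y" "1 \<le> wX x" "1 \<le> wY y" for x y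
    using r s wX_ge wY_ge by auto
  show "(\<lambda>x. wX x * r x) summable_on UNIV"
    using l1_spaceD[OF r(2)] prob_vectorsD(1)[OF r(1)] by simp
  show "(\<lambda>y. wY y * phiY y ^ 4 * s y) summable_on UNIV"
    using l1_spaceD[OF s(2)] prob_vectorsD(1)[OF s(1)] by simp
qed

lemma Phi4_eq: "G.Phi4 = PhiY"
  by (simp add: G.Phi4_def)

lemma plan_eq: "erot_plan lam c r s = G.plan"
  unfolding erot_plan_eq[OF pair r(1,2) s(1,2,3)] gibbs_def G.plan_def p_def ..

lemma PhiY_s_bound: "\<bar>h y\<bar> \<le> l1_norm PhiY UNIV h" if "h \<in> l1_space PhiY UNIV"
proof -
  have "PhiY y * \<bar>h y\<bar> \<le> l1_norm PhiY UNIV h"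
    unfolding l1_norm_def
    by (rule has_sum_nonneg_le[OF has_sum_infsum[OF l1_spaceD[OF that]]])
      (intro mult_nonneg_nonneg abs_ge_zero order_trans[OF zero_le_one PhiY_ge(3)])
  moreover have "\<bar>h y\<bar> \<le> PhiY y * \<bar>h y\<bar>"
    using mult_right_mono[OF PhiY_ge(3)[of y], of "\<bar>h y\<bar>"] by simp
  ultimately show ?thesis by linarith
qed

text \<open>A sum of three bounds, so that it exceeds each: for \<open>v y / phiY y\<close>, for
  \<open>u\<close> and for \<open>1 / u\<close>. The \<open>2\<close> comes from
  \<open>s y1 / 2\<close> as lower bound for the perturbed mass at \<open>y1\<close>;
  \<open>G.nY s + N\<close> bounds the perturbed \<open>phiY\<close>-moment.\<close>

definition "Q N = K * phiY y1 * K + 2 * K * phiY y1 / s y1 * (K * km.S) + km.C * (K * (G.nY s + N))"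

text \<open>The perturbed marginals may have zeros, but \<open>t * N \<le> s y1 / 2\<close> keeps at
  least half of the mass at \<open>y1\<close>. Their scalings can thus be normalized at the same
  point as \<open>a0\<close>, \<open>b0\<close>, which makes the ratio \<open>v\<close> equal to
  \<open>1\<close> there.\<close>

lemma perturbed:
  assumes t: "0 < t" "t \<le> 1" "t * N \<le> s y1 / 2" and N: "1 \<le> N"
    and g: "g \<in> G.lX" "G.nX g \<le> N" and g0: "g0 \<in> G.lX" "G.nX g0 \<le> N" and gd: "G.nX (g - g0) \<le> d"
    and h: "h \<in> G.lY" "G.nY h \<le> N" and h0: "h0 \<in> G.lY" "G.nY h0 \<le> N" and hd: "G.nY (h - h0) \<le> d"
    and d: "0 \<le> d"
    and r': "r + t *\<^sub>R g \<in> prob_vectors \<inter> l1_space wX UNIV"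
    and s': "s + t *\<^sub>R h \<in> prob_vectors \<inter> l1_space PhiY UNIV"
  shows "\<exists>u v. perturbed_density p r s phiY wY wX y1 M \<theta> t g g0 u h h0 v (Q N) N d \<and>
    erot_plan lam c (r + t *\<^sub>R g) (s + t *\<^sub>R h) =
      (\<lambda>(x, y). p x y * u x * v y * (r x + t * g x) * (s y + t * h y))"
proof -
  have sy: "s y1 / 2 \<le> (s + t *\<^sub>R h) y1"
  proof -
    have "\<bar>h y1\<bar> \<le> N" using PhiY_s_bound[of h y1] h by (simp add: Phi4_eq)
    then have "t * \<bar>h y1\<bar> \<le> t * N" using t by (intro mult_left_mono) auto
    moreover have "- (t * \<bar>h y1\<bar>) \<le> t * h y1"
      using mult_left_mono[of "- \<bar>h y1\<bar>" "h y1" t] t(1) by simp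
    ultimately show ?thesis using t(3) by (simp add: scaleR_fun_def)
  qed
  then have sy0: "0 < (s + t *\<^sub>R h) y1" using s(3)[of y1] by linarith
  interpret kn: kernel_marginals kern phiY K "r + t *\<^sub>R g" "s + t *\<^sub>R h" y1
    by (rule kernel_marginalsI) (use r' s' sy0 in auto)
  obtain a b where ab: "schroedinger_pair kern (r + t *\<^sub>R g) (s + t *\<^sub>R h) y1 a b"
    using kn.schroedinger_pair_exists by blast
  have pos: "0 < a x" "0 < b y" and b1: "b y1 = 1"
    and row: "((\<lambda>y. kern x y * b y * (s + t *\<^sub>R h) y) has_sum 1 / a x) UNIV"
    and col: "((\<lambda>x. kern x y * a x * (r + t *\<^sub>R g) x) has_sum 1 / b y) UNIV" for x y
    using ab by (auto simp: schroedinger_pair_def)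
  note bounds = kn.schroedinger_pair_bounds[OF ab]
  have S': "kn.S \<le> G.nY s + N"
  proof -
    have "kn.S \<le> l1_norm PhiY UNIV (s + t *\<^sub>R h)"
      unfolding kn.S_def l1_norm_def
    proof (rule infsum_mono[OF kn.phi_s])
      show "(\<lambda>y. PhiY y * \<bar>(s + t *\<^sub>R h) y\<bar>) summable_on UNIV"
        by (rule l1_spaceD[of "s + t *\<^sub>R h"]) (use s' in blast)
      show "phiY y * (s + t *\<^sub>R h) y \<le> PhiY y * \<bar>(s + t *\<^sub>R h) y\<bar>" for y
        using PhiY_ge(2)[of y] phiY_ge[of y] kn.s_prob(1)[of y] by (intro mult_mono) auto
    qed
    also have "\<dots> \<le> l1_norm PhiY UNIV s + l1_norm PhiY UNIV (t *\<^sub>R h)"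
      using s(2) h(1) by (intro l1_space_add(2) l1_space_scaleR(1))
        (auto simp: Phi4_eq intro: order_trans[OF zero_le_one PhiY_ge(3)])
    also have "l1_norm PhiY UNIV (t *\<^sub>R h) = t * G.nY h"
      using l1_space_scaleR(2)[of h PhiY t] h(1) t(1) by (simp add: Phi4_eq)
    also have "t * G.nY h \<le> 1 * N"
      using t h(2) N G.nY_nonneg by (intro mult_mono) auto
    finally show ?thesis by (simp only: Phi4_eq mult_1)
  qed
  define u where "u x = a x / a0 x" for x
  define v where "v y = b y / b0 y" for y
  have uv_pos: "0 < u x" "0 < v y" for x y
    using pos pair_pos by (auto simp: u_def v_def)
  let ?Q1 = "K * phiY y1 * K" and ?Q2 = "2 * K * phiY y1 / s y1 * (K * km.S)"
    and ?Q3 = "km.C * (K * (G.nY s + N))"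
  have Kp: "0 < K" "0 < phiY y1" "0 < km.S"
    using K_ge phiY_ge[of y1] km.S_ge by auto
  have C1: "1 \<le> ?Q1" "0 \<le> ?Q2" "0 \<le> ?Q3"
  proof -
    show "1 \<le> ?Q1" using mult_mono[OF km.Kphi_ge[of y1] K_ge] km.Kphi_ge[of y1] by simp
    show "0 \<le> ?Q2" using Kp s(3)[of y1] by simp
    show "0 \<le> ?Q3" using Kp km.C_ge G.nY_nonneg[of s] N by simp
  qed
  have u_le: "u x \<le> ?Q2" for x
  proof -
    have "a x \<le> K * phiY y1 / (s y1 / 2)"
      using bounds(4)[of x] sy s(3)[of y1] Kp
      by (intro order_trans[OF bounds(4)] divide_left_mono) auto
    moreover have "1 / a0 x \<le> K * km.S"
      using pair_bounds(3)[of x] pair_pos(1)[of x] Kp by (simp add: divide_simps mult_ac)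
    ultimately have "a x * (1 / a0 x) \<le> K * phiY y1 / (s y1 / 2) * (K * km.S)"
      using pos(1)[of x] pair_pos(1)[of x] Kp s(3)[of y1] by (intro mult_mono) auto
    then show ?thesis by (simp add: u_def mult_ac)
  qed
  have u_ge: "1 / u x \<le> ?Q3" for x
  proof -
    have "1 / (K * kn.S) \<le> a x" by (rule bounds(3))
    then have "1 / a x \<le> K * kn.S"
      using pos(1)[of x] Kp kn.S_ge by (simp add: divide_simps mult_ac)
    also have "\<dots> \<le> K * (G.nY s + N)" using S' Kp by (intro mult_left_mono) auto
    finally have "a0 x * (1 / a x) \<le> km.C * (K * (G.nY s + N))"
      using pair_bounds(4)[of x] pos(1)[of x] pair_pos(1)[of x] km.C_ge
      unfolding km.C_def[symmetric] by (intro mult_mono) auto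
    then show ?thesis by (simp add: u_def)
  qed
  have v_le: "v y \<le> ?Q1 * phiY y" for y
  proof -
    have "1 / b0 y \<le> K * phiY y1"
      using pair_bounds(1)[of y] pair_pos(2)[of y] Kp by (simp add: divide_simps mult_ac)
    then have "b y * (1 / b0 y) \<le> (K * phiY y) * (K * phiY y1)"
      using bounds(2)[of y] pos(2)[of y] pair_pos(2)[of y] km.Kphi_pos[of y] by (intro mult_mono) auto
    then show ?thesis by (simp add: v_def mult_ac)
  qed
  have "perturbed_density p r s phiY wY wX y1 M \<theta> t g g0 u h h0 v (Q N) N d"
  proof (rule perturbed_density.intro[OF G.gibbs_density_axioms perturbed_density_axioms.intro])
    show "0 < t" "0 \<le> d" "0 \<le> N" using t d N by auto
    show "1 \<le> Q N" using C1 by (simp add: Q_def)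
    show "g \<in> G.lX" "G.nX g \<le> N" "g0 \<in> G.lX" "G.nX g0 \<le> N" "G.nX (g - g0) \<le> d"
      "h \<in> G.lY" "G.nY h \<le> N" "h0 \<in> G.lY" "G.nY h0 \<le> N" "G.nY (h - h0) \<le> d"
      by (fact g g0 gd h h0 hd)+
    show "0 < u x" "0 < v y" for x y by (fact uv_pos)+
    show "u x \<le> Q N" for x using u_le[of x] C1 unfolding Q_def by linarith
    show "1 / u x \<le> Q N" for x using u_ge[of x] C1 unfolding Q_def by linarith
    show "v y \<le> Q N * phiY y" for y
    proof -
      have "?Q1 * phiY y \<le> Q N * phiY y"
        using C1 phiY_ge[of y] by (intro mult_right_mono) (auto simp: Q_def)
      with v_le[of y] show ?thesis by linarith
    qed
    show "v y1 = 1" by (simp add: v_def b1 pair_pos)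
    show "((\<lambda>y. p x y * v y * (s y + t * h y)) has_sum 1 / u x) UNIV" for x
      using has_sum_cmult_right[OF row[of x], of "a0 x"] pair_pos(2)[THEN less_imp_neq]
      by (simp add: p_def v_def u_def scaleR_fun_def mult_ac)
    show "((\<lambda>x. p x y * u x * (r x + t * g x)) has_sum 1 / v y) UNIV" for y
      using has_sum_cmult_right[OF col[of y], of "b0 y"] pair_pos(1)[THEN less_imp_neq]
      by (simp add: p_def v_def u_def scaleR_fun_def mult_ac)
  qed
  moreover have "erot_plan lam c (r + t *\<^sub>R g) (s + t *\<^sub>R h) =
      (\<lambda>(x, y). p x y * u x * v y * (r x + t * g x) * (s y + t * h y))"
  proof -
    have "erot_plan lam c (r + t *\<^sub>R g) (s + t *\<^sub>R h) = gibbs a b (r + t *\<^sub>R g) (s + t *\<^sub>R h)"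
      by (rule erot_plan_eq[OF ab]) (use r' s' sy0 in auto)
    also have "\<dots> = (\<lambda>(x, y). p x y * u x * v y * (r x + t * g x) * (s y + t * h y))"
    proof -
      have "p x y * u x * v y = kern x y * a x * b y" for x y
        using pair_pos(1)[of x] pair_pos(2)[of y] by (simp add: p_def u_def v_def)
      then show ?thesis by (simp add: gibbs_def scaleR_fun_def fun_eq_iff)
    qed
    finally show ?thesis .
  qed
  ultimately show ?thesis by blast
qed

lemma hadamard_limit:
  assumes t: "\<And>n. 0 < t n" "t \<longlonglongrightarrow> 0"
    and r': "\<And>n. r + t n *\<^sub>R g n \<in> prob_vectors \<inter> l1_space wX UNIV"
    and s': "\<And>n. s + t n *\<^sub>R h n \<in> prob_vectors \<inter> l1_space PhiY UNIV"
    and g0: "g0 \<in> G.lX" and h0: "h0 \<in> G.lY"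
    and lim: "(\<lambda>n::nat. G.nX (g n - g0) + G.nY (h n - h0)) \<longlonglongrightarrow> 0"
  shows "(\<lambda>n. G.nV ((1 / t n) *\<^sub>R (erot_plan lam c (r + t n *\<^sub>R g n) (s + t n *\<^sub>R h n) -
    erot_plan lam c r s) - G.deriv_plan g0 h0)) \<longlonglongrightarrow> 0"
proof -
  define d where "d n = G.nX (g n - g0) + G.nY (h n - h0)" for n
  have d0: "0 \<le> d n" for n
    unfolding d_def by (intro add_nonneg_nonneg G.nX_nonneg G.nY_nonneg)
  \<comment> \<open>One more than the norms of the limiting directions, hence a bound for
    \<open>g n\<close> and \<open>h n\<close> as soon as \<open>d n \<le> 1\<close>.\<close>
  define N where "N = G.nX g0 + G.nY h0 + 1"
  have N: "1 \<le> N" using G.nX_nonneg[of g0] G.nY_nonneg[of h0] by (simp add: N_def)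
  have w0: "0 \<le> wX x" "0 \<le> G.Phi4 y" for x y
    using wX_ge[of x] G.Phi4_ge[of y] by linarith+
  have g_in: "g n \<in> G.lX" for n
  proof -
    have "g n = (1 / t n) *\<^sub>R ((r + t n *\<^sub>R g n) - r)" using t(1)[of n] by simp
    moreover have "(1 / t n) *\<^sub>R ((r + t n *\<^sub>R g n) - r) \<in> G.lX"
      by (intro l1_space_scaleR(1) l1_space_diff w0 r(2)) (use r'[of n] in simp)
    ultimately show ?thesis by simp
  qed
  have h_in: "h n \<in> G.lY" for n
  proof -
    have "h n = (1 / t n) *\<^sub>R ((s + t n *\<^sub>R h n) - s)" using t(1)[of n] by simp
    moreover have "(1 / t n) *\<^sub>R ((s + t n *\<^sub>R h n) - s) \<in> G.lY"
      by (intro l1_space_scaleR(1) l1_space_diff w0) (use s'[of n] s(2) in \<open>simp_all add: Phi4_eq\<close>)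
    ultimately show ?thesis by simp
  qed
  have nd: "G.nX (g n - g0) \<le> d n" "G.nY (h n - h0) \<le> d n" for n
    unfolding d_def using G.nX_nonneg[of "g n - g0"] G.nY_nonneg[of "h n - h0"] by linarith+
  have g_norm: "G.nX (g n) \<le> N" if "d n \<le> 1" for n
  proof -
    have "g n = g0 + (g n - g0)" by simp
    then have "G.nX (g n) \<le> G.nX g0 + G.nX (g n - g0)"
      using l1_space_add(2)[OF g0 l1_space_diff[OF g_in g0 w0(1)] w0(1)] by metis
    then show ?thesis using nd(1)[of n] that G.nY_nonneg[of h0] by (simp add: N_def)
  qed
  have h_norm: "G.nY (h n) \<le> N" if "d n \<le> 1" for n
  proof -
    have "h n = h0 + (h n - h0)" by simp
    then have "G.nY (h n) \<le> G.nY h0 + G.nY (h n - h0)"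
      using l1_space_add(2)[OF h0 l1_space_diff[OF h_in h0 w0(2)] w0(2)] by metis
    then show ?thesis using nd(2)[of n] that G.nX_nonneg[of g0] by (simp add: N_def)
  qed
  obtain C where C: "\<And>t g g0 u h h0 v d. perturbed_density p r s phiY wY wX y1 M \<theta> t g g0 u h h0 v (Q N) N d \<Longrightarrow>
    G.nV ((1 / t) *\<^sub>R ((\<lambda>(x, y). p x y * u x * v y * (r x + t * g x) * (s y + t * h y)) - G.plan) -
      G.deriv_plan g0 h0) \<le> C * (t + d)"
    using G.remainder_uniform[of "Q N" N] by blast
  have d_lim: "d \<longlonglongrightarrow> 0" using lim by (simp add: d_def[abs_def])
  have "eventually (\<lambda>n. d n < 1) sequentially"
    by (rule order_tendstoD(2)[OF d_lim]) simp
  moreover have "eventually (\<lambda>n. t n < 1) sequentially"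
    by (rule order_tendstoD(2)[OF t(2)]) simp
  moreover have "eventually (\<lambda>n. t n < s y1 / (2 * N)) sequentially"
    by (rule order_tendstoD(2)[OF t(2)]) (use s(3)[of y1] N in simp)
  ultimately have ev: "eventually (\<lambda>n. G.nV ((1 / t n) *\<^sub>R (erot_plan lam c (r + t n *\<^sub>R g n) (s + t n *\<^sub>R h n) -
    erot_plan lam c r s) - G.deriv_plan g0 h0) \<le> C * (t n + d n)) sequentially"
  proof eventually_elim
    case (elim n)
    have tN: "t n * N \<le> s y1 / 2"
      using elim(3) N by (simp add: pos_less_divide_eq field_simps less_imp_le)
    obtain u v where uv: "perturbed_density p r s phiY wY wX y1 M \<theta> (t n) (g n) g0 u (h n) h0 v (Q N) N (d n)"
      "erot_plan lam c (r + t n *\<^sub>R g n) (s + t n *\<^sub>R h n) =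
        (\<lambda>(x, y). p x y * u x * v y * (r x + t n * g n x) * (s y + t n * h n y))"
      using perturbed[OF t(1)[of n] _ tN N g_in[of n] g_norm g0 _ nd(1)[of n] h_in[of n] h_norm h0 _ nd(2)[of n] d0[of n] r'[of n] s'[of n]]
        elim G.nX_nonneg[of g0] G.nY_nonneg[of h0] by (auto simp: N_def)
    show ?case unfolding uv(2) plan_eq by (rule C[OF uv(1)])
  qed
  have V0: "0 \<le> (wX \<oplus>\<^sub>t wY) z" for z
    using wX_ge[of "fst z"] wY_ge[of "snd z"] by (simp add: dsum_def case_prod_unfold)
  have "(\<lambda>n. C * (t n + d n)) \<longlonglongrightarrow> C * (0 + 0)"
    by (intro tendsto_intros t d_lim)
  then have "(\<lambda>n. C * (t n + d n)) \<longlonglongrightarrow> 0" by simp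
  then show ?thesis
    by (intro tendsto_sandwich[OF always_eventually ev tendsto_const] allI l1_norm_nonneg V0)
qed

end

theorem theorem5p8:
  fixes c :: "'x::countable \<times> 'y::countable \<Rightarrow> real"
    and cXm cXp :: "'x \<Rightarrow> real" and cYm cYp :: "'y \<Rightarrow> real"
    and lam :: real and y1 :: 'y
    and r :: "'x \<Rightarrow> real" and s :: "'y \<Rightarrow> real"
  defines "CX \<equiv> cost_weight cXm cXp"
    and "CY \<equiv> cost_weight cYm cYp"
    and "phiY \<equiv> exp_weight lam cYm cYp"
  defines "Phi4 \<equiv> (\<lambda>y. CY y * phiY y ^ 4)"
  defines "U \<equiv> l1_space CX UNIV \<times> l1_space Phi4 UNIV"
    and "nU \<equiv> (\<lambda>(hX, hY). l1_norm CX UNIV hX + l1_norm Phi4 UNIV hY)"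
    and "U0 \<equiv> (prob_vectors \<inter> l1_space CX UNIV) \<times> (prob_vectors \<inter> l1_space Phi4 UNIV)"
    and "V \<equiv> l1_space (CX \<oplus>\<^sub>t CY) UNIV"
    and "nV \<equiv> l1_norm (CX \<oplus>\<^sub>t CY) UNIV"
    and "LX \<equiv> linf_space (\<lambda>_. 1) (UNIV :: 'x set)"
    and "LY \<equiv> linf_space phiY (- {y1})"
  defines "W \<equiv> V \<times> LX \<times> LY"
    and "\<pi> \<equiv> erot_plan lam c r s"
  defines "AX \<equiv> op_AX y1 \<pi> r" and "AY \<equiv> op_AY y1 \<pi> s"
    and "BX \<equiv> op_BX \<pi> r s" and "BY \<equiv> op_BY y1 \<pi> r s"
  defines "IX \<equiv> (\<lambda>a. a - AX (AY a))" and "IY \<equiv> (\<lambda>b. b - AY (AX b))"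
  defines "D \<equiv> (\<lambda>(hX, hY).
      - D_vars_inv_pi W lam y1 \<pi> (D_data y1 \<pi> r s (hX, omit y1 hY)))"
    and "E \<equiv> (\<lambda>(hX, hY).
      (\<lambda>z. \<pi> z / (r \<otimes>\<^sub>t s) z) * (r \<otimes>\<^sub>t hY + hX \<otimes>\<^sub>t s) -
      \<pi> * A_star_T y1
        (block_op (inv_into LX IX)                 (\<lambda>v. - inv_into LX IX (AX v))
                  (\<lambda>u. - AY (inv_into LX IX u))    (inv_into LY IY)
          (block_op (\<lambda>_. 0) BX
                    BY      (\<lambda>_. 0)
            (hX, hY))))"
  assumes lam: "lam > 0"
    and dom: "dominating c cXm cXp cYm cYp"
    and bdd: "cXp - cXm \<in> linf_space (\<lambda>_. 1) UNIV"
    and r: "r \<in> prob_vectors" "\<forall>x. r x > 0" "CX \<in> l1_space r UNIV"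
    and s: "s \<in> prob_vectors" "\<forall>y. s y > 0" "Phi4 \<in> l1_space s UNIV"
  shows "(\<forall>(r', s')\<in>U0. \<exists>!p. is_erot_plan lam c r' s' p) \<and>
    has_hadamard_derivative (\<lambda>(r', s'). erot_plan lam c r' s') D U nU U0 V nV (r, s) \<and>
    (\<forall>h\<in>contingent_cone U nU U0 (r, s).
       (\<exists>!w. w \<in> W \<and> D_vars lam y1 \<pi> w = D_data y1 \<pi> r s (fst h, omit y1 (snd h))) \<and>
       D h = E h) \<and>
    AX \<in> LY \<rightarrow> LX \<and> AY \<in> LX \<rightarrow> LY \<and>
    BX \<in> l1_space Phi4 UNIV \<rightarrow> LX \<and> BY \<in> l1_space CX UNIV \<rightarrow> LY \<and>
    bij_betw IX LX LX \<and> bij_betw IY LY LY \<and>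
    contingent_cone U nU U0 (r, s) =
      {hX \<in> l1_space CX UNIV. (\<Sum>\<^sub>\<infinity>x. hX x) = 0} \<times>
      {hY \<in> l1_space Phi4 UNIV. (\<Sum>\<^sub>\<infinity>y. hY y) = 0}"
proof -
  obtain B where B: "\<And>x. \<bar>(cXp - cXm) x\<bar> \<le> B"
    using bdd unfolding linf_space_UNIV_iff by blast
  have B0: "0 \<le> B" using order_trans[OF abs_ge_zero B] .
  have B': "cXp x - cXm x \<le> B" for x using B[of x] by simp
  interpret dc: dominated_cost c cXm cXp cYm cYp lam B
    by standard (use lam dom B' B0 in auto)
  have w: "dc.wX = CX" "dc.wY = CY" "dc.phiY = phiY" "dc.PhiY = Phi4" "(\<lambda>y. CY y * phiY y ^ 4) = Phi4"
    by (simp_all add: CX_def CY_def phiY_def Phi4_def)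
  have w_ge: "1 \<le> CX x" "1 \<le> Phi4 y" for x y
    using dc.wX_ge[of x] dc.PhiY_ge(3)[of y] by (simp_all add: w(1-3) Phi4_def)
  have r_l1: "r \<in> l1_space CX UNIV"
    using r(2,3) w_ge(1) by (simp add: l1_space_def mult.commute abs_of_pos order_less_le_trans[OF zero_less_one] less_imp_le)
  have s_l1: "s \<in> l1_space Phi4 UNIV"
    using s(2,3) w_ge(2) by (simp add: l1_space_def mult.commute abs_of_pos order_less_le_trans[OF zero_less_one] less_imp_le)
  have s_l1': "s \<in> l1_space dc.PhiY UNIV" unfolding w(4) by (rule s_l1)
  have r_l1': "r \<in> l1_space dc.wX UNIV" unfolding w(1) by (rule r_l1)
  interpret km: kernel_marginals dc.kern dc.phiY dc.K r s y1
    by (rule dc.kernel_marginalsI[OF r(1) s(1) s_l1']) (use s(2) in simp)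
  obtain a0 b0 where ab: "schroedinger_pair dc.kern r s y1 a0 b0"
    using km.schroedinger_pair_exists by blast
  interpret bm: base_marginals c cXm cXp cYm cYp lam B r s y1 a0 b0
    by standard (use r s r_l1' s_l1' ab in auto)
  have pi: "bm.G.plan = \<pi>" unfolding \<pi>_def by (rule bm.plan_eq[symmetric])
  have P4: "bm.G.Phi4 = Phi4" "gibbs_density.Phi4 phiY CY = Phi4"
    using trans[OF bm.Phi4_eq w(4)] unfolding w(1-3) by auto
  have ops: "op_AX y1 \<pi> r = AX" "op_AY y1 \<pi> s = AY" "op_BX \<pi> r s = BX" "op_BY y1 \<pi> r s = BY"
    by (simp_all add: AX_def AY_def BX_def BY_def)
  have sp: "linf_space (\<lambda>_. 1) UNIV = LX" "linf_space dc.phiY (- {y1}) = LY" "linf_space phiY (- {y1}) = LY"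
    by (simp_all add: LX_def LY_def w)
  have VW: "l1_space (dc.wX \<oplus>\<^sub>t dc.wY) UNIV = V" "l1_norm (dc.wX \<oplus>\<^sub>t dc.wY) UNIV = nV"
    by (simp_all add: V_def nV_def w)
  have cone: "contingent_cone U nU U0 (r, s) =
      {hX \<in> l1_space CX UNIV. infsum hX UNIV = 0} \<times> {hY \<in> l1_space Phi4 UNIV. infsum hY UNIV = 0}"
    unfolding U_def nU_def U0_def
    by (rule contingent_cone_prob_vectors) (use r(1,2) s(1,2) r_l1 s_l1 w_ge in auto)
  have span: "span (contingent_cone U nU U0 (r, s)) = contingent_cone U nU U0 (r, s)"
    unfolding cone by (intro span_eq_iff[THEN iffD2] subspace_Times subspace_mean_zero w_ge)
  have cone_l1: "fst h \<in> bm.G.lX" "snd h \<in> bm.G.lY" "infsum (snd h) UNIV = 0"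
    if "h \<in> contingent_cone U nU U0 (r, s)" for h
    using that unfolding cone P4 w by auto
  have W: "W = V \<times> LX \<times> LY" by (simp add: W_def)
  \<comment> \<open>On the cone the implicit and the explicit formula are both identified with
    \<open>deriv_plan\<close>: the first by unique solvability, the second by the block inverse. The
    mean-zero condition on the second component is what restores its omitted entry in
    \<open>D_data\<close>.\<close>
  have D_eq: "D h = bm.G.deriv_plan (fst h) (snd h)" if h: "h \<in> contingent_cone U nU U0 (r, s)" for h
    using bm.G.D_vars_inv_pi_eq[OF cone_l1[OF h] lam]
    unfolding VW sp pi by (simp add: D_def W case_prod_unfold)
  have E_eq: "E h = bm.G.deriv_plan (fst h) (snd h)" if h: "h \<in> contingent_cone U nU U0 (r, s)" for h
    using bm.G.deriv_plan_eq_block[OF cone_l1(1,2)[OF h]]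
    unfolding pi ops sp by (simp add: E_def IX_def IY_def case_prod_unfold)
  have plan_V: "erot_plan lam c r' s' \<in> V" if "(r', s') \<in> U0" for r' s'
    using dc.erot_plan_l1[of r' s'] that unfolding VW by (simp add: U0_def w)
  have unique: "\<exists>!p. is_erot_plan lam c r' s' p" if "(r', s') \<in> U0" for r' s'
    using dc.erot_plan_ex1(1)[of r' s'] that by (simp add: U0_def w)
  have linear: "bounded_linear_between (span (contingent_cone U nU U0 (r, s))) nU V nV D"
    unfolding span bounded_linear_between_def
  proof (intro conjI ballI allI)
    let ?T = "contingent_cone U nU U0 (r, s)"
    have sub: "subspace ?T" using subspace_span[of ?T] unfolding span .
    obtain K where "\<forall>hX\<in>bm.G.lX. \<forall>hY\<in>bm.G.lY. bm.G.deriv_plan hX hY \<in> V \<and>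
        nV (bm.G.deriv_plan hX hY) \<le> K * (bm.G.nX hX + bm.G.nY hY)"
      using bm.G.deriv_plan_bound unfolding VW by (rule exE)
    then have K: "bm.G.deriv_plan (fst h) (snd h) \<in> V"
        "nV (bm.G.deriv_plan (fst h) (snd h)) \<le> K * (bm.G.nX (fst h) + bm.G.nY (snd h))"
      if "h \<in> ?T" for h using cone_l1(1,2)[OF that] by simp_all
    show "D h \<in> V" if "h \<in> ?T" for h
      using K(1)[OF that] by (simp add: D_eq[OF that])
    show "D (h + k) = D h + D k" if "h \<in> ?T" "k \<in> ?T" for h k
      using bm.G.deriv_plan_linear(1)[OF cone_l1(1,2)[OF that(1)] cone_l1(1,2)[OF that(2)]]
      by (simp add: D_eq that subspace_add[OF sub])
    show "D (a *\<^sub>R h) = a *\<^sub>R D h" if "h \<in> ?T" for h a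
      using bm.G.deriv_plan_linear(2)[OF cone_l1(1,2)[OF that] cone_l1(1,2)[OF that]]
      by (simp add: D_eq that subspace_scale[OF sub])
    show "\<exists>K. \<forall>h\<in>?T. nV (D h) \<le> K * nU h"
    proof (intro exI ballI)
      show "nV (D h) \<le> K * nU h" if "h \<in> ?T" for h
        using K(2)[OF that] by (simp add: D_eq[OF that] nU_def case_prod_unfold P4 w)
    qed
  qed
  have limit: "(\<lambda>n. nV ((1 / t n) *\<^sub>R ((\<lambda>(r', s'). erot_plan lam c r' s') ((r, s) + t n *\<^sub>R h n) -
      (\<lambda>(r', s'). erot_plan lam c r' s') (r, s)) - D h0)) \<longlonglongrightarrow> 0"
    if t: "\<And>n::nat. 0 < t n" "\<And>n. (r, s) + t n *\<^sub>R h n \<in> U0" "t \<longlonglongrightarrow> 0"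
      and h0: "h0 \<in> U" and lim: "(\<lambda>n. nU (h n - h0)) \<longlonglongrightarrow> 0"
    for t h h0
  proof -
    \<comment> \<open>Limits of admissible directions lie in the cone by definition; this supplies
      the mean-zero condition under which \<open>D\<close> equals \<open>deriv_plan\<close>.\<close>
    have hT: "h0 \<in> contingent_cone U nU U0 (r, s)"
      unfolding contingent_cone_def
    proof (rule CollectI, rule conjI[OF h0], rule exI[of _ t], rule exI[of _ "\<lambda>n. (r, s) + t n *\<^sub>R h n"],
        intro conjI allI t)
      have "(1 / t n) *\<^sub>R ((r, s) + t n *\<^sub>R h n - (r, s)) = h n" for n
        using t(1)[of n] by simp
      then show "(\<lambda>n. nU ((1 / t n) *\<^sub>R ((r, s) + t n *\<^sub>R h n - (r, s)) - h0)) \<longlonglongrightarrow> 0"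
        using lim by (simp only:)
    qed
    have step: "(r, s) + t n *\<^sub>R h n = (r + t n *\<^sub>R fst (h n), s + t n *\<^sub>R snd (h n))" for n
      by (simp add: prod_eq_iff)
    have "r + t n *\<^sub>R fst (h n) \<in> prob_vectors \<inter> l1_space dc.wX UNIV"
      "s + t n *\<^sub>R snd (h n) \<in> prob_vectors \<inter> l1_space dc.PhiY UNIV" for n
      using t(2)[of n] unfolding step U0_def w by auto
    moreover have "(\<lambda>n. bm.G.nX (fst (h n) - fst h0) + bm.G.nY (snd (h n) - snd h0)) \<longlonglongrightarrow> 0"
      using lim by (simp add: nU_def case_prod_unfold P4 w)
    ultimately have "(\<lambda>n. bm.G.nV ((1 / t n) *\<^sub>R (erot_plan lam c (r + t n *\<^sub>R fst (h n)) (s + t n *\<^sub>R snd (h n)) -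
        erot_plan lam c r s) - bm.G.deriv_plan (fst h0) (snd h0))) \<longlonglongrightarrow> 0"
      by (intro bm.hadamard_limit t cone_l1[OF hT])
    then show ?thesis unfolding step VW D_eq[OF hT] by simp
  qed
  have hadamard: "has_hadamard_derivative (\<lambda>(r', s'). erot_plan lam c r' s') D U nU U0 V nV (r, s)"
    unfolding has_hadamard_derivative_def
  proof (intro conjI allI impI linear)
    show "U0 \<subseteq> U" by (auto simp: U0_def U_def)
    show "(r, s) \<in> U0" using r(1) s(1) r_l1 s_l1 by (simp add: U0_def)
    show "(\<lambda>(r', s'). erot_plan lam c r' s') \<in> U0 \<rightarrow> V" using plan_V by auto
  qed (use limit in blast)
  have solution: "\<exists>!w. w \<in> W \<and> D_vars lam y1 \<pi> w = D_data y1 \<pi> r s (fst h, omit y1 (snd h))"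
    if h: "h \<in> contingent_cone U nU U0 (r, s)" for h
    using bm.G.D_vars_unique_solution[OF cone_l1[OF h] lam] unfolding VW sp pi W by simp
  show ?thesis
  proof (intro conjI)
    show "\<forall>(r', s')\<in>U0. \<exists>!p. is_erot_plan lam c r' s' p" using unique by blast
    show "has_hadamard_derivative (\<lambda>(r', s'). erot_plan lam c r' s') D U nU U0 V nV (r, s)" by (rule hadamard)
    show "\<forall>h\<in>contingent_cone U nU U0 (r, s).
        (\<exists>!w. w \<in> W \<and> D_vars lam y1 \<pi> w = D_data y1 \<pi> r s (fst h, omit y1 (snd h))) \<and> D h = E h"
      using solution D_eq E_eq by simp
    show "AX \<in> LY \<rightarrow> LX" using bm.G.AX_in unfolding pi ops sp .
    show "AY \<in> LX \<rightarrow> LY" using bm.G.AY_in unfolding pi ops sp .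
    show "BX \<in> l1_space Phi4 UNIV \<rightarrow> LX" using bm.G.BX_in unfolding pi ops sp P4 .
    show "BY \<in> l1_space CX UNIV \<rightarrow> LY" using bm.G.BY_in unfolding pi ops sp w .
    show "bij_betw IX LX LX" using bm.G.IX_bij unfolding pi ops sp IX_def .
    show "bij_betw IY LY LY" using bm.G.IY_bij unfolding pi ops sp IY_def .
    show "contingent_cone U nU U0 (r, s) =
      {hX \<in> l1_space CX UNIV. (\<Sum>\<^sub>\<infinity>x. hX x) = 0} \<times> {hY \<in> l1_space Phi4 UNIV. (\<Sum>\<^sub>\<infinity>y. hY y) = 0}"
      by (rule cone)
  qed
qed

end
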